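(* Let $V$ be a $\mathcal{T}$-vertex algebra, let $A$ be an abelian group, and let $\{\mathcal{I}_{i,j}^{i+j}\}_{i,j\in A}$ be a one-dimensional $\mathcal{T}$-commutativity datum for a $\mathcal{T}$-compatible set of $V$-modules $\{M_i\}_{i\in A}$ in $\mathcal{T}$ with $M_0=V$. Then the sum $\bigoplus_{i\in A}M_i$ admits a vertex algebra structure induced by the intertwining operators (that is, by some choice of nonzero elements of the spaces $\mathcal{I}_{i,j}^{i+j}$) if and only if for each coset $2A+k$ in $A$, there exist some representative $i\in2A+k$ and a (nonzero) even intertwining operator $m^{i,i}_z\in\mathcal{I}_{i,i}^{2i}$.
   Context: Power series. All vector spaces are over $\mathbb{C}$; all series have integer exponents. $M((z))((w))$ means Laurent series in $w$ with coefficients in $M((z))$. The space $M[[z,w]][z^{-1},w^{-1},(z-w)^{-1}]$ consists of series landing in $M[[z,w]]$ after multiplication by a power of $zw(z-w)$; it embeds in $M((z))((w))$, $M((w))((z))$, $M((w))((z-w))$ by the binomial expansions $(z-w)^n=z^n(1-w/z)^n$, $(z-w)^n=(-1)^nw^n(1-z/w)^n$, $z^n=w^n(1+\frac{z-w}{w})^n$ respectively. Maps into the larger spaces are compared by factoring them through this common subspace. Vertex algebras. A vertex algebra is $(V,\mathbf 1,L(-1),m_z)$ with $\mathbf 1\in V$, $L(-1)\in\mathrm{End}(V)$, $m_z:V\otimes V\to V((z))$ linear, such that $m_z(\mathbf 1\otimes v)=v$, $m_z(v\otimes\mathbf 1)\in v+zV[[z]]$, $L(-1)m_z(u\otimes v)-m_z(u\otimes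 L(-1)v)=\frac{d}{dz}m_z(u\otimes v)$, and $m_z(u\otimes m_w(v\otimes x))$, $m_w(v\otimes m_z(u\otimes x))$ are expansions of the same element of $V[[z,w]][z^{-1},w^{-1},(z-w)^{-1}]$. It is weighted if equipped with $L(0)$ acting semisimply with integer eigenvalues ($V=\bigoplus_n V_n$), $[L(-1),L(0)]=-L(-1)$, and $L(0)m_z(u\otimes v)-m_z(u\otimes L(0)v)=m_z(L(0)u\otimes v)+zm_z(L(-1)u\otimes v)$. It is Möbius (resp. quasi-conformal) if weighted with an operator $L(1)$ (resp. operators $L(i)$, $i\ge-1$) satisfying $[L(i),L(j)]=(i-j)L(i+j)$, $L(i)m_z(u\otimes v)-m_z(u\otimes L(i)v)=\sum_{j=0}^{i+1}\binom{i+1}{j}z^jm_z(L(i-j)u\otimes v)$, and such that the span of the $L(i)$ with $i\ge1$ acts locally nilpotently. It is conformal of central charge $c$ if weighted with $\omega\in V_2$ such that $m_z(\omega\otimes v)=\sum_nL(n)vz^{-n-2}$ gives operators satisfying the Virasoro relations of central charge $c$. A vertex operator algebra (VOA) is a conformal vertex algebra with $L(0)$-eigenvalues bounded below and finite dimensional $L(0)$-eigenspaces. Modules. A $V$-module is a vector space $M$ with $act_z:V\otimes M\to M((z))$ and an operator $L(-1)^M$ such that $act_z(\mathbf 1\otimes x)=x$, $L(-1)^Mact_z(u\otimes x)-act_z(u\otimes L(-1)^Mx)=act_z(L(-1)u\otimes x)$, and $act_w(m_{z-w}(u\otimes v)\otimes x)\in M((w))((z-w))$, $act_z(u\otimes act_w(v\otimes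 x))\in M((z))((w))$ are expansions of the same element of $M[[z,w]][z^{-1},w^{-1},(z-w)^{-1}]$. If $V$ is weighted (resp. Möbius, quasi-conformal), an integral-weight module also carries the corresponding operators $L(i)^M$, with $L(0)^M$ semisimple with integer eigenvalues, $[L(i)^M,L(j)^M]=(i-j)L(i+j)^M$, $L(i)^Mact_z(u\otimes x)-act_z(u\otimes L(i)^Mx)=\sum_{j=0}^{i+1}\binom{i+1}{j}z^jact_z(L(i-j)u\otimes x)$, and the span of the $L(i)^M$, $i\ge1$, acting locally nilpotently. If $V$ is conformal one also requires that the coefficients of $act_z(\omega\otimes\cdot)$ give a Virasoro representation of central charge $c$; if $V$ is a VOA, also that $L(0)^M$ has spectrum bounded below and finite dimensional eigenspaces. Intertwining operators. An integral-weight intertwining operator of type $\binom{M_3}{M_1M_2}$ is a linear map $I_z:M_1\otimes M_2\to M_3((z))$ with $\frac{d}{dz}I_z(u\otimes v)=I_z(L(-1)u\otimes v)=L(-1)I_z(u\otimes v)-I_z(u\otimes L(-1)v)$, and such that $act_z(a\otimes I_w(u\otimes v))$, $I_w(act_{z-w}(a\otimes u)\otimes v)$, $I_w(u\otimes act_z(a\otimes v))$ are expansions (in $M_3((z))((w))$, $M_3((w))((z-w))$, $M_3((w))((z))$) of the same element of $M_3[[z,w]][z^{-1},w^{-1},(z-w)^{-1}]$ for $a\in V$. In the presence of operators $L(i)$ one also requires $L(i)I_z(u\otimes v)-I_z(u\otimes L(i)v)=\sum_{j=0}^{i+1}\binom{i+1}{j}z^jI_z(L(i-j)u\otimes v)$.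 Its skew $I^*_z:M_2\otimes M_1\to M_3((z))$ is $I^*_z(v\otimes u)=e^{zL(-1)}I_{-z}(u\otimes v)$, again an intertwining operator. Types. $\mathcal{T}$ denotes one of the following settings: (a) unrestricted: vertex algebras, with modules, module maps and integral-weight intertwining operators; (b) weighted, Möbius, quasi-conformal or conformal vertex algebras, with integral-weight modules of the corresponding kind and with module maps and intertwining operators compatible with all defined $L(i)$; (c) VOAs, with integral-weight VOA modules; (d) strictly $G$-equivariant versions of these for a group $G$ acting on $V$ by automorphisms and on modules by operators commuting with all $L(i)$ and satisfying $act_z(gv\otimes gu)=g\,act_z(v\otimes u)$, with equivariant module maps and intertwining operators. $I_{\mathcal{T}}\binom{M_3}{M_1,M_2}$ is the space of $\mathcal{T}$-intertwining operators. A set of modules in $\mathcal{T}$ is $\mathcal{T}$-compatible if its direct sum is a module in $\mathcal{T}$. Data. A one-dimensional $\mathcal{T}$-associativity datum for $\{M_i\}_{i\in A}$ ($M_0=V$) is a set of one-dimensional subspaces $\mathcal{I}_{i,j}^{i+j}\subset I_{\mathcal{T}}\binom{M_{i+j}}{M_i,M_j}$ such that: (i) for all $i,j,k$ there is a one-dimensional space $\mathcal{I}_{i,j,k}^{i+j+k}$ of maps $M_i\otimes M_j\otimes M_k\to M_{i+j+k}[[z,w]][z^{-1},w^{-1},(z-w)^{-1}]$ such that the compositions $m^{i,j+k}_z\circ(1\otimes m^{j,k}_w)$ (into $M_{i+j+k}((z))((w))$) and $m^{i+j,k}_w\circ(m^{i,j}_{z-w}\otimes1)$ (into $M_{i+j+k}((w))((z-w))$)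 factor through the embeddings and induce isomorphisms $\mathcal{I}_{i,j+k}^{i+j+k}\otimes\mathcal{I}_{j,k}^{j+k}\cong\mathcal{I}_{i,j,k}^{i+j+k}$ and $\mathcal{I}_{i+j,k}^{i+j+k}\otimes\mathcal{I}_{i,j}^{i+j}\cong\mathcal{I}_{i,j,k}^{i+j+k}$; (ii) for all $i,j,k,\ell$ there is a one-dimensional space $\mathcal{I}_{i,j,k,\ell}^{i+j+k+\ell}$ of maps $M_i\otimes M_j\otimes M_k\otimes M_\ell\to M_{i+j+k+\ell}[[z,w,t]][z^{-1},w^{-1},t^{-1},(z-w)^{-1},(z-t)^{-1},(w-t)^{-1}]$ such that composition $m_z\circ(1\otimes m_w)\circ(1\otimes1\otimes m_t)$ (into $M_{i+j+k+\ell}((z))((w))((t))$, with the analogous binomial expansions) induces an isomorphism $\mathcal{I}_{i,j+k+\ell}^{i+j+k+\ell}\otimes\mathcal{I}_{j,k+\ell}^{j+k+\ell}\otimes\mathcal{I}_{k,\ell}^{k+\ell}\cong\mathcal{I}_{i,j,k,\ell}^{i+j+k+\ell}$; (iii) $\mathcal{I}_{0,i}^i$ is spanned by the module structure map $act_z$ of $M_i$, and $\mathcal{I}_{i,0}^i$ by $act^*_z$. It is a commutativity datum if moreover for every nonzero $m^{i,j}_z\in\mathcal{I}_{i,j}^{i+j}$ one has $m^{i,j,*}_z\in\mathcal{I}_{j,i}^{j+i}$. Evenness. A $\mathcal{T}$-intertwining operator $I_z:M_1\otimes M_1\to M_2((z))$ is even if either (1) $I_z(u\otimes u)=0$ for all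 $u$, and whenever $I_z(u\otimes v)\ne0$ its lowest-order exponent of $z$ is odd; or (2) there is $u$ with $I_z(u\otimes u)\neq0$ having even lowest-order exponent. $2A=\{i+i\mid i\in A\}$. *)

theory Defs
  imports
    Complex_Main
    "HOL-Library.Function_Algebras"
    "HOL-Computational_Algebra.Formal_Laurent_Series"
    "HOL-Algebra.Group"
begin

notation fls_nth (infixl \<open>$$\<close> 75)

section \<open>Complex vector spaces\<close>

text \<open>
  The complex analogue of \<^class>\<open>real_vector\<close>. A vector space is a subspace of a type
  of this class.
\<close>

class complex_vector = ab_group_add +
  fixes scaleC :: "complex \<Rightarrow> 'a \<Rightarrow> 'a"  (infixr \<open>*\<^sub>C\<close> 75)
  assumes scaleC_add_right: "a *\<^sub>C (x + y) = a *\<^sub>C x + a *\<^sub>C y"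
    and scaleC_add_left: "(a + b) *\<^sub>C x = a *\<^sub>C x + b *\<^sub>C x"
    and scaleC_scaleC: "a *\<^sub>C b *\<^sub>C x = (a * b) *\<^sub>C x"
    and scaleC_one: "1 *\<^sub>C x = x"

global_interpretation cvec: vector_space "scaleC :: complex \<Rightarrow> 'a \<Rightarrow> 'a::complex_vector"
  by unfold_locales (fact scaleC_add_right scaleC_add_left scaleC_scaleC scaleC_one)+

instantiation "fun" :: (type, complex_vector) complex_vector
begin

definition scaleC_fun_def: "c *\<^sub>C f = (\<lambda>x. c *\<^sub>C f x)"

instance
  by standard
    (simp_all add: scaleC_fun_def fun_eq_iff cvec.scale_right_distrib cvec.scale_left_distrib)

end

lemma scaleC_fun_apply [simp]: "(c *\<^sub>C f) x = c *\<^sub>C f x"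
  by (simp add: scaleC_fun_def)

instantiation fls :: (complex_vector) complex_vector
begin

lift_definition scaleC_fls :: "complex \<Rightarrow> 'a fls \<Rightarrow> 'a fls" is "\<lambda>c f n. c *\<^sub>C f n"
  by (auto elim: eventually_mono)

instance
proof
  fix a b :: complex and x y :: "'a fls"
  show "a *\<^sub>C (x + y) = a *\<^sub>C x + a *\<^sub>C y"
    by (simp add: fls_eq_iff scaleC_fls.rep_eq cvec.scale_right_distrib)
  show "(a + b) *\<^sub>C x = a *\<^sub>C x + b *\<^sub>C x"
    by (simp add: fls_eq_iff scaleC_fls.rep_eq cvec.scale_left_distrib)
  show "a *\<^sub>C b *\<^sub>C x = (a * b) *\<^sub>C x"
    by (simp add: fls_eq_iff scaleC_fls.rep_eq)
  show "1 *\<^sub>C x = x"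
    by (simp add: fls_eq_iff scaleC_fls.rep_eq)
qed

end

lemma fls_scaleC_nth [simp]: "(c *\<^sub>C F) $$ n = c *\<^sub>C (F $$ n)"
  by (simp add: scaleC_fls.rep_eq)

definition linear_on ::
    "'a::complex_vector set \<Rightarrow> 'b::complex_vector set \<Rightarrow> ('a \<Rightarrow> 'b) \<Rightarrow> bool" where
  "linear_on S U f \<longleftrightarrow>
     (\<forall>x\<in>S. f x \<in> U) \<and> (\<forall>x\<in>S. \<forall>y\<in>S. f (x + y) = f x + f y) \<and>
     (\<forall>c. \<forall>x\<in>S. f (c *\<^sub>C x) = c *\<^sub>C f x)"

text \<open>
  Linear maps out of a tensor product of subspaces, given as multilinear maps. The values outside
  the given subspaces are normalised to \<open>0\<close>, so that such maps are equal as HOL functions iff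
  they agree on the subspaces, and spaces of them (and their dimensions) can be
  formed inside the function type.
\<close>

definition bilinear_map :: "'a::complex_vector set \<Rightarrow> 'b::complex_vector set \<Rightarrow>
    'c::complex_vector set \<Rightarrow> ('a \<Rightarrow> 'b \<Rightarrow> 'c) \<Rightarrow> bool" where
  "bilinear_map S T U f \<longleftrightarrow>
     (\<forall>x\<in>S. linear_on T U (\<lambda>y. f x y)) \<and> (\<forall>y\<in>T. linear_on S U (\<lambda>x. f x y)) \<and>
     (\<forall>x y. x \<notin> S \<or> y \<notin> T \<longrightarrow> f x y = 0)"

definition trilinear_map :: "'a::complex_vector set \<Rightarrow> 'b::complex_vector set \<Rightarrow>
    'c::complex_vector set \<Rightarrow> 'd::complex_vector set \<Rightarrow> ('a \<Rightarrow> 'b \<Rightarrow> 'c \<Rightarrow> 'd) \<Rightarrow> bool" where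
  "trilinear_map S T R U f \<longleftrightarrow>
     (\<forall>x\<in>S. bilinear_map T R U (\<lambda>y z. f x y z)) \<and>
     (\<forall>y\<in>T. \<forall>z\<in>R. linear_on S U (\<lambda>x. f x y z)) \<and>
     (\<forall>x y z. x \<notin> S \<longrightarrow> f x y z = 0)"

definition quadrilinear_map :: "'a::complex_vector set \<Rightarrow> 'b::complex_vector set \<Rightarrow>
    'c::complex_vector set \<Rightarrow> 'd::complex_vector set \<Rightarrow> 'e::complex_vector set \<Rightarrow>
    ('a \<Rightarrow> 'b \<Rightarrow> 'c \<Rightarrow> 'd \<Rightarrow> 'e) \<Rightarrow> bool" where
  "quadrilinear_map S T R Q U f \<longleftrightarrow>
     (\<forall>x\<in>S. trilinear_map T R Q U (\<lambda>y z w. f x y z w)) \<and>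
     (\<forall>y\<in>T. \<forall>z\<in>R. \<forall>w\<in>Q. linear_on S U (\<lambda>x. f x y z w)) \<and>
     (\<forall>x y z w. x \<notin> S \<longrightarrow> f x y z w = 0)"

definition is_basis :: "'a::complex_vector set \<Rightarrow> 'a set \<Rightarrow> bool" where
  "is_basis B X \<longleftrightarrow> cvec.independent B \<and> cvec.span B = X"

definition one_dimensional :: "'a::complex_vector set \<Rightarrow> bool" where
  "one_dimensional X \<longleftrightarrow> cvec.subspace X \<and> cvec.dim X = 1"

text \<open>
  The linear map out of the tensor product induced by a multilinear map is an isomorphism onto
  \<open>Z\<close> iff it sends the basis of pure tensors \<open>b \<otimes> c\<close> bijectively onto a basis of \<open>Z\<close>.
\<close>

definition induces_iso2 :: "'a::complex_vector set \<Rightarrow> 'b::complex_vector set \<Rightarrow>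
    'c::complex_vector set \<Rightarrow> ('a \<Rightarrow> 'b \<Rightarrow> 'c) \<Rightarrow> bool" where
  "induces_iso2 X Y Z \<phi> \<longleftrightarrow> bilinear_map X Y Z \<phi> \<and>
     (\<exists>B C. is_basis B X \<and> is_basis C Y \<and>
        inj_on (\<lambda>(b, c). \<phi> b c) (B \<times> C) \<and> is_basis ((\<lambda>(b, c). \<phi> b c) ` (B \<times> C)) Z)"

definition induces_iso3 :: "'a::complex_vector set \<Rightarrow> 'b::complex_vector set \<Rightarrow>
    'c::complex_vector set \<Rightarrow> 'd::complex_vector set \<Rightarrow> ('a \<Rightarrow> 'b \<Rightarrow> 'c \<Rightarrow> 'd) \<Rightarrow> bool" where
  "induces_iso3 X Y W Z \<phi> \<longleftrightarrow> trilinear_map X Y W Z \<phi> \<and>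
     (\<exists>B C D. is_basis B X \<and> is_basis C Y \<and> is_basis D W \<and>
        inj_on (\<lambda>(b, c, d). \<phi> b c d) (B \<times> C \<times> D) \<and>
        is_basis ((\<lambda>(b, c, d). \<phi> b c d) ` (B \<times> C \<times> D)) Z)"


section \<open>Localised power series\<close>

text \<open>
  \<open>M((z))\<close> is the space of Laurent series in \<^typ>\<open>'m fls\<close> with coefficients in \<open>M\<close>.
  Elements of iterated Laurent series spaces such as \<open>M((z))((w))\<close> are represented by their
  coefficient functions \<open>int \<Rightarrow> int \<Rightarrow> 'm\<close>.
\<close>

definition laurent :: "'m::zero set \<Rightarrow> 'm fls set" where
  "laurent M = {F. \<forall>n. F $$ n \<in> M}"

text \<open>
  An element of the localisation of a space \<open>X\<close> at an injective linear operator \<open>D\<close> is a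
  fraction \<open>D\<^sup>-\<^sup>N g\<close>, represented by the pair \<open>(N, g)\<close>.
\<close>

definition frac_rel :: "('x \<Rightarrow> 'x) \<Rightarrow> nat \<times> 'x \<Rightarrow> nat \<times> 'x \<Rightarrow> bool" where
  "frac_rel D = (\<lambda>(N, g) (N', g'). (D ^^ N') g = (D ^^ N) g')"

definition frac_add :: "('x \<Rightarrow> 'x) \<Rightarrow> nat \<times> 'x \<Rightarrow> nat \<times> 'x \<Rightarrow> nat \<times> 'x::plus" where
  "frac_add D = (\<lambda>(N, g) (N', g'). (N + N', (D ^^ N') g + (D ^^ N) g'))"

lemma funpow_funpow: "(D ^^ a) ((D ^^ b) x) = (D ^^ (a + b)) x"
  by (simp add: funpow_add)

lemma frac_rel_equivp:
  assumes "inj D"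
  shows "equivp (frac_rel D)"
proof (rule equivpI)
  have inj: "inj (D ^^ n)" for n
    using assms by (rule inj_fn)
  show "reflp (frac_rel D)"
    by (auto simp: reflp_def frac_rel_def)
  show "symp (frac_rel D)"
    by (auto simp: symp_def frac_rel_def)
  show "transp (frac_rel D)"
  proof (rule transpI)
    fix p q r
    assume pq: "frac_rel D p q" and qr: "frac_rel D q r"
    obtain a x b y c z where eqs: "p = (a, x)" "q = (b, y)" "r = (c, z)"
      by (metis surj_pair)
    have 1: "(D ^^ b) x = (D ^^ a) y" and 2: "(D ^^ c) y = (D ^^ b) z"
      using pq qr by (simp_all add: eqs frac_rel_def)
    have "(D ^^ b) ((D ^^ c) x) = (D ^^ c) ((D ^^ b) x)"
      by (simp add: funpow_funpow add.commute)
    also have "\<dots> = (D ^^ a) ((D ^^ c) y)"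
      by (simp add: 1 funpow_funpow add.commute)
    also have "\<dots> = (D ^^ b) ((D ^^ a) z)"
      by (simp add: 2 funpow_funpow add.commute)
    finally show "frac_rel D p r"
      by (simp add: eqs frac_rel_def inj_eq[OF inj])
  qed
qed

lemma funpow_additive:
  fixes D :: "'x::ab_group_add \<Rightarrow> 'x"
  assumes add: "\<And>x y. D (x + y) = D x + D y"
  shows "(D ^^ n) (x + y) = (D ^^ n) x + (D ^^ n) y"
    and "(D ^^ n) 0 = 0"
    and "(D ^^ n) (- x) = - (D ^^ n) x"
proof -
  show 1: "(D ^^ n) (x + y) = (D ^^ n) x + (D ^^ n) y" for x y
    by (induction n) (simp_all add: add)
  from 1[of 0 0] show 2: "(D ^^ n) 0 = 0"
    by simp
  from 1[of x "- x"] 2 show "(D ^^ n) (- x) = - (D ^^ n) x"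
    by (simp add: eq_neg_iff_add_eq_0 add.commute)
qed

lemma funpow_scale:
  fixes D :: "'x::complex_vector \<Rightarrow> 'x"
  assumes "\<And>c x. D (c *\<^sub>C x) = c *\<^sub>C D x"
  shows "(D ^^ n) (c *\<^sub>C x) = c *\<^sub>C (D ^^ n) x"
  by (induction n) (simp_all add: assms)

lemma frac_add_rsp:
  fixes D :: "'x::ab_group_add \<Rightarrow> 'x"
  assumes add: "\<And>x y. D (x + y) = D x + D y"
    and "frac_rel D p p'" "frac_rel D q q'"
  shows "frac_rel D (frac_add D p q) (frac_add D p' q')"
proof -
  obtain a x a' x' b y b' y' where eqs: "p = (a, x)" "p' = (a', x')" "q = (b, y)" "q' = (b', y')"
    by (metis surj_pair)
  have 1: "(D ^^ a') x = (D ^^ a) x'" and 2: "(D ^^ b') y = (D ^^ b) y'"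
    using assms(2,3) by (simp_all add: eqs frac_rel_def)
  have "(D ^^ (a' + b' + b)) x = (D ^^ (b' + b)) ((D ^^ a') x)"
    unfolding funpow_funpow by (simp add: ac_simps)
  also have "\<dots> = (D ^^ (a + b + b')) x'"
    unfolding 1 funpow_funpow by (simp add: ac_simps)
  finally have 3: "(D ^^ (a' + b' + b)) x = (D ^^ (a + b + b')) x'" .
  have "(D ^^ (a' + b' + a)) y = (D ^^ (a' + a)) ((D ^^ b') y)"
    unfolding funpow_funpow by (simp add: ac_simps)
  also have "\<dots> = (D ^^ (a + b + a')) y'"
    unfolding 2 funpow_funpow by (simp add: ac_simps)
  finally have 4: "(D ^^ (a' + b' + a)) y = (D ^^ (a + b + a')) y'" .
  show ?thesis
    by (simp add: eqs frac_rel_def frac_add_def funpow_additive[OF add] funpow_funpow 3 4)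
qed

lemma frac_add_assoc:
  fixes D :: "'x::ab_group_add \<Rightarrow> 'x"
  assumes "\<And>x y. D (x + y) = D x + D y"
  shows "frac_add D (frac_add D p q) r = frac_add D p (frac_add D q r)"
  by (cases p; cases q; cases r)
    (simp add: frac_add_def funpow_additive[OF assms] funpow_funpow ac_simps)

lemma frac_add_commute: "frac_add D p q = frac_add D q (p :: nat \<times> 'x::ab_group_add)"
  by (cases p; cases q) (simp add: frac_add_def ac_simps)

lemma frac_add_zero:
  fixes D :: "'x::ab_group_add \<Rightarrow> 'x"
  assumes "\<And>x y. D (x + y) = D x + D y"
  shows "frac_add D (0, 0) p = p"
  by (cases p) (simp add: frac_add_def funpow_additive[OF assms])

subsection \<open>Two variables\<close>

text \<open>
  \<open>M[[z, w]]\<close> is represented by coefficient functions \<open>nat \<Rightarrow> nat \<Rightarrow> 'm\<close>, extended by \<open>0\<close> to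
  integer exponents where convenient. \<open>mult_zw\<close> is multiplication by \<open>zw(z - w)\<close>.
\<close>

definition ext2 :: "(nat \<Rightarrow> nat \<Rightarrow> 'm::zero) \<Rightarrow> int \<Rightarrow> int \<Rightarrow> 'm" where
  "ext2 g p q = (if p \<ge> 0 \<and> q \<ge> 0 then g (nat p) (nat q) else 0)"

definition mult_zw :: "(nat \<Rightarrow> nat \<Rightarrow> 'm::ab_group_add) \<Rightarrow> nat \<Rightarrow> nat \<Rightarrow> 'm" where
  "mult_zw g a b = ext2 g (int a - 2) (int b - 1) - ext2 g (int a - 1) (int b - 2)"

lemma ext2_simps [simp]:
  "p < 0 \<Longrightarrow> ext2 g p q = 0" "q < 0 \<Longrightarrow> ext2 g p q = 0"
  "ext2 g (int a) (int b) = g a b"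
  by (simp_all add: ext2_def)

lemma ext2_linear:
  "ext2 (g + h) p q = ext2 g p q + (ext2 h p q :: 'm::complex_vector)"
  "ext2 (c *\<^sub>C g) p q = c *\<^sub>C (ext2 g p q :: 'm::complex_vector)"
  by (simp_all add: ext2_def)

lemma ext2_mult_zw:
  "ext2 (mult_zw g) p q = ext2 g (p - 2) (q - 1) - ext2 g (p - 1) (q - 2)"
  by (auto simp: ext2_def mult_zw_def)

lemma mult_zw_linear:
  "mult_zw (g + h) = mult_zw g + (mult_zw h :: nat \<Rightarrow> nat \<Rightarrow> 'm::complex_vector)"
  "mult_zw (c *\<^sub>C g) = c *\<^sub>C (mult_zw g :: nat \<Rightarrow> nat \<Rightarrow> 'm::complex_vector)"
  by (simp_all add: fun_eq_iff mult_zw_def ext2_linear cvec.scale_right_diff_distrib)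

lemma inj_mult_zw: "inj (mult_zw :: _ \<Rightarrow> nat \<Rightarrow> nat \<Rightarrow> 'm::complex_vector)"
proof (rule injI)
  fix g g' :: "nat \<Rightarrow> nat \<Rightarrow> 'm"
  define h where "h = ext2 g - ext2 g'"
  assume "mult_zw g = mult_zw g'"
  then have "ext2 (mult_zw g) (p + 2) (q + 2) = ext2 (mult_zw g') (p + 2) (q + 2)" for p q
    by simp
  from this[unfolded ext2_mult_zw] have step: "h p (q + 1) = h (p + 1) q" for p q
    unfolding h_def minus_apply diff_eq_eq
    by (metis (no_types, opaque_lifting) add.commute add_diff_cancel_right' diff_add_eq diff_diff_eq2
        diff_eq_eq one_add_one add.assoc)
  have "h p (int n - 1) = 0" for p n
  proof (induction n arbitrary: p)
    case 0
    then show ?case by (simp add: h_def)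
  next
    case (Suc n)
    then show ?case using step[of p "int n - 1"] by simp
  qed
  from this[of "int a" "Suc b" for a b] show "g = g'"
    by (simp add: h_def fun_eq_iff)
qed

quotient_type (overloaded) 'm zw_series = "nat \<times> (nat \<Rightarrow> nat \<Rightarrow> 'm::complex_vector)" /
  "frac_rel mult_zw"
  by (rule frac_rel_equivp[OF inj_mult_zw])

instantiation zw_series :: (complex_vector) complex_vector
begin

lift_definition zero_zw_series :: "'a zw_series" is "(0, 0)" .

lift_definition plus_zw_series :: "'a zw_series \<Rightarrow> 'a zw_series \<Rightarrow> 'a zw_series"
  is "frac_add mult_zw"
  by (rule frac_add_rsp[OF mult_zw_linear(1)])

lift_definition uminus_zw_series :: "'a zw_series \<Rightarrow> 'a zw_series" is "\<lambda>(N, g). (N, - g)"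
  by (auto simp: frac_rel_def funpow_additive[OF mult_zw_linear(1)])

definition minus_zw_series :: "'a zw_series \<Rightarrow> 'a zw_series \<Rightarrow> 'a zw_series" where
  "minus_zw_series f g = f + - g"

lift_definition scaleC_zw_series :: "complex \<Rightarrow> 'a zw_series \<Rightarrow> 'a zw_series"
  is "\<lambda>c (N, g). (N, c *\<^sub>C g)"
  by (auto simp: frac_rel_def funpow_scale[OF mult_zw_linear(2)])

instance
proof
  fix a b :: complex and x y z :: "'a zw_series"
  show "x + y + z = x + (y + z)"
    by transfer (simp add: frac_add_assoc[OF mult_zw_linear(1)] frac_rel_def split: prod.splits)
  show "x + y = y + x"
    by transfer (simp add: frac_add_commute[of mult_zw] frac_rel_def split: prod.splits)
  show "0 + x = x"
    by transfer (simp add: frac_add_zero[OF mult_zw_linear(1)] frac_rel_def split: prod.splits)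
  show "- x + x = 0"
    by transfer (auto simp: frac_add_def frac_rel_def funpow_additive[OF mult_zw_linear(1)])
  show "x - y = x + - y"
    by (fact minus_zw_series_def)
  show "a *\<^sub>C (x + y) = a *\<^sub>C x + a *\<^sub>C y"
    by transfer (auto simp: frac_add_def frac_rel_def cvec.scale_right_distrib
        funpow_scale[OF mult_zw_linear(2)])
  show "(a + b) *\<^sub>C x = a *\<^sub>C x + b *\<^sub>C x"
    by transfer (auto simp: frac_add_def frac_rel_def cvec.scale_left_distrib funpow_funpow
        funpow_additive[OF mult_zw_linear(1)] funpow_scale[OF mult_zw_linear(2)])
  show "a *\<^sub>C b *\<^sub>C x = (a * b) *\<^sub>C x"
    by transfer (auto simp: frac_rel_def)
  show "1 *\<^sub>C x = x"
    by transfer (auto simp: frac_rel_def)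
qed

end

lift_definition zw_frac :: "nat \<Rightarrow> (nat \<Rightarrow> nat \<Rightarrow> 'm) \<Rightarrow> 'm::complex_vector zw_series"
  is Pair .

definition zw_series_in :: "'m::complex_vector set \<Rightarrow> 'm zw_series set" where
  "zw_series_in M = {zw_frac N g | N g. \<forall>a b. g a b \<in> M}"

text \<open>\<open>neg_binom N j\<close> is the coefficient of \<open>x\<^sup>j\<close> in \<open>(1 - x)\<^sup>-\<^sup>N\<close>.\<close>

definition neg_binom :: "nat \<Rightarrow> nat \<Rightarrow> complex" where
  "neg_binom N j = (- 1) ^ j * ((- of_nat N) gchoose j)"

lemma neg_binom_0 [simp]: "neg_binom N 0 = 1"
  by (simp add: neg_binom_def)

lemma neg_binom_Suc: "neg_binom (Suc N) (Suc j) = neg_binom (Suc N) j + neg_binom N (Suc j)"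
  using gbinomial_Suc_Suc[of "- of_nat (Suc N) :: complex" j]
  by (simp add: neg_binom_def algebra_simps)

lemma neg_binom_telescope:
  fixes f :: "nat \<Rightarrow> 'm::complex_vector"
  assumes "f (Suc K) = 0"
  shows "(\<Sum>i\<le>K. neg_binom (Suc n) i *\<^sub>C (f i - f (Suc i))) = (\<Sum>i\<le>K. neg_binom n i *\<^sub>C f i)"
proof -
  have "(\<Sum>i\<le>L. neg_binom (Suc n) i *\<^sub>C (f i - f (Suc i))) =
      (\<Sum>i\<le>L. neg_binom n i *\<^sub>C f i) - neg_binom (Suc n) L *\<^sub>C f (Suc L)" for L
    by (induction L)
      (simp_all add: neg_binom_Suc cvec.scale_right_diff_distrib cvec.scale_left_distrib)
  then show ?thesis
    by (simp add: assms)
qed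

lemma frac_rel_invariant:
  assumes step: "\<And>N g. F (Suc N) (D g) = F N g"
    and "frac_rel D (N, g) (N', g')"
  shows "F N g = F N' g'"
proof -
  have *: "F (k + N) ((D ^^ k) g) = F N g" for k N g
    by (induction k) (simp_all add: step)
  have "F N g = F (N' + N) ((D ^^ N') g)"
    by (simp add: *)
  also have "\<dots> = F (N + N') ((D ^^ N) g')"
    using assms(2) by (simp add: frac_rel_def add.commute)
  also have "\<dots> = F N' g'"
    by (simp add: *)
  finally show ?thesis .
qed

text \<open>
  The three expansions. In \<open>z\<^sup>-\<^sup>Nw\<^sup>-\<^sup>N(z - w)\<^sup>-\<^sup>N g\<close> one substitutes

  \<^item> for \<open>M((z))((w))\<close>: \<open>(z - w)\<^sup>-\<^sup>N = z\<^sup>-\<^sup>N(1 - w/z)\<^sup>-\<^sup>N\<close>;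
  \<^item> for \<open>M((w))((z))\<close>: \<open>(z - w)\<^sup>-\<^sup>N = (-1)\<^sup>N w\<^sup>-\<^sup>N(1 - z/w)\<^sup>-\<^sup>N\<close>;
  \<^item> for \<open>M((w))((z - w))\<close>: \<open>z\<^sup>n = w\<^sup>n(1 + (z - w)/w)\<^sup>n\<close>, where \<open>n = a - N\<close> for the coefficient of
    \<open>z\<^sup>a\<close> in \<open>g\<close>.

  In the first two the arguments \<open>p, q\<close> are the exponents of \<open>z\<close> and \<open>w\<close>, in the third those
  of \<open>z - w\<close> and \<open>w\<close>. The finite ranges of summation contain all nonzero terms.
\<close>

lift_definition expand_zw :: "'m::complex_vector zw_series \<Rightarrow> int \<Rightarrow> int \<Rightarrow> 'm" is
  "\<lambda>(N, g) p q. \<Sum>j\<le>nat (q + int N).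
     neg_binom N j *\<^sub>C ext2 g (p + 2 * int N + int j) (q + int N - int j)"
proof (clarsimp simp: fun_eq_iff)
  fix N N' and g g' :: "nat \<Rightarrow> nat \<Rightarrow> 'm" and p q
  assume rel: "frac_rel mult_zw (N, g) (N', g')"
  define F :: "nat \<Rightarrow> (nat \<Rightarrow> nat \<Rightarrow> 'm) \<Rightarrow> 'm" where "F = (\<lambda>N g. \<Sum>j\<le>nat (q + int N).
     neg_binom N j *\<^sub>C ext2 g (p + 2 * int N + int j) (q + int N - int j))"
  have "F (Suc N) (mult_zw g) = F N g" for N and g :: "nat \<Rightarrow> nat \<Rightarrow> 'm"
  proof -
    define f where "f j = ext2 g (p + 2 * int N + int j) (q + int N - int j)" for j
    let ?K = "nat (q + int (Suc N))"
    have "F (Suc N) (mult_zw g) = (\<Sum>j\<le>?K. neg_binom (Suc N) j *\<^sub>C (f j - f (Suc j)))"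
      unfolding F_def f_def by (simp add: ext2_mult_zw algebra_simps)
    also have "\<dots> = (\<Sum>j\<le>?K. neg_binom N j *\<^sub>C f j)"
      by (rule neg_binom_telescope) (simp add: f_def)
    also have "\<dots> = F N g"
      unfolding F_def f_def by (rule sum.mono_neutral_right) auto
    finally show ?thesis .
  qed
  from frac_rel_invariant[where F = F, OF this rel]
  show "(\<Sum>j\<le>nat (q + int N).
      neg_binom N j *\<^sub>C ext2 g (p + 2 * int N + int j) (q + int N - int j)) =
    (\<Sum>j\<le>nat (q + int N').
      neg_binom N' j *\<^sub>C ext2 g' (p + 2 * int N' + int j) (q + int N' - int j))"
    by (simp add: F_def)
qed

lift_definition expand_wz :: "'m::complex_vector zw_series \<Rightarrow> int \<Rightarrow> int \<Rightarrow> 'm" is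
  "\<lambda>(N, g) p q. (- 1) ^ N *\<^sub>C (\<Sum>j\<le>nat (p + int N).
     neg_binom N j *\<^sub>C ext2 g (p + int N - int j) (q + 2 * int N + int j))"
proof (clarsimp simp: fun_eq_iff)
  fix N N' and g g' :: "nat \<Rightarrow> nat \<Rightarrow> 'm" and p q
  assume rel: "frac_rel mult_zw (N, g) (N', g')"
  define F :: "nat \<Rightarrow> (nat \<Rightarrow> nat \<Rightarrow> 'm) \<Rightarrow> 'm" where "F = (\<lambda>N g. (- 1) ^ N *\<^sub>C (\<Sum>j\<le>nat (p + int N).
     neg_binom N j *\<^sub>C ext2 g (p + int N - int j) (q + 2 * int N + int j)))"
  have "F (Suc N) (mult_zw g) = F N g" for N and g :: "nat \<Rightarrow> nat \<Rightarrow> 'm"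
  proof -
    define f where "f j = - ext2 g (p + int N - int j) (q + 2 * int N + int j)" for j
    let ?K = "nat (p + int (Suc N))"
    have "F (Suc N) (mult_zw g) =
        (- 1) ^ Suc N *\<^sub>C (\<Sum>j\<le>?K. neg_binom (Suc N) j *\<^sub>C (f j - f (Suc j)))"
      unfolding F_def f_def by (simp add: ext2_mult_zw algebra_simps)
    also have "(\<Sum>j\<le>?K. neg_binom (Suc N) j *\<^sub>C (f j - f (Suc j))) = (\<Sum>j\<le>?K. neg_binom N j *\<^sub>C f j)"
      by (rule neg_binom_telescope) (simp add: f_def)
    also have "\<dots> = (\<Sum>j\<le>nat (p + int N). neg_binom N j *\<^sub>C f j)"
      unfolding f_def by (rule sum.mono_neutral_right) auto
    also have "(- 1) ^ Suc N *\<^sub>C \<dots> = F N g"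
      unfolding F_def f_def by (simp add: sum_negf)
    finally show ?thesis .
  qed
  from frac_rel_invariant[where F = F, OF this rel]
  show "(- 1) ^ N *\<^sub>C (\<Sum>j\<le>nat (p + int N).
      neg_binom N j *\<^sub>C ext2 g (p + int N - int j) (q + 2 * int N + int j)) =
    (- 1) ^ N' *\<^sub>C (\<Sum>j\<le>nat (p + int N').
      neg_binom N' j *\<^sub>C ext2 g' (p + int N' - int j) (q + 2 * int N' + int j))"
    by (simp add: F_def)
qed

lemma summation_by_parts:
  fixes e :: "int \<Rightarrow> 'm::complex_vector"
  assumes "e (- 2) = 0"
  shows "(\<Sum>a\<le>K. c a *\<^sub>C (e (int a - 2) - e (int a - 1))) =
    (\<Sum>a<K. (c (Suc a) - c a) *\<^sub>C e (int a - 1)) - c K *\<^sub>C e (int K - 1)"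
  by (induction K)
    (simp_all add: assms cvec.scale_right_diff_distrib cvec.scale_left_diff_distrib)

lift_definition expand_w_diff :: "'m::complex_vector zw_series \<Rightarrow> int \<Rightarrow> int \<Rightarrow> 'm" is
  "\<lambda>(N, g) p q. if p + int N < 0 then 0 else
     (\<Sum>a\<le>nat (p + q + 3 * int N).
        (of_int (int a - int N) gchoose nat (p + int N)) *\<^sub>C
          ext2 g (int a) (p + q + 3 * int N - int a))"
proof -
  fix rs1 rs2 :: "nat \<times> (nat \<Rightarrow> nat \<Rightarrow> 'm)"
  assume rel: "frac_rel mult_zw rs1 rs2"
  obtain N g N' g' where eqs: "rs1 = (N, g)" "rs2 = (N', g')"
    by (metis surj_pair)
  define F where "F = (\<lambda>N g p q. if p + int N < 0 then 0 else
     (\<Sum>a\<le>nat (p + q + 3 * int N).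
        (of_int (int a - int N) gchoose nat (p + int N) :: complex) *\<^sub>C
          (ext2 g (int a) (p + q + 3 * int N - int a) :: 'm)))"
  have "F (Suc N) (mult_zw g) p q = F N g p q" for N p q and g :: "nat \<Rightarrow> nat \<Rightarrow> 'm"
  proof (cases "p + int N < - 1")
    case True
    then show ?thesis by (simp add: F_def)
  next
    case False
    define s where "s = p + q + 3 * int N"
    define e where "e x = ext2 g x (s - x)" for x
    define c :: "nat \<Rightarrow> complex" where
      "c a = (of_int (int a - int (Suc N)) gchoose nat (p + int N + 1))" for a
    let ?K = "nat (s + 3)"
    have "F (Suc N) (mult_zw g) p q = (\<Sum>a\<le>?K. c a *\<^sub>C (e (int a - 2) - e (int a - 1)))"
      unfolding F_def using False
      by (auto simp: ext2_mult_zw c_def e_def s_def algebra_simps intro!: sum.cong)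
    also have "\<dots> = (\<Sum>a<?K. (c (Suc a) - c a) *\<^sub>C e (int a - 1))"
      by (subst summation_by_parts) (simp_all add: e_def)
    also have "\<dots> = F N g p q"
    proof (cases "p + int N = - 1")
      case True
      then show ?thesis by (simp add: F_def c_def)
    next
      case nonneg: False
      define m where "m = nat (p + int N)"
      have m: "nat (p + int N + 1) = Suc m" "p + int N = int m"
        using False nonneg by (simp_all add: m_def)
      have c: "c (Suc a) - c a = (of_int (int a - int (Suc N)) gchoose m)" for a
        using gbinomial_Suc_Suc[of "of_int (int a - int (Suc N)) :: complex" m]
        unfolding c_def m(1) by (simp add: algebra_simps)
      have F: "F N g p q = (\<Sum>a\<le>nat s. (of_int (int a - int N) gchoose m) *\<^sub>C e (int a))"
        by (simp add: F_def e_def s_def m)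
      have "(\<Sum>a<?K. (c (Suc a) - c a) *\<^sub>C e (int a - 1)) =
          (\<Sum>a\<in>Suc ` {..nat s}. (c (Suc a) - c a) *\<^sub>C e (int a - 1))"
      proof (rule sum.mono_neutral_cong)
        show "(c (Suc a) - c a) *\<^sub>C e (int a - 1) = 0" if "a \<in> {..<?K} - Suc ` {..nat s}" for a
        proof (cases a)
          case (Suc b)
          with that have "b > nat s" by force
          then show ?thesis by (simp add: Suc e_def)
        qed (simp add: e_def)
        show "(c (Suc a) - c a) *\<^sub>C e (int a - 1) = 0" if "a \<in> Suc ` {..nat s} - {..<?K}" for a
          using that by (auto simp: e_def)
      qed auto
      also have "\<dots> = F N g p q"
        by (subst sum.reindex) (simp_all add: F c)
      finally show ?thesis .
    qed
    finally show ?thesis .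
  qed
  then have "F (Suc N) (mult_zw g) = F N g" for N g
    by (simp add: fun_eq_iff)
  from frac_rel_invariant[where F = F, OF this rel[unfolded eqs]]
  show "(case rs1 of (N, g) \<Rightarrow> \<lambda>p q. if p + int N < 0 then 0 else
     (\<Sum>a\<le>nat (p + q + 3 * int N).
        (of_int (int a - int N) gchoose nat (p + int N)) *\<^sub>C
          ext2 g (int a) (p + q + 3 * int N - int a))) =
    (case rs2 of (N, g) \<Rightarrow> \<lambda>p q. if p + int N < 0 then 0 else
     (\<Sum>a\<le>nat (p + q + 3 * int N).
        (of_int (int a - int N) gchoose nat (p + int N)) *\<^sub>C
          ext2 g (int a) (p + q + 3 * int N - int a)))"
    by (simp add: eqs F_def fun_eq_iff)
qed

subsection \<open>Three variables\<close>

definition ext3 :: "(nat \<Rightarrow> nat \<Rightarrow> nat \<Rightarrow> 'm::zero) \<Rightarrow> int \<Rightarrow> int \<Rightarrow> int \<Rightarrow> 'm" where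
  "ext3 g p q r = (if p \<ge> 0 \<and> q \<ge> 0 \<and> r \<ge> 0 then g (nat p) (nat q) (nat r) else 0)"

text \<open>Multiplication by \<open>z - w\<close>, \<open>z - t\<close>, \<open>w - t\<close>, and by \<open>zwt(z - w)(z - t)(w - t)\<close>.\<close>

definition mult_diff12 :: "(int \<Rightarrow> int \<Rightarrow> int \<Rightarrow> 'm::ab_group_add) \<Rightarrow> int \<Rightarrow> int \<Rightarrow> int \<Rightarrow> 'm" where
  "mult_diff12 h p q r = h (p - 1) q r - h p (q - 1) r"

definition mult_diff13 :: "(int \<Rightarrow> int \<Rightarrow> int \<Rightarrow> 'm::ab_group_add) \<Rightarrow> int \<Rightarrow> int \<Rightarrow> int \<Rightarrow> 'm" where
  "mult_diff13 h p q r = h (p - 1) q r - h p q (r - 1)"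

definition mult_diff23 :: "(int \<Rightarrow> int \<Rightarrow> int \<Rightarrow> 'm::ab_group_add) \<Rightarrow> int \<Rightarrow> int \<Rightarrow> int \<Rightarrow> 'm" where
  "mult_diff23 h p q r = h p (q - 1) r - h p q (r - 1)"

definition mult_zwt ::
    "(nat \<Rightarrow> nat \<Rightarrow> nat \<Rightarrow> 'm::ab_group_add) \<Rightarrow> nat \<Rightarrow> nat \<Rightarrow> nat \<Rightarrow> 'm" where
  "mult_zwt g a b c =
     mult_diff12 (mult_diff13 (mult_diff23 (ext3 g))) (int a - 1) (int b - 1) (int c - 1)"

lemmas mult_diff_defs = mult_diff12_def mult_diff13_def mult_diff23_def

lemma ext3_simps [simp]:
  "p < 0 \<Longrightarrow> ext3 g p q r = 0" "q < 0 \<Longrightarrow> ext3 g p q r = 0" "r < 0 \<Longrightarrow> ext3 g p q r = 0"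
  "ext3 g (int a) (int b) (int c) = g a b c"
  by (simp_all add: ext3_def)

lemma ext3_linear:
  "ext3 (g + h) p q r = ext3 g p q r + (ext3 h p q r :: 'm::complex_vector)"
  "ext3 (c *\<^sub>C g) p q r = c *\<^sub>C (ext3 g p q r :: 'm::complex_vector)"
  by (simp_all add: ext3_def)

lemma ext3_mult_zwt:
  "ext3 (mult_zwt g) p q r =
     mult_diff12 (mult_diff13 (mult_diff23 (ext3 g))) (p - 1) (q - 1) (r - 1)"
proof (cases "p \<ge> 0 \<and> q \<ge> 0 \<and> r \<ge> 0")
  case True
  then show ?thesis by (simp add: ext3_def[of "mult_zwt g"] mult_zwt_def)
next
  case False
  then show ?thesis by (auto simp: mult_diff_defs)
qed

lemma mult_zwt_linear:
  "mult_zwt (g + h) = mult_zwt g + (mult_zwt h :: nat \<Rightarrow> nat \<Rightarrow> nat \<Rightarrow> 'm::complex_vector)"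
  "mult_zwt (c *\<^sub>C g) = c *\<^sub>C (mult_zwt g :: nat \<Rightarrow> nat \<Rightarrow> nat \<Rightarrow> 'm::complex_vector)"
  by (simp_all add: fun_eq_iff mult_zwt_def mult_diff_defs ext3_linear
      cvec.scale_right_diff_distrib cvec.scale_right_distrib)

lemma mult_diff_inject:
  fixes h :: "int \<Rightarrow> int \<Rightarrow> int \<Rightarrow> 'm::ab_group_add"
  assumes neg: "\<And>p q r. q < 0 \<or> r < 0 \<Longrightarrow> h p q r = 0"
  shows "(\<And>p q r. mult_diff12 h p q r = 0) \<Longrightarrow> h p q r = 0"
    and "(\<And>p q r. mult_diff13 h p q r = 0) \<Longrightarrow> h p q r = 0"
    and "(\<And>p q r. mult_diff23 h p q r = 0) \<Longrightarrow> h p q r = 0"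
proof -
  {
    assume "\<And>p q r. mult_diff12 h p q r = 0"
    then have step: "h p q r = h (p + 1) (q - 1) r" for p q r
      by (metis add_diff_cancel_right' eq_iff_diff_eq_0 mult_diff12_def)
    have "h p (int n - 1) r = 0" for p n r
    proof (induction n arbitrary: p)
      case (Suc n)
      then show ?case using step[of p "int n" r] by simp
    qed (simp add: neg)
    from this[of p "nat (q + 1)" r] show "h p q r = 0"
      using neg[of q r p] by (cases "q < 0") simp_all
  }
  {
    assume "\<And>p q r. mult_diff13 h p q r = 0"
    then have step: "h p q r = h (p + 1) q (r - 1)" for p q r
      by (metis add_diff_cancel_right' eq_iff_diff_eq_0 mult_diff13_def)
    have "h p q (int n - 1) = 0" for p n q
    proof (induction n arbitrary: p)
      case (Suc n)
      then show ?case using step[of p q "int n"] by simp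
    qed (simp add: neg)
    from this[of p q "nat (r + 1)"] show "h p q r = 0"
      using neg[of q r p] by (cases "r < 0") simp_all
  }
  {
    assume "\<And>p q r. mult_diff23 h p q r = 0"
    then have step: "h p q r = h p (q + 1) (r - 1)" for p q r
      by (metis add_diff_cancel_right' eq_iff_diff_eq_0 mult_diff23_def)
    have "h p q (int n - 1) = 0" for p n q
    proof (induction n arbitrary: q)
      case (Suc n)
      then show ?case using step[of p q "int n"] by simp
    qed (simp add: neg)
    from this[of p q "nat (r + 1)"] show "h p q r = 0"
      using neg[of q r p] by (cases "r < 0") simp_all
  }
qed

lemma inj_mult_zwt: "inj (mult_zwt :: _ \<Rightarrow> nat \<Rightarrow> nat \<Rightarrow> nat \<Rightarrow> 'm::complex_vector)"
proof (rule injI)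
  fix g g' :: "nat \<Rightarrow> nat \<Rightarrow> nat \<Rightarrow> 'm"
  assume eq: "mult_zwt g = mult_zwt g'"
  define h where "h p q r = ext3 g p q r - ext3 g' p q r" for p q r
  have neg: "h p q r = 0" if "q < 0 \<or> r < 0" for p q r
    using that by (auto simp: h_def)
  have neg23: "mult_diff23 h p q r = 0" if "q < 0 \<or> r < 0" for p q r
    using that by (auto simp: mult_diff23_def neg)
  have neg13: "mult_diff13 (mult_diff23 h) p q r = 0" if "q < 0 \<or> r < 0" for p q r
    using that by (auto simp: mult_diff13_def neg23)
  have "mult_diff12 (mult_diff13 (mult_diff23 h)) p q r = 0" for p q r
  proof -
    have "ext3 (mult_zwt g) (p + 1) (q + 1) (r + 1) = ext3 (mult_zwt g') (p + 1) (q + 1) (r + 1)"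
      by (simp add: eq)
    then show ?thesis
      unfolding ext3_mult_zwt by (simp add: mult_diff_defs h_def algebra_simps)
  qed
  note mult_diff_inject(1)[OF neg13 this]
  note mult_diff_inject(2)[OF neg23 this]
  note mult_diff_inject(3)[OF neg this]
  then show "g = g'"
    by (metis (no_types, opaque_lifting) eq_iff_diff_eq_0 ext3_simps(4) ext h_def)
qed

quotient_type (overloaded) 'm zwt_series = "nat \<times> (nat \<Rightarrow> nat \<Rightarrow> nat \<Rightarrow> 'm::complex_vector)" /
  "frac_rel mult_zwt"
  by (rule frac_rel_equivp[OF inj_mult_zwt])

instantiation zwt_series :: (complex_vector) complex_vector
begin

lift_definition zero_zwt_series :: "'a zwt_series" is "(0, 0)" .

lift_definition plus_zwt_series :: "'a zwt_series \<Rightarrow> 'a zwt_series \<Rightarrow> 'a zwt_series"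
  is "frac_add mult_zwt"
  by (rule frac_add_rsp[OF mult_zwt_linear(1)])

lift_definition uminus_zwt_series :: "'a zwt_series \<Rightarrow> 'a zwt_series" is "\<lambda>(N, g). (N, - g)"
  by (auto simp: frac_rel_def funpow_additive[OF mult_zwt_linear(1)])

definition minus_zwt_series :: "'a zwt_series \<Rightarrow> 'a zwt_series \<Rightarrow> 'a zwt_series" where
  "minus_zwt_series f g = f + - g"

lift_definition scaleC_zwt_series :: "complex \<Rightarrow> 'a zwt_series \<Rightarrow> 'a zwt_series"
  is "\<lambda>c (N, g). (N, c *\<^sub>C g)"
  by (auto simp: frac_rel_def funpow_scale[OF mult_zwt_linear(2)])

instance
proof
  fix a b :: complex and x y z :: "'a zwt_series"
  show "x + y + z = x + (y + z)"
    by transfer (simp add: frac_add_assoc[OF mult_zwt_linear(1)] frac_rel_def split: prod.splits)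
  show "x + y = y + x"
    by transfer (simp add: frac_add_commute[of mult_zwt] frac_rel_def split: prod.splits)
  show "0 + x = x"
    by transfer (simp add: frac_add_zero[OF mult_zwt_linear(1)] frac_rel_def split: prod.splits)
  show "- x + x = 0"
    by transfer (auto simp: frac_add_def frac_rel_def funpow_additive[OF mult_zwt_linear(1)])
  show "x - y = x + - y"
    by (fact minus_zwt_series_def)
  show "a *\<^sub>C (x + y) = a *\<^sub>C x + a *\<^sub>C y"
    by transfer (auto simp: frac_add_def frac_rel_def cvec.scale_right_distrib
        funpow_scale[OF mult_zwt_linear(2)])
  show "(a + b) *\<^sub>C x = a *\<^sub>C x + b *\<^sub>C x"
    by transfer (auto simp: frac_add_def frac_rel_def cvec.scale_left_distrib funpow_funpow
        funpow_additive[OF mult_zwt_linear(1)] funpow_scale[OF mult_zwt_linear(2)])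
  show "a *\<^sub>C b *\<^sub>C x = (a * b) *\<^sub>C x"
    by transfer (auto simp: frac_rel_def)
  show "1 *\<^sub>C x = x"
    by transfer (auto simp: frac_rel_def)
qed

end

lift_definition zwt_frac ::
  "nat \<Rightarrow> (nat \<Rightarrow> nat \<Rightarrow> nat \<Rightarrow> 'm) \<Rightarrow> 'm::complex_vector zwt_series" is Pair .

definition zwt_series_in :: "'m::complex_vector set \<Rightarrow> 'm zwt_series set" where
  "zwt_series_in M = {zwt_frac N g | N g. \<forall>a b c. g a b c \<in> M}"

text \<open>
  The coefficient of \<open>z\<^sup>p w\<^sup>q t\<^sup>r\<close> in the product of \<open>h\<close> with
  \<open>z\<^sup>-\<^sup>k(1 - w/z)\<^sup>-\<^sup>k z\<^sup>-\<^sup>l(1 - t/z)\<^sup>-\<^sup>l w\<^sup>-\<^sup>m(1 - t/w)\<^sup>-\<^sup>m\<close>, where the indices of summation are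
  truncated at \<open>K\<close>.
\<close>

definition expand_diffs :: "nat \<Rightarrow> nat \<Rightarrow> nat \<Rightarrow> nat \<Rightarrow>
    (int \<Rightarrow> int \<Rightarrow> int \<Rightarrow> 'm::complex_vector) \<Rightarrow> int \<Rightarrow> int \<Rightarrow> int \<Rightarrow> 'm" where
  "expand_diffs K k l m h p q r = (\<Sum>i\<le>K. \<Sum>j\<le>K. \<Sum>n\<le>K.
     (neg_binom k i * neg_binom l j * neg_binom m n) *\<^sub>C
       h (p + int k + int l + int i + int j) (q + int m - int i + int n) (r - int j - int n))"

lemma sum_rotate3:
  "(\<Sum>i\<in>A. \<Sum>j\<in>A. \<Sum>n\<in>A. G i j n) = (\<Sum>j\<in>A. \<Sum>n\<in>A. \<Sum>i\<in>A. G i j n)"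
proof -
  have "(\<Sum>i\<in>A. \<Sum>j\<in>A. \<Sum>n\<in>A. G i j n) = (\<Sum>j\<in>A. \<Sum>i\<in>A. \<Sum>n\<in>A. G i j n)"
    by (rule sum.swap)
  also have "\<dots> = (\<Sum>j\<in>A. \<Sum>n\<in>A. \<Sum>i\<in>A. G i j n)"
    by (rule sum.cong[OF refl], rule sum.swap)
  finally show ?thesis .
qed

context
  fixes h :: "int \<Rightarrow> int \<Rightarrow> int \<Rightarrow> 'm::complex_vector"
  assumes neg: "\<And>p q r. q < 0 \<or> r < 0 \<Longrightarrow> h p q r = 0"
begin

lemma expand_diffs_step12:
  assumes "int K \<ge> r" "int K \<ge> q + int m + r"
  shows "expand_diffs K (Suc k) l m (mult_diff12 h) p q r = expand_diffs K k l m h p q r"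
proof -
  define f where "f j n i =
    h (p + int k + int l + int i + int j) (q + int m - int i + int n) (r - int j - int n)" for i j n
  have tel: "(\<Sum>i\<le>K. neg_binom (Suc k) i *\<^sub>C (f j n i - f j n (Suc i))) =
      (\<Sum>i\<le>K. neg_binom k i *\<^sub>C f j n i)" if "n \<le> K" for j n
  proof (rule neg_binom_telescope)
    show "f j n (Suc K) = 0"
      unfolding f_def using assms that by (intro neg) linarith
  qed
  have "expand_diffs K (Suc k) l m (mult_diff12 h) p q r =
      (\<Sum>j\<le>K. \<Sum>n\<le>K. (neg_binom l j * neg_binom m n) *\<^sub>C
        (\<Sum>i\<le>K. neg_binom (Suc k) i *\<^sub>C (f j n i - f j n (Suc i))))"
    unfolding expand_diffs_def f_def mult_diff12_def cvec.scale_sum_right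
    by (subst sum_rotate3, (rule sum.cong[OF refl])+) (simp add: algebra_simps)
  also have "\<dots> = (\<Sum>j\<le>K. \<Sum>n\<le>K. (neg_binom l j * neg_binom m n) *\<^sub>C
        (\<Sum>i\<le>K. neg_binom k i *\<^sub>C f j n i))"
    by (rule sum.cong[OF refl], rule sum.cong[OF refl]) (simp add: tel)
  also have "\<dots> = expand_diffs K k l m h p q r"
    unfolding expand_diffs_def f_def cvec.scale_sum_right
    by (subst (2) sum_rotate3, (rule sum.cong[OF refl])+) (simp add: algebra_simps)
  finally show ?thesis .
qed

lemma expand_diffs_step13:
  assumes "int K \<ge> r"
  shows "expand_diffs K k (Suc l) m (mult_diff13 h) p q r = expand_diffs K k l m h p q r"
proof -
  define f where "f i n j =
    h (p + int k + int l + int i + int j) (q + int m - int i + int n) (r - int j - int n)" for i j n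
  have tel: "(\<Sum>j\<le>K. neg_binom (Suc l) j *\<^sub>C (f i n j - f i n (Suc j))) =
      (\<Sum>j\<le>K. neg_binom l j *\<^sub>C f i n j)" for i n
  proof (rule neg_binom_telescope)
    show "f i n (Suc K) = 0"
      unfolding f_def using assms by (intro neg) linarith
  qed
  have swap: "(\<Sum>i\<le>K. \<Sum>j\<le>K. \<Sum>n\<le>K. G i j n) = (\<Sum>i\<le>K. \<Sum>n\<le>K. \<Sum>j\<le>K. G i j n)"
    for G :: "nat \<Rightarrow> nat \<Rightarrow> nat \<Rightarrow> 'm"
    by (rule sum.cong[OF refl], rule sum.swap)
  have "expand_diffs K k (Suc l) m (mult_diff13 h) p q r =
      (\<Sum>i\<le>K. \<Sum>n\<le>K. (neg_binom k i * neg_binom m n) *\<^sub>C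
        (\<Sum>j\<le>K. neg_binom (Suc l) j *\<^sub>C (f i n j - f i n (Suc j))))"
    unfolding expand_diffs_def f_def mult_diff13_def cvec.scale_sum_right
    by (subst swap, (rule sum.cong[OF refl])+) (simp add: algebra_simps)
  also have "\<dots> = (\<Sum>i\<le>K. \<Sum>n\<le>K. (neg_binom k i * neg_binom m n) *\<^sub>C
        (\<Sum>j\<le>K. neg_binom l j *\<^sub>C f i n j))"
    by (simp only: tel)
  also have "\<dots> = expand_diffs K k l m h p q r"
    unfolding expand_diffs_def f_def cvec.scale_sum_right
    by (subst (2) swap, (rule sum.cong[OF refl])+) (simp add: algebra_simps)
  finally show ?thesis .
qed

lemma expand_diffs_step23:
  assumes "int K \<ge> r"
  shows "expand_diffs K k l (Suc m) (mult_diff23 h) p q r = expand_diffs K k l m h p q r"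
proof -
  define f where "f i j n =
    h (p + int k + int l + int i + int j) (q + int m - int i + int n) (r - int j - int n)" for i j n
  have tel: "(\<Sum>n\<le>K. neg_binom (Suc m) n *\<^sub>C (f i j n - f i j (Suc n))) =
      (\<Sum>n\<le>K. neg_binom m n *\<^sub>C f i j n)" for i j
  proof (rule neg_binom_telescope)
    show "f i j (Suc K) = 0"
      unfolding f_def using assms by (intro neg) linarith
  qed
  have "expand_diffs K k l (Suc m) (mult_diff23 h) p q r =
      (\<Sum>i\<le>K. \<Sum>j\<le>K. (neg_binom k i * neg_binom l j) *\<^sub>C
        (\<Sum>n\<le>K. neg_binom (Suc m) n *\<^sub>C (f i j n - f i j (Suc n))))"
    unfolding expand_diffs_def f_def mult_diff23_def cvec.scale_sum_right
    by ((rule sum.cong[OF refl])+) (simp add: algebra_simps)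
  also have "\<dots> = (\<Sum>i\<le>K. \<Sum>j\<le>K. (neg_binom k i * neg_binom l j) *\<^sub>C
        (\<Sum>n\<le>K. neg_binom m n *\<^sub>C f i j n))"
    by (simp only: tel)
  also have "\<dots> = expand_diffs K k l m h p q r"
    unfolding expand_diffs_def f_def cvec.scale_sum_right
    by ((rule sum.cong[OF refl])+) (simp add: algebra_simps)
  finally show ?thesis .
qed

lemma expand_diffs_bound:
  assumes "int K \<ge> r" "int K \<ge> q + int m + r" "K \<le> L"
  shows "expand_diffs L k l m h p q r = expand_diffs K k l m h p q r"
proof -
  define f where "f = (\<lambda>(i, j, n). (neg_binom k i * neg_binom l j * neg_binom m n) *\<^sub>C
    h (p + int k + int l + int i + int j) (q + int m - int i + int n) (r - int j - int n))"
  have eq: "expand_diffs K k l m h p q r = sum f ({..K} \<times> {..K} \<times> {..K})" for K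
    by (simp add: expand_diffs_def f_def sum.cartesian_product)
  show ?thesis
    unfolding eq
  proof (rule sum.mono_neutral_right)
    show "\<forall>x\<in>{..L} \<times> {..L} \<times> {..L} - {..K} \<times> {..K} \<times> {..K}. f x = 0"
    proof (rule ballI)
      fix x
      assume x: "x \<in> {..L} \<times> {..L} \<times> {..L} - {..K} \<times> {..K} \<times> {..K}"
      obtain i j n where "x = (i, j, n)"
        by (cases x)
      moreover from this x have "q + int m - int i + int n < 0 \<or> r - int j - int n < 0"
        using assms(1,2) by auto
      ultimately show "f x = 0"
        by (auto simp: f_def neg)
    qed
  qed (use assms in auto)
qed

end

text \<open>The expansion in \<open>M((z))((w))((t))\<close>; the arguments \<open>p, q, r\<close> are the exponents of \<open>z, w, t\<close>.\<close>

lift_definition expand_zwt :: "'m::complex_vector zwt_series \<Rightarrow> int \<Rightarrow> int \<Rightarrow> int \<Rightarrow> 'm" is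
  "\<lambda>(N, g) p q r. expand_diffs (nat (r + int N) + nat (q + r + 3 * int N)) N N N (ext3 g)
     (p + int N) (q + int N) (r + int N)"
proof -
  fix rs1 rs2 :: "nat \<times> (nat \<Rightarrow> nat \<Rightarrow> nat \<Rightarrow> 'm)"
  assume rel: "frac_rel mult_zwt rs1 rs2"
  obtain N g N' g' where eqs: "rs1 = (N, g)" "rs2 = (N', g')"
    by (metis surj_pair)
  define F :: "nat \<Rightarrow> (nat \<Rightarrow> nat \<Rightarrow> nat \<Rightarrow> 'm) \<Rightarrow> int \<Rightarrow> int \<Rightarrow> int \<Rightarrow> 'm" where
    "F N g p q r = expand_diffs (nat (r + int N) + nat (q + r + 3 * int N)) N N N (ext3 g)
     (p + int N) (q + int N) (r + int N)" for N g p q r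
  have "F (Suc N) (mult_zwt g) p q r = F N g p q r" for N p q r
    and g :: "nat \<Rightarrow> nat \<Rightarrow> nat \<Rightarrow> 'm"
  proof -
    define K where "K = nat (r + int (Suc N)) + nat (q + r + 3 * int (Suc N))"
    define h where "h = ext3 g"
    have neg: "h p q r = 0" if "q < 0 \<or> r < 0" for p q r
      using that by (auto simp: h_def)
    have neg23: "mult_diff23 h p q r = 0" if "q < 0 \<or> r < 0" for p q r
      using that by (auto simp: mult_diff23_def neg)
    have neg13: "mult_diff13 (mult_diff23 h) p q r = 0" if "q < 0 \<or> r < 0" for p q r
      using that by (auto simp: mult_diff13_def neg23)
    have "F (Suc N) (mult_zwt g) p q r =
        expand_diffs K (Suc N) (Suc N) (Suc N) (mult_diff12 (mult_diff13 (mult_diff23 h)))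
          (p + int N) (q + int N) (r + int N)"
      unfolding F_def K_def[symmetric]
      by (simp add: expand_diffs_def ext3_mult_zwt h_def algebra_simps)
    also have "\<dots> = expand_diffs K N (Suc N) (Suc N) (mult_diff13 (mult_diff23 h))
          (p + int N) (q + int N) (r + int N)"
      by (rule expand_diffs_step12[OF neg13]) (auto simp: K_def)
    also have "\<dots> = expand_diffs K N N (Suc N) (mult_diff23 h)
          (p + int N) (q + int N) (r + int N)"
      by (rule expand_diffs_step13[OF neg23]) (auto simp: K_def)
    also have "\<dots> = expand_diffs K N N N h (p + int N) (q + int N) (r + int N)"
      by (rule expand_diffs_step23[OF neg]) (auto simp: K_def)
    also have "\<dots> = F N g p q r"
      unfolding F_def h_def[symmetric]
      by (rule expand_diffs_bound[OF neg]) (auto simp: K_def)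
    finally show ?thesis .
  qed
  then have "F (Suc N) (mult_zwt g) = F N g" for N g
    by (simp add: fun_eq_iff)
  from frac_rel_invariant[where F = F, OF this rel[unfolded eqs]]
  show "(case rs1 of (N, g) \<Rightarrow> \<lambda>p q r.
      expand_diffs (nat (r + int N) + nat (q + r + 3 * int N)) N N N (ext3 g)
       (p + int N) (q + int N) (r + int N)) =
    (case rs2 of (N, g) \<Rightarrow> \<lambda>p q r.
      expand_diffs (nat (r + int N) + nat (q + r + 3 * int N)) N N N (ext3 g)
       (p + int N) (q + int N) (r + int N))"
    by (simp add: eqs F_def fun_eq_iff)
qed

section \<open>Vertex algebras, modules and intertwining operators\<close>

text \<open>
  \<open>comp_outer m m'\<close> is \<open>m\<^sub>z \<circ> (1 \<otimes> m'\<^sub>w)\<close>, where \<open>p, q\<close> are the exponents of \<open>z, w\<close>;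
  \<open>comp_inner m m'\<close> is \<open>m\<^sub>w \<circ> (m'\<^bsub>z-w\<^esub> \<otimes> 1)\<close>, where \<open>p, q\<close> are the exponents of \<open>z - w, w\<close>.
\<close>

definition comp_outer :: "('a \<Rightarrow> 'b \<Rightarrow> 'c::zero fls) \<Rightarrow> ('d \<Rightarrow> 'e \<Rightarrow> 'b::zero fls) \<Rightarrow>
    'a \<Rightarrow> 'd \<Rightarrow> 'e \<Rightarrow> int \<Rightarrow> int \<Rightarrow> 'c" where
  "comp_outer m m' u v x = (\<lambda>p q. m u (m' v x $$ q) $$ p)"

definition comp_inner :: "('b \<Rightarrow> 'e \<Rightarrow> 'c::zero fls) \<Rightarrow> ('a \<Rightarrow> 'd \<Rightarrow> 'b::zero fls) \<Rightarrow>
    'a \<Rightarrow> 'd \<Rightarrow> 'e \<Rightarrow> int \<Rightarrow> int \<Rightarrow> 'c" where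
  "comp_inner m m' u v x = (\<lambda>p q. m (m' u v $$ p) x $$ q)"

text \<open>
  The arguments are the space \<open>V\<close>, the vacuum, \<open>L(-1)\<close> and \<open>m\<^sub>z\<close>. The composition in the other order
  has values in \<open>M((w))((z))\<close>; its arguments are permuted so that \<open>p, q\<close> remain the exponents of \<open>z, w\<close>.
\<close>

definition vertex_algebra :: "'v::complex_vector set \<Rightarrow> 'v \<Rightarrow> ('v \<Rightarrow> 'v) \<Rightarrow>
    ('v \<Rightarrow> 'v \<Rightarrow> 'v fls) \<Rightarrow> bool" where
  "vertex_algebra V vac Lm1 m \<longleftrightarrow>
     cvec.subspace V \<and> vac \<in> V \<and> linear_on V V Lm1 \<and> bilinear_map V V (laurent V) m \<and>
     (\<forall>v\<in>V. m vac v = fls_const v) \<and>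
     (\<forall>v\<in>V. (\<forall>n<0. m v vac $$ n = 0) \<and> m v vac $$ 0 = v) \<and>
     (\<forall>u\<in>V. \<forall>v\<in>V. \<forall>n.
        Lm1 (m u v $$ n) - m u (Lm1 v) $$ n = of_int (n + 1) *\<^sub>C (m u v $$ (n + 1))) \<and>
     (\<forall>u\<in>V. \<forall>v\<in>V. \<forall>x\<in>V. \<exists>f\<in>zw_series_in V.
        expand_zw f = comp_outer m m u v x \<and>
        expand_wz f = (\<lambda>p q. comp_outer m m v u x q p))"

text \<open>
  Structures of the various kinds. \<open>L\<close> is only meaningful at the indices that the kind
  under consideration provides; \<open>omega\<close> and \<open>charge\<close> are the conformal vector and the central
  charge of a conformal vertex algebra, \<open>gact\<close> is the action of the group in the equivariant case.
\<close>

record (overloaded) ('g, 'v::complex_vector) va_data =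
  Vspace :: "'v set"
  Vvac :: 'v
  V_L :: "int \<Rightarrow> 'v \<Rightarrow> 'v"
  Vmult :: "'v \<Rightarrow> 'v \<Rightarrow> 'v fls"
  Vomega :: 'v
  Vcharge :: complex
  Vgact :: "'g \<Rightarrow> 'v \<Rightarrow> 'v"

record (overloaded) ('g, 'v, 'm::complex_vector) mod_data =
  Mspace :: "'m set"
  M_L :: "int \<Rightarrow> 'm \<Rightarrow> 'm"
  Mact :: "'v \<Rightarrow> 'm \<Rightarrow> 'm fls"
  Mgact :: "'g \<Rightarrow> 'm \<Rightarrow> 'm"

datatype va_kind = Unrestricted | Weighted | Moebius | Quasi_conformal | Conformal | VOA

datatype 'g setting = Plain va_kind | Equivariant va_kind "'g monoid"

fun kind_of :: "'g setting \<Rightarrow> va_kind" where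
  "kind_of (Plain k) = k"
| "kind_of (Equivariant k G) = k"

text \<open>The indices of the operators \<open>L(i)\<close> provided by each kind.\<close>

fun defined_L :: "va_kind \<Rightarrow> int set" where
  "defined_L Unrestricted = {-1}"
| "defined_L Weighted = {-1, 0}"
| "defined_L Moebius = {-1, 0, 1}"
| "defined_L Quasi_conformal = {-1..}"
| "defined_L Conformal = UNIV"
| "defined_L VOA = UNIV"

definition weight_space :: "'m::complex_vector set \<Rightarrow> ('m \<Rightarrow> 'm) \<Rightarrow> int \<Rightarrow> 'm set" where
  "weight_space M L0 n = {v \<in> M. L0 v = of_int n *\<^sub>C v}"

definition integral_semisimple :: "'m::complex_vector set \<Rightarrow> ('m \<Rightarrow> 'm) \<Rightarrow> bool" where
  "integral_semisimple M L0 \<longleftrightarrow> linear_on M M L0 \<and> M \<subseteq> cvec.span (\<Union>n. weight_space M L0 n)"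

definition bounded_finite_weights :: "'m::complex_vector set \<Rightarrow> ('m \<Rightarrow> 'm) \<Rightarrow> bool" where
  "bounded_finite_weights M L0 \<longleftrightarrow>
     (\<exists>N. \<forall>n<N. weight_space M L0 n = {0}) \<and>
     (\<forall>n. \<exists>B. finite B \<and> weight_space M L0 n \<subseteq> cvec.span B)"

definition witt_relations ::
    "int set \<Rightarrow> 'm::complex_vector set \<Rightarrow> (int \<Rightarrow> 'm \<Rightarrow> 'm) \<Rightarrow> bool" where
  "witt_relations J M L \<longleftrightarrow> (\<forall>i\<in>J. \<forall>j\<in>J. \<forall>v\<in>M.
     L i (L j v) - L j (L i v) = of_int (i - j) *\<^sub>C L (i + j) v)"

definition virasoro_relations ::
    "complex \<Rightarrow> 'm::complex_vector set \<Rightarrow> (int \<Rightarrow> 'm \<Rightarrow> 'm) \<Rightarrow> bool" where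
  "virasoro_relations c M L \<longleftrightarrow> (\<forall>m n. \<forall>v\<in>M.
     L m (L n v) - L n (L m v) = of_int (m - n) *\<^sub>C L (m + n) v +
       (if m + n = 0 then (c * of_int (m ^ 3 - m) / 12) *\<^sub>C v else 0))"

text \<open>
  \<open>L(i)I\<^sub>z(u \<otimes> v) - I\<^sub>z(u \<otimes> L(i)v) = \<Sum>\<^sub>j (i + 1 choose j) z\<^sup>j I\<^sub>z(L(i - j)u \<otimes> v)\<close>, where \<open>L1, L2, L3\<close> are
  the operators on the two sources and on the target.
\<close>

definition L_formula :: "int \<Rightarrow> 'a set \<Rightarrow> 'b set \<Rightarrow> (int \<Rightarrow> 'a \<Rightarrow> 'a) \<Rightarrow> (int \<Rightarrow> 'b \<Rightarrow> 'b) \<Rightarrow>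
    (int \<Rightarrow> 'c \<Rightarrow> 'c) \<Rightarrow> ('a \<Rightarrow> 'b \<Rightarrow> 'c::complex_vector fls) \<Rightarrow> bool" where
  "L_formula i S T L1 L2 L3 I \<longleftrightarrow> (\<forall>u\<in>S. \<forall>v\<in>T. \<forall>n.
     L3 i (I u v $$ n) - I u (L2 i v) $$ n =
     (\<Sum>j\<le>nat (i + 1). of_nat (nat (i + 1) choose j) *\<^sub>C (I (L1 (i - int j) u) v $$ (n - int j))))"

text \<open>Every vector is annihilated by all products of sufficiently many elements of \<open>X\<close>.\<close>

definition locally_nilpotent :: "'m::zero set \<Rightarrow> ('m \<Rightarrow> 'm) set \<Rightarrow> bool" where
  "locally_nilpotent M X \<longleftrightarrow>
     (\<forall>v\<in>M. \<exists>N. \<forall>xs. length xs = N \<and> set xs \<subseteq> X \<longrightarrow> foldr (\<lambda>x y. x y) xs v = 0)"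

definition L_action :: "int set \<Rightarrow> 'v set \<Rightarrow> (int \<Rightarrow> 'v \<Rightarrow> 'v) \<Rightarrow> 'm::complex_vector set \<Rightarrow>
    (int \<Rightarrow> 'm \<Rightarrow> 'm) \<Rightarrow> ('v \<Rightarrow> 'm \<Rightarrow> 'm fls) \<Rightarrow> bool" where
  "L_action J V LV M LM act \<longleftrightarrow>
     (\<forall>i\<in>J. linear_on M M (LM i)) \<and>
     witt_relations J M LM \<and>
     (\<forall>i\<in>J. L_formula i V M LV LM LM act) \<and>
     locally_nilpotent M (cvec.span {LM i | i. i \<in> J \<and> i \<ge> 1})"


subsection \<open>Vertex algebras of each kind\<close>

definition underlying_va :: "('g, 'v::complex_vector) va_data \<Rightarrow> bool" where
  "underlying_va V \<longleftrightarrow> vertex_algebra (Vspace V) (Vvac V) (V_L V (-1)) (Vmult V)"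

definition weighted_va :: "('g, 'v::complex_vector) va_data \<Rightarrow> bool" where
  "weighted_va V \<longleftrightarrow>
     underlying_va V \<and> integral_semisimple (Vspace V) (V_L V 0) \<and>
     (\<forall>v\<in>Vspace V. V_L V (-1) (V_L V 0 v) - V_L V 0 (V_L V (-1) v) = - V_L V (-1) v) \<and>
     L_formula 0 (Vspace V) (Vspace V) (V_L V) (V_L V) (V_L V) (Vmult V)"

definition conformal_va :: "('g, 'v::complex_vector) va_data \<Rightarrow> bool" where
  "conformal_va V \<longleftrightarrow>
     weighted_va V \<and> Vomega V \<in> weight_space (Vspace V) (V_L V 0) 2 \<and>
     (\<forall>n. \<forall>v\<in>Vspace V. Vmult V (Vomega V) v $$ (- n - 2) = V_L V n v) \<and>
     virasoro_relations (Vcharge V) (Vspace V) (V_L V)"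

fun va_of_kind :: "va_kind \<Rightarrow> ('g, 'v::complex_vector) va_data \<Rightarrow> bool" where
  "va_of_kind Unrestricted V = underlying_va V"
| "va_of_kind Weighted V = weighted_va V"
| "va_of_kind Moebius V =
     (weighted_va V \<and> L_action {-1, 0, 1} (Vspace V) (V_L V) (Vspace V) (V_L V) (Vmult V))"
| "va_of_kind Quasi_conformal V =
     (weighted_va V \<and> L_action {-1..} (Vspace V) (V_L V) (Vspace V) (V_L V) (Vmult V))"
| "va_of_kind Conformal V = conformal_va V"
| "va_of_kind VOA V = (conformal_va V \<and> bounded_finite_weights (Vspace V) (V_L V 0))"

text \<open>\<open>G\<close> acts on \<open>M\<close> by linear operators that commute with the operators \<open>L(i)\<close>, \<open>i \<in> J\<close>.\<close>

definition group_acts :: "'g monoid \<Rightarrow> int set \<Rightarrow> 'm::complex_vector set \<Rightarrow>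
    (int \<Rightarrow> 'm \<Rightarrow> 'm) \<Rightarrow> ('g \<Rightarrow> 'm \<Rightarrow> 'm) \<Rightarrow> bool" where
  "group_acts G J M L \<rho> \<longleftrightarrow>
     (\<forall>g\<in>carrier G. linear_on M M (\<rho> g)) \<and>
     (\<forall>v\<in>M. \<rho> \<one>\<^bsub>G\<^esub> v = v) \<and>
     (\<forall>g\<in>carrier G. \<forall>h\<in>carrier G. \<forall>v\<in>M. \<rho> (g \<otimes>\<^bsub>G\<^esub> h) v = \<rho> g (\<rho> h v)) \<and>
     (\<forall>g\<in>carrier G. \<forall>i\<in>J. \<forall>v\<in>M. \<rho> g (L i v) = L i (\<rho> g v))"

definition equivariant_map :: "'g monoid \<Rightarrow> 'a set \<Rightarrow> 'b set \<Rightarrow> ('g \<Rightarrow> 'a \<Rightarrow> 'a) \<Rightarrow>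
    ('g \<Rightarrow> 'b \<Rightarrow> 'b) \<Rightarrow> ('g \<Rightarrow> 'c \<Rightarrow> 'c) \<Rightarrow> ('a \<Rightarrow> 'b \<Rightarrow> 'c::zero fls) \<Rightarrow> bool" where
  "equivariant_map G S T \<rho>1 \<rho>2 \<rho>3 I \<longleftrightarrow>
     (\<forall>g\<in>carrier G. \<forall>u\<in>S. \<forall>v\<in>T. \<forall>n. I (\<rho>1 g u) (\<rho>2 g v) $$ n = \<rho>3 g (I u v $$ n))"

fun T_vertex_algebra :: "'g setting \<Rightarrow> ('g, 'v::complex_vector) va_data \<Rightarrow> bool" where
  "T_vertex_algebra (Plain k) V = va_of_kind k V"
| "T_vertex_algebra (Equivariant k G) V =
     (va_of_kind k V \<and> group G \<and>
      group_acts G (defined_L k) (Vspace V) (V_L V) (Vgact V) \<and>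
      equivariant_map G (Vspace V) (Vspace V) (Vgact V) (Vgact V) (Vgact V) (Vmult V) \<and>
      (\<forall>g\<in>carrier G. Vgact V g (Vvac V) = Vvac V) \<and>
      (k \<in> {Conformal, VOA} \<longrightarrow> (\<forall>g\<in>carrier G. Vgact V g (Vomega V) = Vomega V)))"


subsection \<open>Modules\<close>

definition va_module :: "('g, 'v::complex_vector) va_data \<Rightarrow>
    ('g, 'v, 'm::complex_vector) mod_data \<Rightarrow> bool" where
  "va_module V M \<longleftrightarrow>
     cvec.subspace (Mspace M) \<and> linear_on (Mspace M) (Mspace M) (M_L M (-1)) \<and>
     bilinear_map (Vspace V) (Mspace M) (laurent (Mspace M)) (Mact M) \<and>
     (\<forall>x\<in>Mspace M. Mact M (Vvac V) x = fls_const x) \<and>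
     (\<forall>u\<in>Vspace V. \<forall>x\<in>Mspace M. \<forall>n.
        M_L M (-1) (Mact M u x $$ n) - Mact M u (M_L M (-1) x) $$ n = Mact M (V_L V (-1) u) x $$ n) \<and>
     (\<forall>u\<in>Vspace V. \<forall>v\<in>Vspace V. \<forall>x\<in>Mspace M. \<exists>f\<in>zw_series_in (Mspace M).
        expand_w_diff f = comp_inner (Mact M) (Vmult V) u v x \<and>
        expand_zw f = comp_outer (Mact M) (Mact M) u v x)"

definition integral_weight_module :: "int set \<Rightarrow> ('g, 'v::complex_vector) va_data \<Rightarrow>
    ('g, 'v, 'm::complex_vector) mod_data \<Rightarrow> bool" where
  "integral_weight_module J V M \<longleftrightarrow>
     va_module V M \<and> integral_semisimple (Mspace M) (M_L M 0) \<and>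
     L_action J (Vspace V) (V_L V) (Mspace M) (M_L M) (Mact M)"

definition conformal_module :: "('g, 'v::complex_vector) va_data \<Rightarrow>
    ('g, 'v, 'm::complex_vector) mod_data \<Rightarrow> bool" where
  "conformal_module V M \<longleftrightarrow>
     integral_weight_module {-1, 0} V M \<and>
     (\<forall>n. \<forall>x\<in>Mspace M. Mact M (Vomega V) x $$ (- n - 2) = M_L M n x) \<and>
     virasoro_relations (Vcharge V) (Mspace M) (M_L M)"

fun module_of_kind :: "va_kind \<Rightarrow> ('g, 'v::complex_vector) va_data \<Rightarrow>
    ('g, 'v, 'm::complex_vector) mod_data \<Rightarrow> bool" where
  "module_of_kind Unrestricted V M = va_module V M"
| "module_of_kind Weighted V M = integral_weight_module {-1, 0} V M"
| "module_of_kind Moebius V M = integral_weight_module {-1, 0, 1} V M"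
| "module_of_kind Quasi_conformal V M = integral_weight_module {-1..} V M"
| "module_of_kind Conformal V M = conformal_module V M"
| "module_of_kind VOA V M = (conformal_module V M \<and> bounded_finite_weights (Mspace M) (M_L M 0))"

fun T_module :: "'g setting \<Rightarrow> ('g, 'v::complex_vector) va_data \<Rightarrow>
    ('g, 'v, 'm::complex_vector) mod_data \<Rightarrow> bool" where
  "T_module (Plain k) V M = module_of_kind k V M"
| "T_module (Equivariant k G) V M =
     (module_of_kind k V M \<and>
      group_acts G (defined_L k) (Mspace M) (M_L M) (Mgact M) \<and>
      equivariant_map G (Vspace V) (Mspace M) (Vgact V) (Mgact M) (Mgact M) (Mact M))"

definition adjoint_module :: "('g, 'v::complex_vector) va_data \<Rightarrow> ('g, 'v, 'v) mod_data" where
  "adjoint_module V = \<lparr>Mspace = Vspace V, M_L = V_L V, Mact = Vmult V, Mgact = Vgact V\<rparr>"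


subsection \<open>Intertwining operators\<close>

definition intertwining_operator :: "'g setting \<Rightarrow> ('g, 'v::complex_vector) va_data \<Rightarrow>
    ('g, 'v, 'a::complex_vector) mod_data \<Rightarrow> ('g, 'v, 'b::complex_vector) mod_data \<Rightarrow>
    ('g, 'v, 'c::complex_vector) mod_data \<Rightarrow> ('a \<Rightarrow> 'b \<Rightarrow> 'c fls) \<Rightarrow> bool" where
  "intertwining_operator T V M1 M2 M3 I \<longleftrightarrow>
     bilinear_map (Mspace M1) (Mspace M2) (laurent (Mspace M3)) I \<and>
     (\<forall>u\<in>Mspace M1. \<forall>v\<in>Mspace M2. \<forall>n.
        of_int (n + 1) *\<^sub>C (I u v $$ (n + 1)) = I (M_L M1 (-1) u) v $$ n \<and>
        I (M_L M1 (-1) u) v $$ n = M_L M3 (-1) (I u v $$ n) - I u (M_L M2 (-1) v) $$ n) \<and>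
     (\<forall>a\<in>Vspace V. \<forall>u\<in>Mspace M1. \<forall>v\<in>Mspace M2. \<exists>f\<in>zw_series_in (Mspace M3).
        expand_zw f = comp_outer (Mact M3) I a u v \<and>
        expand_w_diff f = comp_inner I (Mact M1) a u v \<and>
        expand_wz f = (\<lambda>p q. comp_outer I (Mact M2) u a v q p)) \<and>
     (\<forall>i\<in>defined_L (kind_of T). i \<ge> -1 \<longrightarrow>
        L_formula i (Mspace M1) (Mspace M2) (M_L M1) (M_L M2) (M_L M3) I) \<and>
     (case T of
        Plain k \<Rightarrow> True
      | Equivariant k G \<Rightarrow>
          equivariant_map G (Mspace M1) (Mspace M2) (Mgact M1) (Mgact M2) (Mgact M3) I)"

text \<open>\<open>F(z) \<mapsto> F(-z)\<close> and \<open>F(z) \<mapsto> e\<^sup>z\<^sup>L F(z)\<close>\<close>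

lift_definition fls_neg_arg :: "'m::complex_vector fls \<Rightarrow> 'm fls" is
  "\<lambda>F n. (- 1) powi n *\<^sub>C F n"
  by (auto elim: eventually_mono)

lift_definition fls_exp_op :: "('m \<Rightarrow> 'm) \<Rightarrow> 'm::complex_vector fls \<Rightarrow> 'm fls" is
  "\<lambda>L F n. \<Sum>j | F (n - int j) \<noteq> 0. (1 / fact j) *\<^sub>C (L ^^ j) (F (n - int j))"
proof -
  fix L :: "'m \<Rightarrow> 'm" and F :: "int \<Rightarrow> 'm"
  assume "\<forall>\<^sub>\<infinity>n. F (- int n) = 0"
  then obtain N where N: "F (- int n) = 0" if "n > N" for n
    by (auto simp: MOST_nat)
  have "F (- int n - int j) = 0" if "n > N" for n j
    using N[of "n + j"] that by simp
  then show "\<forall>\<^sub>\<infinity>n. (\<Sum>j | F (- int n - int j) \<noteq> 0.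
      (1 / fact j) *\<^sub>C (L ^^ j) (F (- int n - int j))) = 0"
    by (auto simp: MOST_nat intro!: exI[of _ N])
qed

definition skew :: "('c \<Rightarrow> 'c) \<Rightarrow> ('a \<Rightarrow> 'b \<Rightarrow> 'c::complex_vector fls) \<Rightarrow> 'b \<Rightarrow> 'a \<Rightarrow> 'c fls" where
  "skew Lm1 I v u = fls_exp_op Lm1 (fls_neg_arg (I u v))"

text \<open>The lowest-order exponent of a nonzero Laurent series is its \<^const>\<open>fls_subdegree\<close>.\<close>

definition even_operator :: "'a set \<Rightarrow> ('a \<Rightarrow> 'a \<Rightarrow> 'b::zero fls) \<Rightarrow> bool" where
  "even_operator M I \<longleftrightarrow>
     (\<forall>u\<in>M. I u u = 0) \<and> (\<forall>u\<in>M. \<forall>v\<in>M. I u v \<noteq> 0 \<longrightarrow> odd (fls_subdegree (I u v))) \<or>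
     (\<exists>u\<in>M. I u u \<noteq> 0 \<and> even (fls_subdegree (I u u)))"


section \<open>Direct sums\<close>

text \<open>The Laurent series with values in a direct sum whose components are the given series.\<close>

definition fls_assemble :: "('a \<Rightarrow> 'm::zero fls) \<Rightarrow> ('a \<Rightarrow> 'm) fls" where
  "fls_assemble F = Abs_fls (\<lambda>n i. F i $$ n)"

lemma fls_assemble_nth:
  assumes "finite {i. F i \<noteq> 0}"
  shows "fls_assemble F $$ n = (\<lambda>i. F i $$ n)"
  unfolding fls_assemble_def
proof (rule nth_Abs_fls_ex_lower_bound)
  let ?D = "insert 0 (fls_subdegree ` F ` {i. F i \<noteq> 0})"
  have "F i $$ n = 0" if "n < Min ?D" for n i
  proof (cases "F i = 0")
    case False
    then have "Min ?D \<le> fls_subdegree (F i)"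
      using assms by (intro Min_le) auto
    then show ?thesis using that by simp
  qed simp
  then show "\<exists>N. \<forall>n<N. (\<lambda>i. F i $$ n) = 0"
    by (auto simp: fun_eq_iff)
qed

definition direct_sum_space ::
    "('a \<Rightarrow> ('g, 'v::complex_vector, 'm::complex_vector) mod_data) \<Rightarrow> ('a \<Rightarrow> 'm) set" where
  "direct_sum_space M = {x. (\<forall>i. x i \<in> Mspace (M i)) \<and> finite {i. x i \<noteq> 0}}"

definition direct_sum ::
    "('a \<Rightarrow> ('g, 'v::complex_vector, 'm::complex_vector) mod_data) \<Rightarrow> ('g, 'v, 'a \<Rightarrow> 'm) mod_data" where
  "direct_sum M =
     \<lparr>Mspace = direct_sum_space M,
      M_L = (\<lambda>n x i. M_L (M i) n (x i)),
      Mact = (\<lambda>v x. if x \<in> direct_sum_space M then fls_assemble (\<lambda>i. Mact (M i) v (x i)) else 0),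
      Mgact = (\<lambda>g x i. Mgact (M i) g (x i))\<rparr>"

definition T_compatible :: "'g setting \<Rightarrow> ('g, 'v::complex_vector) va_data \<Rightarrow>
    ('a \<Rightarrow> ('g, 'v, 'm::complex_vector) mod_data) \<Rightarrow> bool" where
  "T_compatible T V M \<longleftrightarrow> T_module T V (direct_sum M)"

text \<open>
  The multiplication on the direct sum whose restriction to \<open>M\<^sub>i \<otimes> M\<^sub>j\<close> is \<open>m i j\<close>, with values
  in the summand \<open>M\<^sub>i\<^sub>+\<^sub>j\<close>.
\<close>

definition direct_sum_mult ::
    "('a::ab_group_add \<Rightarrow> ('g, 'v::complex_vector, 'm::complex_vector) mod_data) \<Rightarrow>
    ('a \<Rightarrow> 'a \<Rightarrow> 'm \<Rightarrow> 'm \<Rightarrow> 'm fls) \<Rightarrow> ('a \<Rightarrow> 'm) \<Rightarrow> ('a \<Rightarrow> 'm) \<Rightarrow> ('a \<Rightarrow> 'm) fls" where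
  "direct_sum_mult M m x y =
     (if x \<in> direct_sum_space M \<and> y \<in> direct_sum_space M
      then fls_assemble (\<lambda>k. \<Sum>i | x i \<noteq> 0. m i (k - i) (x i) (y (k - i)))
      else 0)"

definition direct_sum_vac ::
    "('g, 'm::complex_vector) va_data \<Rightarrow> 'a::zero \<Rightarrow> 'm" where
  "direct_sum_vac V = (\<lambda>i. if i = 0 then Vvac V else 0)"


section \<open>Associativity and commutativity data\<close>

text \<open>
  The spaces \<open>M\<^sub>i\<close> are subspaces of one ambient type, which also contains \<open>V = M\<^sub>0\<close>. Each map \<open>\<phi>\<close> is
  the composition of operators, factored through the embedding of the localised series.
\<close>

definition associativity_datum :: "'g setting \<Rightarrow> ('g, 'v::complex_vector) va_data \<Rightarrow>
    ('a::ab_group_add \<Rightarrow> ('g, 'v, 'v) mod_data) \<Rightarrow>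
    ('a \<Rightarrow> 'a \<Rightarrow> ('v \<Rightarrow> 'v \<Rightarrow> 'v fls) set) \<Rightarrow> bool" where
  "associativity_datum T V M \<I> \<longleftrightarrow>
     (\<forall>i j. one_dimensional (\<I> i j) \<and>
        (\<forall>m\<in>\<I> i j. intertwining_operator T V (M i) (M j) (M (i + j)) m)) \<and>
     (\<forall>i j k. \<exists>J. one_dimensional J \<and>
        (\<forall>F\<in>J. trilinear_map (Mspace (M i)) (Mspace (M j)) (Mspace (M k))
           (zw_series_in (Mspace (M (i + j + k)))) F) \<and>
        (\<exists>\<phi>. induces_iso2 (\<I> i (j + k)) (\<I> j k) J \<phi> \<and>
           (\<forall>m\<in>\<I> i (j + k). \<forall>m'\<in>\<I> j k.
            \<forall>u\<in>Mspace (M i). \<forall>v\<in>Mspace (M j). \<forall>x\<in>Mspace (M k).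
              expand_zw (\<phi> m m' u v x) = comp_outer m m' u v x)) \<and>
        (\<exists>\<phi>. induces_iso2 (\<I> (i + j) k) (\<I> i j) J \<phi> \<and>
           (\<forall>m\<in>\<I> (i + j) k. \<forall>m'\<in>\<I> i j.
            \<forall>u\<in>Mspace (M i). \<forall>v\<in>Mspace (M j). \<forall>x\<in>Mspace (M k).
              expand_w_diff (\<phi> m m' u v x) = comp_inner m m' u v x))) \<and>
     (\<forall>i j k l. \<exists>J. one_dimensional J \<and>
        (\<forall>F\<in>J. quadrilinear_map (Mspace (M i)) (Mspace (M j)) (Mspace (M k)) (Mspace (M l))
           (zwt_series_in (Mspace (M (i + j + k + l)))) F) \<and>
        (\<exists>\<phi>. induces_iso3 (\<I> i (j + k + l)) (\<I> j (k + l)) (\<I> k l) J \<phi> \<and>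
           (\<forall>m\<in>\<I> i (j + k + l). \<forall>m'\<in>\<I> j (k + l). \<forall>m''\<in>\<I> k l.
            \<forall>u\<in>Mspace (M i). \<forall>v\<in>Mspace (M j). \<forall>x\<in>Mspace (M k). \<forall>y\<in>Mspace (M l).
              expand_zwt (\<phi> m m' m'' u v x y) =
                (\<lambda>p q r. m u (m' v (m'' x y $$ r) $$ q) $$ p)))) \<and>
     (\<forall>i. \<I> 0 i = cvec.span {Mact (M i)} \<and>
          \<I> i 0 = cvec.span {skew (M_L (M i) (-1)) (Mact (M i))})"

definition commutativity_datum :: "'g setting \<Rightarrow> ('g, 'v::complex_vector) va_data \<Rightarrow>
    ('a::ab_group_add \<Rightarrow> ('g, 'v, 'v) mod_data) \<Rightarrow>
    ('a \<Rightarrow> 'a \<Rightarrow> ('v \<Rightarrow> 'v \<Rightarrow> 'v fls) set) \<Rightarrow> bool" where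
  "commutativity_datum T V M \<I> \<longleftrightarrow>
     associativity_datum T V M \<I> \<and>
     (\<forall>i j. \<forall>m\<in>\<I> i j. m \<noteq> 0 \<longrightarrow> skew (M_L (M (i + j)) (-1)) m \<in> \<I> j i)"

end

theory Submission
  imports Defs "HOL-Library.Multiset"
begin

text \<open>
  Choose nonzero operators \<open>m\<^sub>i\<^sub>j\<close>. Comparing \<open>u(vx)\<close> with \<open>(uv)x\<close> gives scalars \<open>\<alpha>\<close>, and comparing the skew of
  \<open>m\<^sub>i\<^sub>j\<close> with \<open>m\<^sub>j\<^sub>i\<close> gives scalars \<open>\<Omega>\<close>. The pentagon (from the five ways to degenerate a four-point
  series) and the hexagon (from the action of \<open>S\<^sub>3\<close> on the leading terms of three-point series) make
  \<open>(\<alpha>, \<Omega>)\<close> an abelian 3-cocycle on \<open>A\<close> with \<open>\<Omega>\<^sub>i\<^sub>j \<Omega>\<^sub>j\<^sub>i = 1\<close>. Hence \<open>i \<mapsto> \<Omega>\<^sub>i\<^sub>i \<in> {1, -1}\<close> is a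
  homomorphism, constant on the cosets of \<open>2A\<close>, and \<open>m\<^sub>i\<^sub>i\<close> is even iff \<open>\<Omega>\<^sub>i\<^sub>i = 1\<close>. Locality of the
  product on the direct sum forces \<open>\<Omega>\<^sub>i\<^sub>i = 1\<close>. Conversely, if \<open>\<Omega>\<^sub>i\<^sub>i = 1\<close> for all \<open>i\<close>, then after a choice of
  generators along a well-order of \<open>A\<close> one has \<open>\<Omega> = 1\<close>, and the remaining symmetric cocycle \<open>\<alpha>\<close> is a
  coboundary: it is one on the free commutative monoid over \<open>A\<close>, and the trivialisation descends to
  \<open>A\<close> because the nonzero complex numbers form a divisible group.
\<close>

section \<open>Binomial coefficients with integer arguments\<close>

text \<open>The datum supplies four-point series only through their expansion in
  \<open>M((z))((w))((t))\<close>; no other bracketing of four factors comes with a series. The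
  others are reached two variables at a time: a coefficient in one variable is a localised series in
  the other two, and as z, w and z - w are homogeneous of degree 1, any one expansion determines the
  others within each total degree. There only finitely many monomials contribute, so each comparison
  is a finite identity of binomial coefficients. Scalar identities follow by contradiction: if one
  failed, the last product in a chain of comparisons would vanish in some total degree, and going
  back along the chain so would the first, which is nonzero.

  Skew-symmetry enters through \<open>e^(zL(-1))\<close>. On an inner product this is an exact
  translation; on an outer argument it is one only up to terms that disappear in the lowest total
  degree, which is why the hexagon is read off leading terms.

  The group A is arbitrary, possibly with torsion and without a basis. Hence the passage to
  multisets and the extension of characters by Zorn's lemma.\<close>

definition gbin :: "int \<Rightarrow> int \<Rightarrow> complex" where
  "gbin n k = (if k < 0 then 0 else of_int n gchoose nat k)"

text \<open>The value 0 at negative \<open>k\<close> lets sums of products of binomials be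
  truncated, extended and reindexed without side conditions; most reindexings below rest on
  it.\<close>

lemma gbin_neg [simp]: "k < 0 \<Longrightarrow> gbin n k = 0"
  by (simp add: gbin_def)

lemma gbin_zero [simp]: "gbin n 0 = 1"
  by (simp add: gbin_def)

lemma gbin_Pascal: "gbin (n + 1) k = gbin n k + gbin n (k - 1)"
proof (cases "k > 0")
  case True
  then obtain m where "k = int (Suc m)"
    by (metis zero_less_imp_eq_int Suc_pred)
  then show ?thesis
    using gbinomial_Suc_Suc[of "of_int n :: complex" m]
    by (simp add: gbin_def nat_add_distrib add.commute)
qed (cases "k = 0"; simp)

lemma gbin_Vandermonde: "(\<Sum>i\<le>nat S. gbin x (int i) * gbin y (S - int i)) = gbin (x + y) S"
proof (cases "S < 0")
  case False
  have "(\<Sum>i\<le>nat S. gbin x (int i) * gbin y (S - int i)) =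
      (\<Sum>i=0..nat S. (of_int x gchoose i) * (of_int y gchoose (nat S - i)))"
    using False by (intro sum.cong) (auto simp: gbin_def nat_diff_distrib)
  then show ?thesis
    using False by (simp add: gbinomial_Vandermonde gbin_def)
qed simp

lemma gbin_Vandermonde': "(\<Sum>i\<le>nat S. gbin x (S - int i) * gbin y (int i)) = gbin (x + y) S"
  using gbin_Vandermonde[where x = y and y = x and S = S] by (simp add: ac_simps)

text \<open>Both sides are the multinomial coefficient for removing \<open>i\<close> and
  \<open>k\<close> from \<open>e\<close>: each equals \<open>gbin e (i + k)\<close> times a binomial
  coefficient of \<open>i + k\<close>.\<close>

lemma gbin_trinomial: "gbin e i * gbin (e - i) k = gbin e k * gbin (e - k) i"
proof (cases "i < 0 \<or> k < 0")
  case False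
  then obtain m n where mn: "i = int m" "k = int n"
    by (metis nonneg_int_cases not_less)
  have *: "(of_int e gchoose m) * ((of_int e - of_nat m) gchoose n) =
     (of_int e gchoose (m + n)) * (of_nat (m + n) gchoose m :: complex)" for m n
    using gbinomial_trinomial_revision[of m "m + n" "of_int e :: complex"] by simp
  have "(of_nat (m + n) gchoose m :: complex) = of_nat (m + n) gchoose n"
    by (metis add_diff_cancel_left' binomial_gbinomial binomial_symmetric le_add1)
  then show ?thesis
    using *[of m n] *[of n m] by (simp add: mn gbin_def add.commute)
qed auto

lemma gbin_minus: "gbin (n + k) k = (-1) powi k * gbin (- n - 1) k"
proof (cases "k < 0")
  case False
  then obtain m where "k = int m"
    by (metis nonneg_int_cases not_less)
  then show ?thesis
    using gbinomial_negated_upper[of "of_int (n + k) :: complex" m]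
    by (simp add: gbin_def algebra_simps)
qed simp

text \<open>Expand both sides by Vandermonde's identity and compare terms.\<close>

lemma gbin_sum_exchange:
  "(\<Sum>i\<le>nat R. gbin e (int i) * gbin f (R - int i) * gbin (a + e - int i) P) =
   (\<Sum>j\<le>nat P. gbin a (P - int j) * gbin e (int j) * gbin (e + f - int j) R)"
proof -
  have V1: "(\<Sum>j\<le>nat P. gbin a (P - int j) * gbin (e - int i) (int j)) = gbin (a + e - int i) P" for i
    by (simp add: gbin_Vandermonde' add_diff_eq)
  have V2: "(\<Sum>i\<le>nat R. gbin (e - int j) (int i) * gbin f (R - int i)) = gbin (e + f - int j) R" for j
    by (simp add: gbin_Vandermonde diff_add_eq)
  have "(\<Sum>i\<le>nat R. gbin e (int i) * gbin f (R - int i) * gbin (a + e - int i) P) =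
    (\<Sum>i\<le>nat R. \<Sum>j\<le>nat P. gbin a (P - int j) * gbin f (R - int i) *
       (gbin e (int i) * gbin (e - int i) (int j)))"
    by (simp add: V1[symmetric] sum_distrib_left mult_ac)
  also have "\<dots> = (\<Sum>j\<le>nat P. \<Sum>i\<le>nat R. gbin a (P - int j) * gbin f (R - int i) *
       (gbin e (int j) * gbin (e - int j) (int i)))"
    by (subst sum.swap) (simp only: gbin_trinomial)
  also have "\<dots> = (\<Sum>j\<le>nat P. gbin a (P - int j) * gbin e (int j) * gbin (e + f - int j) R)"
    by (simp add: V2[symmetric] sum_distrib_left mult_ac)
  finally show ?thesis .
qed

text \<open>The index now sits in an upper argument, \<open>gbin (b + int i) Q\<close>, so after
  Vandermonde the product to revise is \<open>gbin d i * gbin i j\<close>. With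
  \<open>gbin_sum_exchange\<close> and plain reindexings this accounts for the agreement of the
  faces of a four-point series at their common corners.\<close>

lemma gbin_sum_exchange':
  "(\<Sum>i\<le>nat S. gbin d (int i) * gbin e (S - int i) * gbin (b + int i) Q) =
   (\<Sum>j\<le>nat Q. gbin b (Q - int j) * gbin d (int j) * gbin (d + e - int j) (S - int j))"
proof -
  have tri: "gbin d i * gbin i j = gbin d j * gbin (d - j) (i - j)" if "i \<ge> 0" for i j :: int
  proof (cases "j \<le> i \<and> 0 \<le> j")
    case True
    then obtain m n where mn: "i = int m" "j = int n" "n \<le> m"
      by (metis nonneg_int_cases order_trans of_nat_le_iff)
    then show ?thesis
      using gbinomial_trinomial_revision[of n m "of_int d :: complex"]
      by (simp add: gbin_def nat_diff_distrib)
  next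
    case False
    moreover obtain m where "i = int m"
      using \<open>i \<ge> 0\<close> nonneg_int_cases by blast
    moreover have "(of_nat m gchoose n :: complex) = 0" if "m < n" for n
      using that by (simp add: binomial_gbinomial[symmetric])
    ultimately show ?thesis
      by (auto simp: gbin_def)
  qed
  have V: "(\<Sum>i\<le>nat S. gbin (d - int j) (int i - int j) * gbin e (S - int i)) =
      gbin (d + e - int j) (S - int j)" for j
  proof -
    \<comment> \<open>A shift by \<open>j\<close>. The sets \<open>S'\<close> and \<open>T'\<close>
      hold indices with zero terms. The rule compares summands on \<open>S'\<close> as well, so the
      forward map must send these indices to one whose target summand vanishes: at
      \<open>nat S + 1\<close> the argument of \<open>gbin e\<close> is negative. The same device
      serves in the later reindexings.\<close>
    have "(\<Sum>i\<le>nat S. gbin (d - int j) (int i - int j) * gbin e (S - int i)) =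
      (\<Sum>i\<le>nat (S - int j). gbin (d - int j) (int i) * gbin e (S - int j - int i))"
      by (rule sum.reindex_bij_witness_not_neutral[
            where S' = "{i. i \<le> nat S \<and> (i < j \<or> int i > S)}" and
            T' = "{i. i \<le> nat (S - int j) \<and> int i + int j > S}" and
            i = "\<lambda>i. i + j" and j = "\<lambda>i. if i < j then nat S + 1 else i - j"])
        (auto simp: of_nat_diff algebra_simps)
    then show ?thesis
      using gbin_Vandermonde[where S = "S - int j" and x = "d - int j" and y = e]
      by (simp add: algebra_simps)
  qed
  have "(\<Sum>i\<le>nat S. gbin d (int i) * gbin e (S - int i) * gbin (b + int i) Q) =
    (\<Sum>i\<le>nat S. \<Sum>j\<le>nat Q. gbin b (Q - int j) * gbin e (S - int i) *
       (gbin d (int i) * gbin (int i) (int j)))"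
    by (simp add: gbin_Vandermonde'[symmetric, where x = b] sum_distrib_left mult_ac)
  also have "\<dots> = (\<Sum>j\<le>nat Q. \<Sum>i\<le>nat S. gbin b (Q - int j) * gbin e (S - int i) *
       (gbin d (int j) * gbin (d - int j) (int i - int j)))"
    by (subst sum.swap) (simp only: tri of_nat_0_le_iff)
  also have "\<dots> = (\<Sum>j\<le>nat Q. gbin b (Q - int j) * gbin d (int j) * gbin (d + e - int j) (S - int j))"
    by (simp add: V[symmetric] sum_distrib_left mult_ac)
  finally show ?thesis .
qed

lemma powi_minus_one_diff: "(-1::complex) powi (a - b) = (-1) powi a * (-1) powi b"
  by (auto simp: power_int_minus_left)

lemma powi_minus_one_add: "(-1::complex) powi (a + b) = (-1) powi a * (-1) powi b"
  by (auto simp: power_int_minus_left)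

lemma powi_minus_one_self [simp]: "(-1::complex) powi a * (-1) powi a = 1"
  "(-1::complex) powi a * ((-1) powi a * x) = x"
  by (auto simp: power_int_minus_left)

text \<open>Negating the upper argument turns the first factor into \<open>gbin (P - s - 1)\<close>
  up to sign, where Vandermonde applies. This is the binomial form of a linear change of variables;
  \<open>K\<close> is any sufficiently large cut-off.\<close>

lemma gbin_reflect:
  assumes "int K \<ge> P"
  shows "(\<Sum>k\<le>K. gbin (s - P + int k) (int k) * ((-1) powi (P - int k) * gbin a (P - int k))) =
     gbin (s - a) P"
proof -
  have "(\<Sum>k\<le>K. gbin (s - P + int k) (int k) * ((-1) powi (P - int k) * gbin a (P - int k))) =
    (\<Sum>k\<le>K. (-1) powi P * (gbin (P - s - 1) (int k) * gbin a (P - int k)))"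
    by (subst gbin_minus) (simp add: powi_minus_one_diff mult_ac)
  also have "\<dots> = (-1) powi P * (\<Sum>k\<le>nat P. gbin (P - s - 1) (int k) * gbin a (P - int k))"
    unfolding sum_distrib_left[symmetric]
    using assms by (intro arg_cong2[where f = times] refl sum.mono_neutral_right) auto
  also have "\<dots> = (-1) powi P * gbin (P - s - 1 + a) P"
    by (simp only: gbin_Vandermonde)
  also have "\<dots> = gbin (s - a) P"
    using gbin_minus[of "s - a - P" P] by (simp add: algebra_simps)
  finally show ?thesis .
qed

section \<open>Expansions of localised series\<close>

text \<open>The three \<open>coef\<close> functions give the coefficient at exponents
  \<open>(p, q)\<close> in the three expansions of the monomial \<open>z^a w^b (z - w)^d\<close>; in
  the third, \<open>p\<close> belongs to \<open>z - w\<close> and \<open>q\<close> to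
  \<open>w\<close>.\<close>

definition coef_zw :: "int \<Rightarrow> int \<Rightarrow> int \<Rightarrow> int \<Rightarrow> int \<Rightarrow> complex" where
  "coef_zw a b d p q = (if p + q = a + b + d then (-1) powi (q - b) * gbin d (q - b) else 0)"

definition coef_wz :: "int \<Rightarrow> int \<Rightarrow> int \<Rightarrow> int \<Rightarrow> int \<Rightarrow> complex" where
  "coef_wz a b d p q = (if p + q = a + b + d then (-1) powi (d + p - a) * gbin d (p - a) else 0)"

definition coef_diff :: "int \<Rightarrow> int \<Rightarrow> int \<Rightarrow> int \<Rightarrow> int \<Rightarrow> complex" where
  "coef_diff a b d p q = (if p + q = a + b + d then gbin a (p - d) else 0)"

lemmas coef_defs = coef_zw_def coef_wz_def coef_diff_def

lemma powi_minus_one_1 [simp]: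
  "(-1::complex) powi (x + 1) = - ((-1) powi x)"
  "(-1::complex) powi (x - 1) = - ((-1) powi x)"
  "(-1::complex) powi (1 + x) = - ((-1) powi x)"
  by (auto simp: power_int_minus_left)

lemma gbin_Pascal': "gbin d (k - 1) = gbin (1 + d) k - gbin d k"
  using gbin_Pascal[of d k] by (simp add: add.commute)

text \<open>Each equation multiplies out one factor \<open>z - w\<close> of
  \<open>(z - w)^(d + 1)\<close>. Monomials with any exponent of \<open>z - w\<close> can thereby be
  built up from negative ones.\<close>

lemma coef_Pascal:
  "coef_zw a b (d + 1) p q = coef_zw (a + 1) b d p q - coef_zw a (b + 1) d p q"
  "coef_wz a b (d + 1) p q = coef_wz (a + 1) b d p q - coef_wz a (b + 1) d p q"
  "coef_diff a b (d + 1) p q = coef_diff (a + 1) b d p q - coef_diff a (b + 1) d p q"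
proof -
  have 1: "q - (b + 1) = q - b - 1" "p - (a + 1) = p - a - 1" "d + p - (a + 1) = d + p - a - 1"
    "p - (d + 1) = p - d - 1" "d + 1 + p - a = d + p - a + 1"
    by simp_all
  show "coef_zw a b (d + 1) p q = coef_zw (a + 1) b d p q - coef_zw a (b + 1) d p q"
    unfolding coef_defs 1 gbin_Pascal' powi_minus_one_1 by (auto simp: algebra_simps)
  show "coef_wz a b (d + 1) p q = coef_wz (a + 1) b d p q - coef_wz a (b + 1) d p q"
    unfolding coef_defs 1 gbin_Pascal' powi_minus_one_1 by (auto simp: algebra_simps)
  show "coef_diff a b (d + 1) p q = coef_diff (a + 1) b d p q - coef_diff a (b + 1) d p q"
    unfolding coef_defs 1 gbin_Pascal' powi_minus_one_1 by (auto simp: algebra_simps)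
qed

section \<open>Expansions of a fraction as sums over the monomials of its numerator\<close>

lemma neg_binom_gbin: "neg_binom N j = (-1) powi int j * gbin (- int N) (int j)"
  by (simp add: neg_binom_def gbin_def)

text \<open>The sum over powers of \<open>w/z\<close> is regrouped by the monomials of the
  numerator. In this form the three expansions share index set and vectors and differ only in the
  scalar \<open>coef\<close>. The second exponent of the numerator is forced by the total degree,
  the denominator having degree \<open>3 * int N\<close>.\<close>

lemma expand_zw_frac:
  "expand_zw (zw_frac N g) p q = (\<Sum>a\<le>nat (p + q + 3 * int N).
     coef_zw (int a - int N) (p + q + 2 * int N - int a) (- int N) p q *\<^sub>C
       ext2 g (int a) (p + q + 3 * int N - int a))"
proof -
  have "expand_zw (zw_frac N g) p q = (\<Sum>j\<le>nat (q + int N).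
     neg_binom N j *\<^sub>C ext2 g (p + 2 * int N + int j) (q + int N - int j))"
    by (simp add: expand_zw.abs_eq zw_frac.abs_eq)
  also have "\<dots> = (\<Sum>a\<le>nat (p + q + 3 * int N).
     coef_zw (int a - int N) (p + q + 2 * int N - int a) (- int N) p q *\<^sub>C
       ext2 g (int a) (p + q + 3 * int N - int a))"
    by (rule sum.reindex_bij_witness_not_neutral[
          where S' = "{j. j \<le> nat (q + int N) \<and> (p + 2 * int N + int j < 0 \<or> q + int N < int j)}"
          and T' = "{a. a \<le> nat (p + q + 3 * int N) \<and> (int a < p + 2 * int N \<or> int a > p + q + 3 * int N)}"
          and i = "\<lambda>a. nat (int a - p - 2 * int N)" 
          and j = "\<lambda>j. if p + 2 * int N + int j < 0 then nat (p + q + 3 * int N) + 1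
             else nat (p + 2 * int N + int j)"])
      (auto simp: coef_zw_def neg_binom_gbin algebra_simps)
  finally show ?thesis .
qed

lemma expand_wz_frac:
  "expand_wz (zw_frac N g) p q = (\<Sum>a\<le>nat (p + q + 3 * int N).
     coef_wz (int a - int N) (p + q + 2 * int N - int a) (- int N) p q *\<^sub>C
       ext2 g (int a) (p + q + 3 * int N - int a))"
proof -
  have sgn: "(-1::complex) ^ N = (-1) powi int N"
    by simp
  have "expand_wz (zw_frac N g) p q = (\<Sum>j\<le>nat (p + int N).
     ((-1) ^ N * neg_binom N j) *\<^sub>C ext2 g (p + int N - int j) (q + 2 * int N + int j))"
    by (simp add: expand_wz.abs_eq zw_frac.abs_eq cvec.scale_sum_right)
  also have "\<dots> = (\<Sum>a\<le>nat (p + q + 3 * int N).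
     coef_wz (int a - int N) (p + q + 2 * int N - int a) (- int N) p q *\<^sub>C
       ext2 g (int a) (p + q + 3 * int N - int a))"
    by (rule sum.reindex_bij_witness_not_neutral[
          where S' = "{j. j \<le> nat (p + int N) \<and> (p + int N < int j \<or> q + 2 * int N + int j < 0)}"
          and T' = "{a. a \<le> nat (p + q + 3 * int N) \<and> (p + int N < int a \<or> int a > p + q + 3 * int N)}"
          and i = "\<lambda>a. nat (p + int N - int a)" 
          and j = "\<lambda>j. if p + int N < int j \<or> q + 2 * int N + int j < 0 then nat (p + q + 3 * int N) + 1
             else nat (p + int N - int j)"])
      (auto simp: coef_wz_def neg_binom_gbin sgn powi_minus_one_add powi_minus_one_diff algebra_simps
        simp del: power_int_of_nat)
  finally show ?thesis .
qed

lemma expand_w_diff_frac: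
  "expand_w_diff (zw_frac N g) p q = (\<Sum>a\<le>nat (p + q + 3 * int N).
     coef_diff (int a - int N) (p + q + 2 * int N - int a) (- int N) p q *\<^sub>C
       ext2 g (int a) (p + q + 3 * int N - int a))"
  by (auto simp: expand_w_diff.abs_eq zw_frac.abs_eq coef_diff_def gbin_def intro!: sum.cong)

lemmas expand_frac = expand_zw_frac expand_wz_frac expand_w_diff_frac

section \<open>Arithmetic of fractions and linearity of the expansions\<close>

lemma zw_frac_mult: "zw_frac (N + k) ((mult_zw ^^ k) g) = zw_frac N g"
  by transfer (simp add: frac_rel_def funpow_funpow add.commute)

lemma zw_frac_add: "zw_frac N a + zw_frac N b = zw_frac N (a + b)"
  by transfer (simp add: frac_rel_def frac_add_def funpow_additive[OF mult_zw_linear(1)] funpow_funpow)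

lemma zw_frac_scale: "c *\<^sub>C zw_frac N a = zw_frac N (c *\<^sub>C a)"
  by transfer (simp add: frac_rel_def)

lemma zw_frac_zero: "zw_frac N 0 = 0"
  by transfer (simp add: frac_rel_def funpow_additive[OF mult_zw_linear(1)])

lemma zw_frac_cases: obtains N g where "f = zw_frac N g"
  by transfer (metis surj_pair frac_rel_equivp[OF inj_mult_zw] equivp_reflp)

lemma funpow_mult_zw_in:
  assumes "cvec.subspace M" "\<And>a b. g a b \<in> M"
  shows "(mult_zw ^^ k) g a b \<in> M"
  using assms
  by (induction k arbitrary: a b)
    (auto simp: mult_zw_def ext2_def cvec.subspace_0 intro!: cvec.subspace_diff cvec.subspace_neg)

lemma zw_frac_common:
  obtains N g h where "e = zw_frac N g" "f = zw_frac N h"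
proof -
  obtain N1 g1 N2 g2 where "e = zw_frac N1 g1" "f = zw_frac N2 g2"
    by (metis zw_frac_cases)
  then have "e = zw_frac (N1 + N2) ((mult_zw ^^ N2) g1)" "f = zw_frac (N1 + N2) ((mult_zw ^^ N1) g2)"
    by (simp_all add: zw_frac_mult) (metis add.commute zw_frac_mult)
  then show thesis
    by (rule that)
qed

lemma expand_add:
  "expand_zw (e + f) p q = expand_zw e p q + expand_zw f p q"
  "expand_wz (e + f) p q = expand_wz e p q + expand_wz f p q"
  "expand_w_diff (e + f) p q = expand_w_diff e p q + expand_w_diff f p q"
  by (rule zw_frac_common[of e f], simp add: zw_frac_add expand_frac ext2_linear
      cvec.scale_right_distrib sum.distrib)+

lemma expand_scale:
  "expand_zw (c *\<^sub>C f) p q = c *\<^sub>C expand_zw f p q"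
  "expand_wz (c *\<^sub>C f) p q = c *\<^sub>C expand_wz f p q"
  "expand_w_diff (c *\<^sub>C f) p q = c *\<^sub>C expand_w_diff f p q"
  by (rule zw_frac_cases[of f], simp add: zw_frac_scale expand_frac ext2_linear cvec.scale_sum_right mult.commute)+

lemma expand_zero:
  "expand_zw 0 p q = 0" "expand_wz 0 p q = 0" "expand_w_diff 0 p q = 0"
  using expand_scale[of 0 0 p q] by simp_all

lemma expand_diff:
  "expand_zw (e - f) p q = expand_zw e p q - expand_zw f p q"
  "expand_wz (e - f) p q = expand_wz e p q - expand_wz f p q"
  "expand_w_diff (e - f) p q = expand_w_diff e p q - expand_w_diff f p q"
  using expand_add[of "e - f" f p q] by simp_all

lemma expand_sum:
  "expand_zw (sum f A) p q = (\<Sum>s\<in>A. expand_zw (f s) p q)"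
  "expand_wz (sum f A) p q = (\<Sum>s\<in>A. expand_wz (f s) p q)"
  "expand_w_diff (sum f A) p q = (\<Sum>s\<in>A. expand_w_diff (f s) p q)"
  by (induction A rule: infinite_finite_induct) (simp_all add: expand_zero expand_add)

lemma zw_frac_in: "(\<And>a b. g a b \<in> M) \<Longrightarrow> zw_frac N g \<in> zw_series_in M"
  by (auto simp: zw_series_in_def)

lemma subspace_zw_series_in:
  assumes "cvec.subspace M"
  shows "cvec.subspace (zw_series_in M)"
proof (rule cvec.subspaceI)
  show "0 \<in> zw_series_in M"
    unfolding zw_series_in_def using cvec.subspace_0[OF assms] zw_frac_zero[of 0]
    by (auto intro!: exI[of _ 0])
next
  fix e f
  assume "e \<in> zw_series_in M" "f \<in> zw_series_in M"
  then obtain N g N' g' where e: "e = zw_frac N g" "f = zw_frac N' g'"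
    and M: "\<And>a b. g a b \<in> M" "\<And>a b. g' a b \<in> M"
    by (auto simp: zw_series_in_def)
  have "e + f = zw_frac (N + N') ((mult_zw ^^ N') g) + zw_frac (N' + N) ((mult_zw ^^ N) g')"
    by (simp only: e zw_frac_mult)
  also have "\<dots> = zw_frac (N + N') ((mult_zw ^^ N') g + (mult_zw ^^ N) g')"
    by (simp only: zw_frac_add add.commute[of N'])
  finally show "e + f \<in> zw_series_in M"
    using funpow_mult_zw_in[OF assms, of g N'] funpow_mult_zw_in[OF assms, of g' N] M
    by (simp add: zw_frac_in cvec.subspace_add[OF assms])
next
  fix c f
  assume "f \<in> zw_series_in M"
  then show "c *\<^sub>C f \<in> zw_series_in M"
    by (fastforce simp: zw_series_in_def zw_frac_scale intro: cvec.subspace_scale[OF assms])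
qed

text \<open>For \<open>N = 0\<close> the binomial matrix is unitriangular, so the unknowns vanish
  successively from the largest index down. Since the hypothesis covers all \<open>j\<close>, adding
  the equations for \<open>j\<close> and \<open>j - 1\<close> lowers the shift \<open>N\<close> by
  Pascal's rule.\<close>

lemma sum_triangular_eq_0:
  fixes y :: "nat \<Rightarrow> 'm::complex_vector"
  assumes "\<And>j. (\<Sum>a\<le>n. gbin (int a - int N) j *\<^sub>C y a) = 0" and "a \<le> n"
  shows "y a = 0"
proof -
  have zero: "(\<Sum>a\<le>n. gbin (int a) j *\<^sub>C y a) = 0" for j
    using assms(1)
  proof (induction N arbitrary: j)
    case (Suc N)
    have "gbin (int a - int N) j = gbin (int a - int (Suc N)) j + gbin (int a - int (Suc N)) (j - 1)"
      for a j
      using gbin_Pascal[of "int a - int (Suc N)" j] by (simp add: algebra_simps)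
    then have "(\<Sum>a\<le>n. gbin (int a - int N) j *\<^sub>C y a) = 0" for j
      using Suc.prems by (simp add: cvec.scale_left_distrib sum.distrib del: of_nat_Suc)
    then show ?case
      by (rule Suc.IH)
  qed simp
  have "\<forall>a. n - k \<le> a \<and> a \<le> n \<longrightarrow> y a = 0" if "k \<le> n" for k
    using that
  proof (induction k)
    case 0
    have "(\<Sum>a\<le>n. gbin (int a) (int n) *\<^sub>C y a) = (\<Sum>a\<in>{n}. gbin (int a) (int n) *\<^sub>C y a)"
      by (rule sum.mono_neutral_right)
        (auto simp: gbin_def binomial_gbinomial[symmetric])
    with zero[of n] show ?case
      by (auto simp: gbin_def binomial_gbinomial[symmetric])
  next
    case (Suc k)
    have "(\<Sum>a\<le>n. gbin (int a) (int (n - Suc k)) *\<^sub>C y a) =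
        (\<Sum>a\<in>{n - Suc k}. gbin (int a) (int (n - Suc k)) *\<^sub>C y a)"
    proof (rule sum.mono_neutral_right)
      show "\<forall>a\<in>{..n} - {n - Suc k}. gbin (int a) (int (n - Suc k)) *\<^sub>C y a = 0"
      proof
        fix a assume a: "a \<in> {..n} - {n - Suc k}"
        show "gbin (int a) (int (n - Suc k)) *\<^sub>C y a = 0"
        proof (cases "a < n - Suc k")
          case False
          then have "n - k \<le> a"
            using a by auto
          then show ?thesis
            using Suc a by auto
        qed (simp add: gbin_def binomial_gbinomial[symmetric] binomial_eq_0)
      qed
    qed auto
    with zero[of "n - Suc k"] have "y (n - Suc k) = 0"
      by (auto simp: gbin_def binomial_gbinomial[symmetric])
    moreover have "n - k \<le> a \<or> a = n - Suc k" if "n - Suc k \<le> a" for a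
      using that by linarith
    ultimately show ?case
      using Suc by (metis Suc_leD)
  qed
  from this[of n] assms(2) show ?thesis
    by simp
qed

text \<open>The denominator has leading term \<open>z^(-2N) w^(-N)\<close>, so the coefficient at
  \<open>(a - 2N, b - N)\<close> is \<open>g a b\<close> plus terms with smaller second index in the
  same degree.\<close>

lemma expand_zw_frac_eq_0:
  assumes "\<And>p q. p + q = D \<Longrightarrow> expand_zw (zw_frac N g) p q = 0" "int a + int b = D + 3 * int N"
  shows "g a b = 0"
  using assms(2)
proof (induction b arbitrary: a rule: less_induct)
  case (less b)
  have "0 = expand_zw (zw_frac N g) (int a - 2 * int N) (int b - int N)"
    using less.prems by (intro assms(1)[symmetric]) simp
  also have "\<dots> = (\<Sum>j\<le>b. neg_binom N j *\<^sub>C ext2 g (int a + int j) (int b - int j))"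
    by (simp add: expand_zw.abs_eq zw_frac.abs_eq)
  also have "\<dots> = (\<Sum>j\<in>{0}. neg_binom N j *\<^sub>C ext2 g (int a + int j) (int b - int j))"
    using less by (intro sum.mono_neutral_right) (auto simp: ext2_def nat_add_distrib nat_diff_distrib)
  finally show ?case
    by simp
qed

lemma expand_wz_frac_eq_0:
  assumes "\<And>p q. p + q = D \<Longrightarrow> expand_wz (zw_frac N g) p q = 0" "int a + int b = D + 3 * int N"
  shows "g a b = 0"
  using assms(2)
proof (induction a arbitrary: b rule: less_induct)
  case (less a)
  have "0 = expand_wz (zw_frac N g) (int a - int N) (int b - 2 * int N)"
    using less.prems by (intro assms(1)[symmetric]) simp
  also have "\<dots> = (- 1) ^ N *\<^sub>C (\<Sum>j\<le>a. neg_binom N j *\<^sub>C ext2 g (int a - int j) (int b + int j))"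
    by (simp add: expand_wz.abs_eq zw_frac.abs_eq)
  also have "(\<Sum>j\<le>a. neg_binom N j *\<^sub>C ext2 g (int a - int j) (int b + int j)) = 
      (\<Sum>j\<in>{0}. neg_binom N j *\<^sub>C ext2 g (int a - int j) (int b + int j))"
    using less by (intro sum.mono_neutral_right) (auto simp: ext2_def nat_add_distrib nat_diff_distrib)
  finally show ?case
    by simp
qed

lemma expand_w_diff_frac_eq_0:
  assumes "\<And>p q. p + q = D \<Longrightarrow> expand_w_diff (zw_frac N g) p q = 0" "int a + int b = D + 3 * int N"
  shows "g a b = 0"
proof -
  define n where "n = nat (D + 3 * int N)"
  have n: "int n = D + 3 * int N"
    using assms(2) by (simp add: n_def)
  then have D: "D = int n - 3 * int N"
    by simp
  have "(\<Sum>c\<le>n. gbin (int c - int N) j *\<^sub>C ext2 g (int c) (int n - int c)) = 0" for j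
  proof -
    have "expand_w_diff (zw_frac N g) (j - int N) (D - (j - int N)) = 0"
      by (rule assms(1)) simp
    then show ?thesis
      unfolding expand_w_diff_frac coef_diff_def D by simp
  qed
  then have "ext2 g (int a) (int n - int a) = 0"
    by (rule sum_triangular_eq_0) (use assms(2) n in linarith)
  moreover have "int n - int a = int b"
    using assms(2) n by linarith
  ultimately show ?thesis
    by simp
qed

lemma expand_frac_cong:
  assumes "\<And>a b. int a + int b = p + q + 3 * int N \<Longrightarrow> g a b = h a b"
  shows "expand_zw (zw_frac N g) p q = expand_zw (zw_frac N h) p q"
    "expand_wz (zw_frac N g) p q = expand_wz (zw_frac N h) p q"
    "expand_w_diff (zw_frac N g) p q = expand_w_diff (zw_frac N h) p q"
proof -
  have *: "ext2 g (int a) (p + q + 3 * int N - int a) = ext2 h (int a) (p + q + 3 * int N - int a)" for a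
    using assms[of a "nat (p + q + 3 * int N - int a)"] by (simp add: ext2_def)
  show "expand_zw (zw_frac N g) p q = expand_zw (zw_frac N h) p q"
    "expand_wz (zw_frac N g) p q = expand_wz (zw_frac N h) p q"
    "expand_w_diff (zw_frac N g) p q = expand_w_diff (zw_frac N h) p q"
    by (simp_all only: expand_frac *)
qed

text \<open>Degree \<open>D\<close> of any expansion involves exactly the numerator coefficients
  with \<open>a + b = D + 3N\<close>, and each of the three expansions recovers these.\<close>

lemma expand_transfer:
  assumes "(\<forall>p q. p + q = D \<longrightarrow> expand_zw e p q = expand_zw f p q) \<or>
      (\<forall>p q. p + q = D \<longrightarrow> expand_wz e p q = expand_wz f p q) \<or>
      (\<forall>p q. p + q = D \<longrightarrow> expand_w_diff e p q = expand_w_diff f p q)"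
    and "p + q = D"
  shows "expand_zw e p q = expand_zw f p q" "expand_wz e p q = expand_wz f p q"
    "expand_w_diff e p q = expand_w_diff f p q"
proof -
  obtain N g where g: "e - f = zw_frac N g"
    by (rule zw_frac_cases)
  have "g a b = 0" if "int a + int b = D + 3 * int N" for a b
  proof -
    have "(\<forall>p q. p + q = D \<longrightarrow> expand_zw (zw_frac N g) p q = 0) \<or>
        (\<forall>p q. p + q = D \<longrightarrow> expand_wz (zw_frac N g) p q = 0) \<or>
        (\<forall>p q. p + q = D \<longrightarrow> expand_w_diff (zw_frac N g) p q = 0)"
      using assms(1) by (simp add: g[symmetric] expand_diff)
    then show ?thesis
      using that expand_zw_frac_eq_0 expand_wz_frac_eq_0 expand_w_diff_frac_eq_0 by blast
  qed
  then have "expand_zw (e - f) p q = 0" "expand_wz (e - f) p q = 0" "expand_w_diff (e - f) p q = 0"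
    using expand_frac_cong[of p q N g 0] assms(2) by (simp_all add: g zw_frac_zero expand_zero)
  then show "expand_zw e p q = expand_zw f p q" "expand_wz e p q = expand_wz f p q"
    "expand_w_diff e p q = expand_w_diff f p q"
    by (simp_all add: expand_diff)
qed

lemma expand_inject:
  assumes "expand_zw e = expand_zw f \<or> expand_wz e = expand_wz f \<or> expand_w_diff e = expand_w_diff f"
  shows "e = f"
proof -
  have zw: "expand_zw e p q = expand_zw f p q" for p q
    by (rule expand_transfer(1)[where D = "p + q"]) (use assms in auto)
  obtain N g where g: "e - f = zw_frac N g"
    by (rule zw_frac_cases)
  have "g a b = 0" for a b
    by (rule expand_zw_frac_eq_0[of "int a + int b - 3 * int N" N]) (simp_all add: zw g[symmetric] expand_diff)
  then have "g = 0"
    by (simp add: fun_eq_iff)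
  then show ?thesis
    using g by (simp add: zw_frac_zero)
qed

section \<open>Linear maps applied to coefficients, and monomials\<close>

lemma linear_on_0: "linear_on S U L \<Longrightarrow> cvec.subspace S \<Longrightarrow> L 0 = 0"
  unfolding linear_on_def by (metis cvec.scale_zero_left cvec.subspace_0)

lemma linear_on_sum:
  assumes L: "linear_on S U L" and S: "cvec.subspace S" and "\<And>a. a \<in> A \<Longrightarrow> x a \<in> S"
  shows "L (\<Sum>a\<in>A. c a *\<^sub>C x a) = (\<Sum>a\<in>A. c a *\<^sub>C L (x a))"
  using assms(3)
proof (induction A rule: infinite_finite_induct)
  case (insert a A)
  have "L (c a *\<^sub>C x a + (\<Sum>a\<in>A. c a *\<^sub>C x a)) = c a *\<^sub>C L (x a) + L (\<Sum>a\<in>A. c a *\<^sub>C x a)"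
  proof -
    have "c a *\<^sub>C x a \<in> S" "(\<Sum>a\<in>A. c a *\<^sub>C x a) \<in> S"
      using insert.prems by (auto intro!: cvec.subspace_scale[OF S] cvec.subspace_sum[OF S])
    then show ?thesis
      using L insert.prems by (simp add: linear_on_def)
  qed
  then show ?case
    using insert by simp
qed (simp_all add: linear_on_0[OF L S])

text \<open>Applying a linear map to the numerator commutes with all three expansions. It serves to
  multiply a whole three-point series by a further vector.\<close>

lemma zw_series_map:
  fixes L :: "'m::complex_vector \<Rightarrow> 'n::complex_vector"
  assumes L: "linear_on S U L" and S: "cvec.subspace S" and "f \<in> zw_series_in S"
  obtains f' where "f' \<in> zw_series_in U"
    "\<And>p q. expand_zw f' p q = L (expand_zw f p q)"
    "\<And>p q. expand_wz f' p q = L (expand_wz f p q)"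
    "\<And>p q. expand_w_diff f' p q = L (expand_w_diff f p q)"
proof -
  obtain N g where f: "f = zw_frac N g" and g: "\<And>a b. g a b \<in> S"
    using assms(3) by (auto simp: zw_series_in_def)
  let ?g = "\<lambda>a b. L (g a b)"
  have ext: "ext2 ?g p q = L (ext2 g p q)" "ext2 g p q \<in> S" for p q
    using g cvec.subspace_0[OF S] by (simp_all add: ext2_def linear_on_0[OF L S])
  show thesis
  proof (rule that[of "zw_frac N ?g"])
    show "zw_frac N ?g \<in> zw_series_in U"
      using g L by (auto simp: linear_on_def intro!: zw_frac_in)
  qed (simp_all add: f expand_frac ext linear_on_sum[OF L S])
qed

text \<open>Numerators with one term give the monomials with \<open>d = - N\<close> directly.
  \<open>coef_Pascal\<close> then raises \<open>d\<close> by one at the price of raising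
  \<open>a\<close> or \<open>b\<close>, so the induction leaves these free.\<close>

lemma zw_monomial:
  assumes M: "cvec.subspace M" and x: "x \<in> M"
  obtains f where "f \<in> zw_series_in M"
    "\<And>p q. expand_zw f p q = coef_zw a b d p q *\<^sub>C x"
    "\<And>p q. expand_wz f p q = coef_wz a b d p q *\<^sub>C x"
    "\<And>p q. expand_w_diff f p q = coef_diff a b d p q *\<^sub>C x"
proof -
  define Q where "Q a b d f \<longleftrightarrow> f \<in> zw_series_in M \<and> (\<forall>p q.
    expand_zw f p q = coef_zw a b d p q *\<^sub>C x \<and> expand_wz f p q = coef_wz a b d p q *\<^sub>C x \<and>
    expand_w_diff f p q = coef_diff a b d p q *\<^sub>C x)" for a b d f
  define P where "P a b d \<longleftrightarrow> (\<exists>f. Q a b d f)" for a b d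
  have base: "P (int i - int N) (int j - int N) (- int N)" for i j N
  proof -
    define g where "g = (\<lambda>a b. if a = i \<and> b = j then x else 0)"
    have *: "(\<Sum>a\<le>nat (p + q + 3 * int N). C a *\<^sub>C ext2 g (int a) (p + q + 3 * int N - int a)) =
        (if p + q + 3 * int N = int i + int j then C i *\<^sub>C x else 0)" for C :: "nat \<Rightarrow> complex" and p q
    proof -
      have "C a *\<^sub>C ext2 g (int a) (p + q + 3 * int N - int a) =
        (if a = i then (if p + q + 3 * int N = int i + int j then C i *\<^sub>C x else 0) else 0)" for a
        by (auto simp: g_def ext2_def)
      then show ?thesis
        by auto
    qed
    have e: "int i - (p + int N * 2) = q + int N - int j"
      if "p + (q + int N * 3) = int i + int j" for p q
      using that by simp
    have "zw_frac N g \<in> zw_series_in M"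
      using x cvec.subspace_0[OF M] by (auto simp: g_def intro!: zw_frac_in)
    then show ?thesis
      unfolding P_def Q_def
      by (intro exI[of _ "zw_frac N g"] conjI) (assumption, unfold expand_frac *, auto simp: coef_defs e algebra_simps)
  qed
  have step: "P a b (d + 1)" if P: "P (a + 1) b d" "P a (b + 1) d" for a b d
  proof -
    obtain e f where "Q (a + 1) b d e" "Q a (b + 1) d f"
      using P unfolding P_def by blast
    moreover from this have "e - f \<in> zw_series_in M"
      unfolding Q_def by (intro cvec.subspace_diff[OF subspace_zw_series_in[OF M]]) blast+
    ultimately show ?thesis
      unfolding P_def Q_def
      by (intro exI[of _ "e - f"]) (simp add: expand_diff coef_Pascal cvec.scale_left_diff_distrib)
  qed
  \<comment> \<open>Large enough for all three exponents to be at least \<open>- N\<close>.\<close>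
  define N where "N = nat \<bar>a\<bar> + nat \<bar>b\<bar> + nat \<bar>d\<bar>"
  have P: "P a b (int k - int N)" if "a \<ge> - int N" "b \<ge> - int N" for k a b
    using that
  proof (induction k arbitrary: a b)
    case 0
    then show ?case
      using base[of "nat (a + int N)" N "nat (b + int N)"] by simp
  next
    case (Suc k)
    have e: "int (Suc k) - int N = int k - int N + 1"
      by simp
    show ?case
      unfolding e by (rule step) (use Suc in auto)
  qed
  have "P a b (int (nat (d + int N)) - int N)"
    by (rule P) (auto simp: N_def)
  moreover have "d + int N \<ge> 0"
    unfolding N_def by linarith
  then have "int (nat (d + int N)) - int N = d"
    by simp
  ultimately have "P a b d"
    by simp
  then show thesis
    unfolding P_def Q_def using that by blast
qed

text \<open>Prescribing one expansion is enough: it determines the series, hence the other two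
  expansions.\<close>

definition zw_mon :: "int \<Rightarrow> int \<Rightarrow> int \<Rightarrow> 'm::complex_vector \<Rightarrow> 'm zw_series" where
  "zw_mon a b d x = (SOME f. expand_zw f = (\<lambda>p q. coef_zw a b d p q *\<^sub>C x))"

lemma zw_mon_eqI:
  assumes "\<And>p q. expand_zw f p q = coef_zw a b d p q *\<^sub>C x"
  shows "zw_mon a b d x = f"
proof -
  have f: "expand_zw f = (\<lambda>p q. coef_zw a b d p q *\<^sub>C x)"
    using assms by (simp add: fun_eq_iff)
  show ?thesis
    unfolding zw_mon_def
    by (rule some_equality) (use f in \<open>auto intro: expand_inject\<close>)
qed

lemma expand_zw_mon:
  "expand_zw (zw_mon a b d x) p q = coef_zw a b d p q *\<^sub>C x"
  "expand_wz (zw_mon a b d x) p q = coef_wz a b d p q *\<^sub>C x"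
  "expand_w_diff (zw_mon a b d x) p q = coef_diff a b d p q *\<^sub>C x"
proof -
  obtain f where
    "\<And>p q. expand_zw f p q = coef_zw a b d p q *\<^sub>C x"
    "\<And>p q. expand_wz f p q = coef_wz a b d p q *\<^sub>C x"
    "\<And>p q. expand_w_diff f p q = coef_diff a b d p q *\<^sub>C x"
    by (rule zw_monomial[OF cvec.subspace_UNIV UNIV_I, where x = x and a = a and b = b and d = d]) blast
  moreover from this(1) have "zw_mon a b d x = f"
    by (rule zw_mon_eqI)
  ultimately show "expand_zw (zw_mon a b d x) p q = coef_zw a b d p q *\<^sub>C x"
    "expand_wz (zw_mon a b d x) p q = coef_wz a b d p q *\<^sub>C x"
    "expand_w_diff (zw_mon a b d x) p q = coef_diff a b d p q *\<^sub>C x"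
    by simp_all
qed

section \<open>Faces of four-point series\<close>

text \<open>The substitution \<open>i = S - j\<close>. Since the three factors vanish at negative
  arguments, each of the two ranges contains all nonzero terms.\<close>

lemma sum_flip:
  fixes F G H :: "int \<Rightarrow> complex"
  assumes "\<And>k. k < 0 \<Longrightarrow> F k = 0" "\<And>k. k < 0 \<Longrightarrow> G k = 0" "\<And>k. k < 0 \<Longrightarrow> H k = 0"
  shows "(\<Sum>j\<le>nat R. F (int j) * G (R - int j) * H (S - int j)) =
    (\<Sum>i\<le>nat S. H (int i) * F (S - int i) * G (R - S + int i))"
  by (rule sum.reindex_bij_witness_not_neutral[
        where S' = "{j. j \<le> nat R \<and> (int j > S \<or> int j > R)}" and
          T' = "{i. i \<le> nat S \<and> (int i > S \<or> S - int i > R)}" and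
          i = "\<lambda>i. nat (S - int i)" and
          j = "\<lambda>j. if int j > S \<or> int j > R then nat S + 1 else nat (S - int j)"])
    (auto simp: algebra_simps assms)

lemma sum_reverse:
  fixes F G :: "int \<Rightarrow> complex"
  assumes "\<And>k. k < 0 \<Longrightarrow> F k = 0" "\<And>k. k < 0 \<Longrightarrow> G k = 0"
  shows "(\<Sum>j\<le>nat R. F (int j) * G (R - int j) * H (int j)) =
    (\<Sum>j\<le>nat R. F (R - int j) * G (int j) * H (R - int j))"
  by (rule sum.reindex_bij_witness_not_neutral[
        where S' = "{j. j \<le> nat R \<and> int j > R}" and T' = "{j. j \<le> nat R \<and> int j > R}" and
          i = "\<lambda>j. nat (R - int j)" and
          j = "\<lambda>j. if int j > R then nat R + 1 else nat (R - int j)"])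
       (auto simp: algebra_simps assms)

text \<open>
  The boundary strata of the monomial \<open>z\<^sup>a w\<^sup>b t\<^sup>c (z - w)\<^sup>d (z - t)\<^sup>e (w - t)\<^sup>f\<close>: a coefficient in one
  variable is a combination of monomials in the other two, expanded by \<open>C\<close>. The name of a face
  gives that variable; \<open>face_t'\<close> is the coefficient of \<open>t\<^sup>r\<close> when \<open>z - t\<close> and \<open>w - t\<close> are small.
\<close>

type_synonym coef2 = "int \<Rightarrow> int \<Rightarrow> int \<Rightarrow> int \<Rightarrow> int \<Rightarrow> complex"

definition face_t :: "coef2 \<Rightarrow> int \<times> int \<times> int \<Rightarrow> int \<times> int \<times> int \<Rightarrow> int \<Rightarrow> int \<Rightarrow> int \<Rightarrow> complex" where
  "face_t C = (\<lambda>(a, b, c) (d, e, f) r p q. \<Sum>j\<le>nat (r - c).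
     ((-1) powi (r - c) * gbin e (int j) * gbin f (r - c - int j)) *
       C (a + e - int j) (b + f - (r - c) + int j) d p q)"

definition face_z_w :: "coef2 \<Rightarrow> int \<times> int \<times> int \<Rightarrow> int \<times> int \<times> int \<Rightarrow> int \<Rightarrow> int \<Rightarrow> int \<Rightarrow> complex" where
  "face_z_w C = (\<lambda>(a, b, c) (d, e, f) p q r. \<Sum>j\<le>nat (p - d).
     (gbin a (p - d - int j) * gbin e (int j)) *
       C (a + b - (p - d) + int j) c (e + f - int j) q r)"

definition face_z :: "coef2 \<Rightarrow> int \<times> int \<times> int \<Rightarrow> int \<times> int \<times> int \<Rightarrow> int \<Rightarrow> int \<Rightarrow> int \<Rightarrow> complex" where
  "face_z C = (\<lambda>(a, b, c) (d, e, f) p q r. \<Sum>i\<le>nat (a + d + e - p).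
     ((-1) powi (a + d + e - p) * gbin d (int i) * gbin e (a + d + e - p - int i)) *
       C (b + int i) (c + (a + d + e - p) - int i) f q r)"

definition face_w_t :: "coef2 \<Rightarrow> int \<times> int \<times> int \<Rightarrow> int \<times> int \<times> int \<Rightarrow> int \<Rightarrow> int \<Rightarrow> int \<Rightarrow> complex" where
  "face_w_t C = (\<lambda>(a, b, c) (d, e, f) q p r. \<Sum>j\<le>nat (q - f).
     ((-1) powi int j * gbin b (q - f - int j) * gbin d (int j)) *
       C a (b + c - (q - f) + int j) (d + e - int j) p r)"

definition face_t' :: "coef2 \<Rightarrow> int \<times> int \<times> int \<Rightarrow> int \<times> int \<times> int \<Rightarrow> int \<Rightarrow> int \<Rightarrow> int \<Rightarrow> complex" where
  "face_t' C = (\<lambda>(a, b, c) (d, e, f) r p q. \<Sum>i\<le>nat (a + b + c - r).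
     (gbin a (int i) * gbin b (a + b + c - r - int i)) *
       C (e + int i) (f + (a + b + c - r) - int i) d p q)"

lemmas face_defs = face_t_def face_z_w_def face_z_def face_w_t_def face_t'_def

text \<open>This and the next four lemmas are the corners of the pentagon, where adjacent faces
  meet. A corner is the iterated expansion belonging to one bracketing, and it is reached from two
  faces: here \<open>(uv)(xy)\<close>, then \<open>u(v(xy))\<close>, \<open>u((vx)y)\<close>,
  \<open>(u(vx))y\<close> and \<open>((uv)x)y\<close>. Outside the degree of the monomial both sides
  are 0; inside it the claim is an identity of binomial sums.\<close>

lemma face_t_z_w: "face_t coef_diff abc def r p q = face_z_w coef_zw abc def p q r"
proof -
  obtain a b c d e f where eqs: "abc = (a, b, c)" "def = (d, e, f)"
    by (metis surj_pair)
  show ?thesis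
  proof (cases "p + q + r = a + b + c + d + e + f")
    case True
    define R where "R = r - c"
    define P where "P = p - d"
    have q: "q = a + b + e + f - R - P" and rp: "r = R + c" "p = P + d"
      using True by (auto simp: R_def P_def)
    have "face_t coef_diff abc def r p q = (-1) powi R * (\<Sum>j\<le>nat R.
        gbin e (int j) * gbin f (R - int j) * gbin (a + e - int j) P)"
      by (auto simp: face_t_def eqs coef_diff_def q rp algebra_simps sum_distrib_left intro!: sum.cong)
    also have "\<dots> = (-1) powi R * (\<Sum>j\<le>nat P.
        gbin a (P - int j) * gbin e (int j) * gbin (e + f - int j) R)"
      by (simp only: gbin_sum_exchange)
    also have "\<dots> = face_z_w coef_zw abc def p q r"
      by (auto simp: face_z_w_def eqs coef_zw_def q rp algebra_simps sum_distrib_left intro!: sum.cong)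
    finally show ?thesis .
  qed (auto simp: face_defs eqs coef_defs intro!: sum.neutral)
qed

lemma face_t_z: "face_t coef_zw abc def r p q = face_z coef_zw abc def p q r"
proof -
  obtain a b c d e f where eqs: "abc = (a, b, c)" "def = (d, e, f)"
    by (metis surj_pair)
  show ?thesis
  proof (cases "p + q + r = a + b + c + d + e + f")
    case True
    define S where "S = a + d + e - p"
    define R where "R = r - c"
    have q: "q = S + b + f - R" and pr: "p = a + d + e - S" "r = R + c"
      using True by (auto simp: S_def R_def)
    have "face_t coef_zw abc def r p q = (-1) powi R * (\<Sum>j\<le>nat R.
        gbin e (int j) * gbin f (R - int j) * ((-1) powi (S - int j) * gbin d (S - int j)))"
      by (auto simp: face_t_def eqs coef_zw_def q pr algebra_simps sum_distrib_left intro!: sum.cong)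
    also have "(\<Sum>j\<le>nat R. gbin e (int j) * gbin f (R - int j) * ((-1) powi (S - int j) * gbin d (S - int j))) =
       (\<Sum>i\<le>nat S. ((-1) powi int i * gbin d (int i)) * gbin e (S - int i) * gbin f (R - S + int i))"
      by (rule sum_flip) simp_all
    also have "(-1) powi R * \<dots> = face_z coef_zw abc def p q r"
      by (auto simp: face_z_def eqs coef_zw_def q pr algebra_simps powi_minus_one_add
          powi_minus_one_diff sum_distrib_left intro!: sum.cong simp del: power_int_of_nat)
    finally show ?thesis .
  qed (auto simp: face_defs eqs coef_defs intro!: sum.neutral)
qed

lemma face_z_w_t: "face_z coef_diff abc def p q r = face_w_t coef_zw abc def q p r"
proof -
  obtain a b c d e f where eqs: "abc = (a, b, c)" "def = (d, e, f)"
    by (metis surj_pair)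
  show ?thesis
  proof (cases "p + q + r = a + b + c + d + e + f")
    case True
    define S where "S = a + d + e - p"
    define Q where "Q = q - f"
    have r: "r = S + b + c - Q" and pq: "p = a + d + e - S" "q = Q + f"
      using True by (auto simp: S_def Q_def)
    have "face_z coef_diff abc def p q r = (-1) powi S * (\<Sum>i\<le>nat S. gbin d (int i) * gbin e (S - int i) *
        gbin (b + int i) Q)"
      by (auto simp: face_z_def eqs coef_diff_def r pq algebra_simps sum_distrib_left intro!: sum.cong)
    also have "\<dots> = (-1) powi S * (\<Sum>j\<le>nat Q. gbin b (Q - int j) * gbin d (int j) *
        gbin (d + e - int j) (S - int j))"
      by (simp only: gbin_sum_exchange')
    also have "\<dots> = face_w_t coef_zw abc def q p r"
      by (auto simp: face_w_t_def eqs coef_zw_def r pq algebra_simps powi_minus_one_add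
          powi_minus_one_diff sum_distrib_left intro!: sum.cong simp del: power_int_of_nat)
    finally show ?thesis .
  qed (auto simp: face_defs eqs coef_defs intro!: sum.neutral)
qed

lemma face_w_t_t': "face_w_t coef_diff abc def q p r = face_t' coef_zw abc def r p q"
proof -
  obtain a b c d e f where eqs: "abc = (a, b, c)" "def = (d, e, f)"
    by (metis surj_pair)
  show ?thesis
  proof (cases "p + q + r = a + b + c + d + e + f")
    case True
    define S where "S = a + b + c - r"
    define Q where "Q = q - f"
    have p: "p = S + d + e - Q" and rq: "r = a + b + c - S" "q = Q + f"
      using True by (auto simp: S_def Q_def)
    have "face_w_t coef_diff abc def q p r = 
       (\<Sum>j\<le>nat Q. ((-1) powi int j * gbin d (int j)) * gbin b (Q - int j) * gbin a (S - Q + int j))"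
      by (auto simp: face_w_t_def eqs coef_diff_def p rq algebra_simps intro!: sum.cong)
    also have "\<dots> = (\<Sum>i\<le>nat S. gbin a (int i) * gbin b (S - int i) *
       ((-1) powi (Q - S + int i) * gbin d (Q - S + int i)))"
      proof -
      have "(\<Sum>j\<le>nat Q. ((-1) powi int j * gbin d (int j)) * gbin b (Q - int j) * gbin a (S - Q + int j)) =
        (\<Sum>i\<le>nat Q. ((-1) powi (Q - int i) * gbin d (Q - int i)) * gbin b (int i) * gbin a (S - int i))"
        using sum_reverse[of "\<lambda>k. (-1) powi k * gbin d k" "gbin b" Q "\<lambda>k. gbin a (S - Q + k)"] by simp
      also have "\<dots> = (\<Sum>i\<le>nat Q. gbin b (int i) * ((-1) powi (Q - int i) * gbin d (Q - int i)) * gbin a (S - int i))"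
        by (simp add: mult_ac)
      also have "\<dots> = (\<Sum>i\<le>nat S. gbin a (int i) * gbin b (S - int i) *
         ((-1) powi (Q - S + int i) * gbin d (Q - S + int i)))"
        by (rule sum_flip) simp_all
      finally show ?thesis .
    qed
    also have "\<dots> = face_t' coef_zw abc def r p q"
      by (auto simp: face_t'_def eqs coef_zw_def p rq algebra_simps intro!: sum.cong)
    finally show ?thesis .
  qed (auto simp: face_defs eqs coef_defs intro!: sum.neutral)
qed

lemma face_t'_z_w: "face_t' coef_diff abc def r p q = face_z_w coef_diff abc def p q r"
proof -
  obtain a b c d e f where eqs: "abc = (a, b, c)" "def = (d, e, f)"
    by (metis surj_pair)
  show ?thesis
  proof (cases "p + q + r = a + b + c + d + e + f")
    case True
    define S where "S = a + b + c - r"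
    define P where "P = p - d"
    have q: "q = S + e + f - P" and rp: "r = a + b + c - S" "p = P + d"
      using True by (auto simp: S_def P_def)
    have "face_t' coef_diff abc def r p q = (\<Sum>i\<le>nat S. gbin a (int i) * gbin b (S - int i) *
        gbin (e + int i) P)"
      by (auto simp: face_t'_def eqs coef_diff_def q rp algebra_simps intro!: sum.cong)
    also have "\<dots> = (\<Sum>j\<le>nat P. gbin e (P - int j) * gbin a (int j) *
        gbin (a + b - int j) (S - int j))"
      by (simp only: gbin_sum_exchange')
    also have "\<dots> = (\<Sum>j\<le>nat P. gbin e (int j) * gbin a (P - int j) *
        gbin (a + b - (P - int j)) (S - (P - int j)))"
      using sum_reverse[of "gbin a" "gbin e" P "\<lambda>k. gbin (a + b - k) (S - k)"] by (simp add: mult_ac)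
    also have "\<dots> = face_z_w coef_diff abc def p q r"
      by (auto simp: face_z_w_def eqs coef_diff_def q rp algebra_simps intro!: sum.cong)
    finally show ?thesis .
  qed (auto simp: face_defs eqs coef_defs intro!: sum.neutral)
qed

section \<open>Three-variable expansions in terms of faces\<close>

lemma expand_zwt_frac_raw:
  "expand_zwt (zwt_frac N g) p q r =
     expand_diffs (nat (r + int N) + nat (q + r + 3 * int N)) N N N (ext3 g)
       (p + int N) (q + int N) (r + int N)"
  by (simp add: expand_zwt.abs_eq zwt_frac.abs_eq)

lemma zwt_frac_cases: obtains N g where "f = zwt_frac N g"
  by transfer (metis surj_pair frac_rel_equivp[OF inj_mult_zwt] equivp_reflp)

lemma zwt_frac_zero: "zwt_frac N 0 = 0"
  by transfer (simp add: frac_rel_def funpow_additive[OF mult_zwt_linear(1)])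

text \<open>Expanding in \<open>t\<close> and then with \<open>w\<close> small against
  \<open>z\<close> is the nested expansion itself, so a four-point series is the sum of the
  \<open>face_t\<close> contributions of the monomials of its numerator. The exponent of
  \<open>z\<close> is fixed by the total degree; the six factors of the denominator account for
  \<open>6 * int N\<close>.\<close>

lemma expand_zwt_frac:
  fixes g :: "nat \<Rightarrow> nat \<Rightarrow> nat \<Rightarrow> 'm::complex_vector" and p q r :: int and N :: nat
  defines "n \<equiv> nat (p + q + r + 6 * int N)"
  shows "expand_zwt (zwt_frac N g) p q r = (\<Sum>(b, c)\<in>{..n} \<times> {..n}.
     face_t coef_zw (p + q + r + 5 * int N - int b - int c, int b - int N, int c - int N)
         (- int N, - int N, - int N) r p q *\<^sub>C
       ext3 g (p + q + r + 6 * int N - int b - int c) (int b) (int c))"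
proof -
  define K where "K = nat (r + int N) + nat (q + r + 3 * int N)"
  define d where "d = - int N"
  \<comment> \<open>\<open>G\<close> is the term indexed by the powers of \<open>w/z\<close>,
    \<open>t/z\<close> and \<open>t/w\<close>; \<open>H\<close> is the same term indexed by the
    exponents \<open>b\<close>, \<open>c\<close> of \<open>w\<close>, \<open>t\<close> in the
    numerator and the power \<open>j\<close> of \<open>t/z\<close>. On \<open>A\<close> and
    \<open>B\<close>, where no exponent is negative, the two indexings correspond
    bijectively.\<close>
  define G where "G = (\<lambda>(i, j, k). (neg_binom N i * neg_binom N j * neg_binom N k) *\<^sub>C
    ext3 g (p + 3 * int N + int i + int j) (q + 2 * int N - int i + int k) (r + int N - int j - int k))"
  define H where "H = (\<lambda>(b, c, j).
    ((-1) powi (r - int c + int N) * gbin d (int j) * gbin d (r - int c + int N - int j) *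
      ((-1) powi (q - int b + 2 * int N + (r - int c + int N) - int j) *
       gbin d (q - int b + 2 * int N + (r - int c + int N) - int j))) *\<^sub>C
    ext3 g (p + q + r + 6 * int N - int b - int c) (int b) (int c))"
  define A where "A = {(i, j, k). i \<le> K \<and> j \<le> K \<and> k \<le> K \<and> p + 3 * int N + int i + int j \<ge> 0 \<and>
    q + 2 * int N - int i + int k \<ge> 0 \<and> r + int N - int j - int k \<ge> 0}"
  define B where "B = {(b, c, j). b \<le> n \<and> c \<le> n \<and> j \<le> K \<and> p + q + r + 6 * int N - int b - int c \<ge> 0 \<and>
    r - int c + int N - int j \<ge> 0 \<and> q - int b + 2 * int N + (r - int c + int N) - int j \<ge> 0}"
  have face: "face_t coef_zw (p + q + r + 5 * int N - int b - int c, int b - int N, int c - int N)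
         (- int N, - int N, - int N) r p q *\<^sub>C
       ext3 g (p + q + r + 6 * int N - int b - int c) (int b) (int c) = (\<Sum>j\<le>K. H (b, c, j))" for b c
  proof -
    have "face_t coef_zw (p + q + r + 5 * int N - int b - int c, int b - int N, int c - int N)
         (- int N, - int N, - int N) r p q *\<^sub>C
       ext3 g (p + q + r + 6 * int N - int b - int c) (int b) (int c) =
       (\<Sum>j\<le>nat (r - int c + int N). H (b, c, j))"
      by (auto simp: face_t_def coef_zw_def H_def d_def cvec.scale_sum_left algebra_simps intro!: sum.cong)
    also have "\<dots> = (\<Sum>j\<le>K. H (b, c, j))"
      by (rule sum.mono_neutral_left) (auto simp: H_def K_def)
    finally show ?thesis .
  qed
  have "expand_zwt (zwt_frac N g) p q r = sum G ({..K} \<times> {..K} \<times> {..K})"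
    unfolding expand_zwt_frac_raw expand_diffs_def K_def[symmetric] G_def
    by (simp add: sum.cartesian_product algebra_simps)
  also have "\<dots> = sum G A"
    by (rule sum.mono_neutral_right) (auto simp: A_def G_def ext3_def split: if_splits)
  also have "\<dots> = sum H B"
  proof (rule sum.reindex_bij_witness[where
        j = "\<lambda>(i, j, k). (nat (q + 2 * int N - int i + int k), nat (r + int N - int j - int k), j)" and
        i = "\<lambda>(b, c, j). (nat (q - int b + 2 * int N + (r - int c + int N) - int j), j,
          nat (r - int c + int N - int j))"])
    fix x assume "x \<in> A"
    then obtain i j k where x: "x = (i, j, k)" "i \<le> K" "j \<le> K" "k \<le> K"
      "p + 3 * int N + int i + int j \<ge> 0"
      "q + 2 * int N - int i + int k \<ge> 0" "r + int N - int j - int k \<ge> 0"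
      by (auto simp: A_def)
    define b where "b = nat (q + 2 * int N - int i + int k)"
    define c where "c = nat (r + int N - int j - int k)"
    have i: "int i = q + 2 * int N + int k - int b" and r: "r = int c - int N + int j + int k"
      using x by (auto simp: b_def c_def)
    show "(case (case x of (i, j, k) \<Rightarrow> (nat (q + 2 * int N - int i + int k), nat (r + int N - int j - int k), j)) of
         (b, c, j) \<Rightarrow> (nat (q - int b + 2 * int N + (r - int c + int N) - int j), j,
          nat (r - int c + int N - int j))) = x"
      by (simp add: x(1) flip: b_def c_def) (use i r in auto)
    show "(case x of (i, j, k) \<Rightarrow> (nat (q + 2 * int N - int i + int k), nat (r + int N - int j - int k), j)) \<in> B"
      using x by (auto simp: B_def n_def)
    have 1: "r - int c + int N = int j + int k" "q - int b + 2 * int N + (int j + int k) - int j = int i"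
      "p + q + r + 6 * int N - int b - int c = p + 3 * int N + int i + int j" "int j + int k - int j = int k"
      and 2: "q + 2 * int N - int i + int k = int b" "r + int N - int j - int k = int c"
      using i r by auto
    have "H (b, c, j) = G (i, j, k)"
      unfolding H_def G_def prod.case 1 2 neg_binom_gbin d_def
      by (simp add: powi_minus_one_add mult_ac del: power_int_of_nat)
    then show "H (case x of (i, j, k) \<Rightarrow> (nat (q + 2 * int N - int i + int k), nat (r + int N - int j - int k), j)) = G x"
      by (simp add: x(1) flip: b_def c_def)
  next
    fix x assume "x \<in> B"
    then obtain b c j where x: "x = (b, c, j)" "b \<le> n" "c \<le> n" "j \<le> K"
      "p + q + r + 6 * int N - int b - int c \<ge> 0"
      "r - int c + int N - int j \<ge> 0" "q - int b + 2 * int N + (r - int c + int N) - int j \<ge> 0"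
      by (auto simp: B_def)
    then show "(case (case x of (b, c, j) \<Rightarrow> (nat (q - int b + 2 * int N + (r - int c + int N) - int j), j,
          nat (r - int c + int N - int j))) of
        (i, j, k) \<Rightarrow> (nat (q + 2 * int N - int i + int k), nat (r + int N - int j - int k), j)) = x"
      by auto
    show "(case x of (b, c, j) \<Rightarrow> (nat (q - int b + 2 * int N + (r - int c + int N) - int j), j,
          nat (r - int c + int N - int j))) \<in> A"
      using x by (auto simp: A_def K_def)
  qed
  also have "\<dots> = sum H ({..n} \<times> {..n} \<times> {..K})"
  proof (rule sum.mono_neutral_left)
    show "\<forall>x\<in>{..n} \<times> {..n} \<times> {..K} - B. H x = 0"
      by (auto simp: B_def H_def gbin_def ext3_def split: if_splits)
  qed (auto simp: B_def)
  also have "\<dots> = (\<Sum>b\<le>n. \<Sum>c\<le>n. \<Sum>j\<le>K. H (b, c, j))"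
    by (simp add: sum.cartesian_product)
  finally show ?thesis
    unfolding face sum.cartesian_product[symmetric] .
qed

text \<open>The denominator has leading term \<open>z^(-3N) w^(-2N) t^(-N)\<close>. Its further
  terms bring in only coefficients of the numerator with smaller exponent of \<open>t\<close>, or
  with the same one and smaller exponent of \<open>w\<close>; hence the lexicographic
  induction.\<close>

lemma expand_zwt_eq_0:
  fixes f :: "'m::complex_vector zwt_series"
  assumes "\<And>p q r. expand_zwt f p q r = 0"
  shows "f = 0"
proof -
  obtain N g where f: "f = zwt_frac N g"
    by (rule zwt_frac_cases)
  have "g a b c = 0" for a b c
  proof (induction c arbitrary: a b rule: less_induct)
    case IHc: (less c)
    show ?case
    proof (induction b arbitrary: a rule: less_induct)
    case IHb: (less b)
    have IH: "g a' b' c' = 0" if "c' < c \<or> c' = c \<and> b' < b" for a' b' c'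
      using that IHb IHc by blast
    define K where "K = nat (int c) + nat (int b + int c)"
    define G where "G = (\<lambda>(i, j, k). (neg_binom N i * neg_binom N j * neg_binom N k) *\<^sub>C
      ext3 g (int a + int i + int j) (int b - int i + int k) (int c - int j - int k))"
    have "G x = 0" if "x \<noteq> (0, 0, 0)" for x
    proof -
      obtain i j k where x: "x = (i, j, k)"
        by (cases x)
      have "ext3 g (int a + int i + int j) (int b - int i + int k) (int c - int j - int k) = 0"
      proof (cases "int b - int i + int k \<ge> 0 \<and> int c - int j - int k \<ge> 0")
        case True
        have "nat (int c - int j - int k) < c \<or>
            nat (int c - int j - int k) = c \<and> nat (int b - int i + int k) < b"
          using True that x by auto
        from IH[OF this] show ?thesis
          by (simp add: ext3_def)
      qed auto
      then show ?thesis
        by (simp add: G_def x)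
    qed
    then have "sum G ({..K} \<times> {..K} \<times> {..K}) = sum G {(0, 0, 0)}"
      by (intro sum.mono_neutral_right) auto
    moreover have "expand_zwt (zwt_frac N g) (int a - 3 * int N) (int b - 2 * int N) (int c - int N) =
        sum G ({..K} \<times> {..K} \<times> {..K})"
      unfolding expand_zwt_frac_raw expand_diffs_def G_def K_def
      by (simp add: sum.cartesian_product algebra_simps)
    ultimately show "g a b c = 0"
      using assms[of "int a - 3 * int N" "int b - 2 * int N" "int c - int N"] by (simp add: f G_def)
    qed
  qed
  then have "g = 0"
    by (simp add: fun_eq_iff)
  then show ?thesis
    by (simp add: f zwt_frac_zero)
qed

text \<open>A face is a finite combination of monomials, so its expansions come from a genuine
  two-variable series.\<close>

lemma face_series:
  fixes x :: "'s \<Rightarrow> 'm::complex_vector"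
  assumes "finite J" and "\<And>s. finite (I s)"
  shows "\<exists>F.
    (\<forall>p q. expand_zw F p q = (\<Sum>s\<in>J. (\<Sum>j\<in>I s. c s j * coef_zw (A s j) (B s j) (D s j) p q) *\<^sub>C x s)) \<and>
    (\<forall>p q. expand_w_diff F p q = (\<Sum>s\<in>J. (\<Sum>j\<in>I s. c s j * coef_diff (A s j) (B s j) (D s j) p q) *\<^sub>C x s))"
  by (rule exI[of _ "\<Sum>s\<in>J. \<Sum>j\<in>I s. c s j *\<^sub>C zw_mon (A s j) (B s j) (D s j) (x s)"])
    (simp add: expand_sum expand_scale expand_zw_mon cvec.scale_sum_left)

section \<open>Graded products\<close>

text \<open>Non-vanishing of some composite is part of the notion, since otherwise \<open>a\<close>
  would not be determined and identities between such scalars could not be read off from vectors.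
  Only two expansions are recorded; the third will follow from skew-symmetry.\<close>

definition associator ::
    "('a::plus \<Rightarrow> 'v::complex_vector set) \<Rightarrow> ('a \<Rightarrow> 'a \<Rightarrow> 'v \<Rightarrow> 'v \<Rightarrow> 'v fls) \<Rightarrow> 'a \<Rightarrow> 'a \<Rightarrow> 'a \<Rightarrow> complex \<Rightarrow> bool" where
  "associator S m i j k a \<longleftrightarrow> a \<noteq> 0 \<and>
     (\<forall>u\<in>S i. \<forall>v\<in>S j. \<forall>x\<in>S k. \<exists>f\<in>zw_series_in (S (i + j + k)).
        expand_zw f = comp_outer (m i (j + k)) (m j k) u v x \<and>
        expand_w_diff f = (\<lambda>p q. a *\<^sub>C comp_inner (m (i + j) k) (m i j) u v x p q)) \<and>
     (\<exists>u\<in>S i. \<exists>v\<in>S j. \<exists>x\<in>S k. \<exists>p q. comp_outer (m i (j + k)) (m j k) u v x p q \<noteq> 0)"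

definition four_point ::
    "('a::plus \<Rightarrow> 'v::complex_vector set) \<Rightarrow> ('a \<Rightarrow> 'a \<Rightarrow> 'v \<Rightarrow> 'v \<Rightarrow> 'v fls) \<Rightarrow> 'a \<Rightarrow> 'a \<Rightarrow> 'a \<Rightarrow> 'a \<Rightarrow> bool" where
  "four_point S m i j k l \<longleftrightarrow>
     (\<forall>u\<in>S i. \<forall>v\<in>S j. \<forall>x\<in>S k. \<forall>y\<in>S l. \<exists>f.
        expand_zwt f = (\<lambda>p q r. m i (j + (k + l)) u (m j (k + l) v (m k l x y $$ r) $$ q) $$ p)) \<and>
     (\<exists>u\<in>S i. \<exists>v\<in>S j. \<exists>x\<in>S k. \<exists>y\<in>S l. \<exists>p q r.
        m i (j + (k + l)) u (m j (k + l) v (m k l x y $$ r) $$ q) $$ p \<noteq> 0)"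

locale graded_product =
  fixes S :: "'a::ab_group_add \<Rightarrow> 'v::complex_vector set" and L :: "'a \<Rightarrow> 'v \<Rightarrow> 'v"
    and m :: "'a \<Rightarrow> 'a \<Rightarrow> 'v \<Rightarrow> 'v \<Rightarrow> 'v fls"
    and \<alpha> :: "'a \<Rightarrow> 'a \<Rightarrow> 'a \<Rightarrow> complex" and \<Omega> :: "'a \<Rightarrow> 'a \<Rightarrow> complex"
  assumes subspace: "cvec.subspace (S i)"
    and L_linear: "linear_on (S i) (S i) (L i)"
    and bilinear: "bilinear_map (S i) (S j) (laurent (S (i + j))) (m i j)"
    and L_left: "u \<in> S i \<Longrightarrow> v \<in> S j \<Longrightarrow>
      m i j (L i u) v $$ n = of_int (n + 1) *\<^sub>C (m i j u v $$ (n + 1))"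
    and L_right: "u \<in> S i \<Longrightarrow> v \<in> S j \<Longrightarrow>
      m i j u (L j v) $$ n = L (i + j) (m i j u v $$ n) - of_int (n + 1) *\<^sub>C (m i j u v $$ (n + 1))"
    and associator: "associator S m i j k (\<alpha> i j k)"
    and four_point: "four_point S m i j k l"
    and skew: "skew (L (i + j)) (m i j) = \<Omega> i j *\<^sub>C m j i"
begin

lemmas assoc = associator[unfolded associator_def, THEN conjunct2, THEN conjunct1, rule_format]
lemmas assoc_nonzero = associator[unfolded associator_def, THEN conjunct2, THEN conjunct2]
lemmas \<alpha>_nonzero = associator[unfolded associator_def, THEN conjunct1]
lemmas quad = four_point[unfolded four_point_def, THEN conjunct1, rule_format]
lemmas quad_nonzero = four_point[unfolded four_point_def, THEN conjunct2]

lemma mem: "u \<in> S i \<Longrightarrow> v \<in> S j \<Longrightarrow> m i j u v $$ n \<in> S (i + j)"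
  using bilinear[of i j] by (auto simp: bilinear_map_def linear_on_def laurent_def)

lemma linear_right: "u \<in> S i \<Longrightarrow> linear_on (S j) (S (i + j)) (\<lambda>v. m i j u v $$ n)"
  using bilinear[of i j] by (simp add: bilinear_map_def linear_on_def laurent_def)

lemma linear_left: "v \<in> S j \<Longrightarrow> linear_on (S i) (S (i + j)) (\<lambda>u. m i j u v $$ n)"
  using bilinear[of i j] by (simp add: bilinear_map_def linear_on_def laurent_def)

text \<open>Two chains of faces lead from \<open>u(v(xy))\<close> to \<open>((uv)x)y\<close> and
  collect the scalars of the two sides. If these differ, \<open>((uv)x)y\<close> vanishes in total
  degree \<open>D\<close>, and tracing the chain through \<open>(uv)(xy)\<close> backwards kills the
  coefficient of \<open>u(v(xy))\<close> that was chosen nonzero.\<close>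

lemma pentagon: "\<alpha> i j (k + l) * \<alpha> (i + j) k l = \<alpha> j k l * \<alpha> i (j + k) l * \<alpha> i j k"
proof (rule ccontr)
  assume neq: "\<alpha> i j (k + l) * \<alpha> (i + j) k l \<noteq> \<alpha> j k l * \<alpha> i (j + k) l * \<alpha> i j k"
  obtain u v x y p0 q0 r0 where uvxy: "u \<in> S i" "v \<in> S j" "x \<in> S k" "y \<in> S l"
    and nz: "m i (j + (k + l)) u (m j (k + l) v (m k l x y $$ r0) $$ q0) $$ p0 \<noteq> 0"
    using quad_nonzero[of i j k l] by blast
  obtain N g where G: "expand_zwt (zwt_frac N g) =
      (\<lambda>p q r. m i (j + (k + l)) u (m j (k + l) v (m k l x y $$ r) $$ q) $$ p)"
    using quad[OF uvxy] by (metis zwt_frac_cases)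
  define D where "D = p0 + q0 + r0"
  define n where "n = nat (D + 6 * int N)"
  define J where "J = {..n} \<times> {..n}"
  define abc where "abc = (\<lambda>(b, c). (D + 5 * int N - int b - int c, int b - int N, int c - int N))"
  define def where "def = (- int N, - int N, - int N)"
  define X where "X = (\<lambda>(b, c). ext3 g (D + 6 * int N - int b - int c) (int b) (int c))"
  have fin: "finite J"
    by (simp add: J_def)
  \<comment> \<open>The part of the series in total degree \<open>D\<close>, seen from the face
    \<open>F\<close> and expanded by \<open>C\<close>; \<open>t\<close> is the exponent of the
    variable that the face singles out.\<close>
  define Z where "Z F C t p q = (\<Sum>s\<in>J. F C (abc s) def t p q *\<^sub>C X s)"
    for F :: "coef2 \<Rightarrow> int \<times> int \<times> int \<Rightarrow> int \<times> int \<times> int \<Rightarrow> int \<Rightarrow> int \<Rightarrow> int \<Rightarrow> complex" and C t p q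
  have U: "Z face_t coef_zw r p q =
      m i (j + (k + l)) u (m j (k + l) v (m k l x y $$ r) $$ q) $$ p" if "p + q + r = D" for p q r
    using expand_zwt_frac[of N g p q r] G that
    by (simp add: J_def n_def abc_def def_def X_def Z_def case_prod_unfold)
  have faces: "Z face_t coef_diff r p q = Z face_z_w coef_zw p q r" "Z face_t coef_zw r p q = Z face_z coef_zw p q r"
    "Z face_z coef_diff p q r = Z face_w_t coef_zw q p r" "Z face_w_t coef_diff q p r = Z face_t' coef_zw r p q"
    "Z face_t' coef_diff r p q = Z face_z_w coef_diff p q r" for p q r
    by (simp_all only: Z_def face_t_z_w face_t_z face_z_w_t face_w_t_t' face_t'_z_w)
  have series: "F = face_t \<or> F = face_z_w \<or> F = face_z \<or> F = face_w_t \<or> F = face_t' \<longrightarrow>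
      (\<exists>h. (\<forall>p q. expand_zw h p q = Z F coef_zw t p q) \<and> (\<forall>p q. expand_w_diff h p q = Z F coef_diff t p q))" for F t
    by (intro impI, elim disjE; hypsubst; unfold Z_def face_defs case_prod_unfold; rule face_series[OF fin finite_atMost])
  \<comment> \<open>On a face, agreement with a two-variable series in one expansion passes to the
    other; \<open>diff\<close> and \<open>zw\<close> are the two directions.\<close>
  have transfer: "Z F coef_zw t p q = expand_zw f p q \<and> Z F coef_diff t p q = expand_w_diff f p q"
    if F: "F = face_t \<or> F = face_z_w \<or> F = face_z \<or> F = face_w_t \<or> F = face_t'" and "p + q = D - t"
      and "(\<forall>p q. p + q = D - t \<longrightarrow> Z F coef_zw t p q = expand_zw f p q) \<or>
        (\<forall>p q. p + q = D - t \<longrightarrow> Z F coef_diff t p q = expand_w_diff f p q)" for F f t p q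
  proof -
    obtain h where "\<forall>p q. expand_zw h p q = Z F coef_zw t p q" "\<forall>p q. expand_w_diff h p q = Z F coef_diff t p q"
      using series F by blast
    then show ?thesis
      using expand_transfer(1,3)[where e = h and f = f and D = "D - t" and p = p and q = q] that by auto
  qed
  note diff = transfer[THEN conjunct2, OF _ _ disjI1] and zw = transfer[THEN conjunct1, OF _ _ disjI2]
  define W where "W = (\<lambda>p q r. m (i + (j + k)) l (m (i + j) k (m i j u v $$ p) x $$ q) y $$ r)"

  have 1: "Z face_t coef_diff r p q = \<alpha> i j (k + l) *\<^sub>C (m (i + j) (k + l) (m i j u v $$ p) (m k l x y $$ r) $$ q)"
    if "p + q + r = D" for p q r
  proof -
    obtain f where f: "expand_zw f = comp_outer (m i (j + (k + l))) (m j (k + l)) u v (m k l x y $$ r)"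
      "expand_w_diff f = (\<lambda>p q. \<alpha> i j (k + l) *\<^sub>C comp_inner (m (i + j) (k + l)) (m i j) u v (m k l x y $$ r) p q)"
      using assoc[OF uvxy(1,2) mem[OF uvxy(3,4)]] by blast
    have "Z face_t coef_diff r p q = expand_w_diff f p q"
      by (rule diff) (use that in \<open>auto simp: f U comp_outer_def\<close>)
    then show ?thesis
      by (simp add: f comp_inner_def)
  qed
  have 2: "Z face_z_w coef_diff p q r = (\<alpha> i j (k + l) * \<alpha> (i + j) k l) *\<^sub>C W p q r"
    if "p + q + r = D" for p q r
  proof -
    obtain f where f: "expand_zw f = comp_outer (m (i + j) (k + l)) (m k l) (m i j u v $$ p) x y"
      "expand_w_diff f = (\<lambda>q r. \<alpha> (i + j) k l *\<^sub>C comp_inner (m (i + j + k) l) (m (i + j) k) (m i j u v $$ p) x y q r)"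
      using assoc[OF mem[OF uvxy(1,2)] uvxy(3,4)] by blast
    have "Z face_z_w coef_diff p q r = expand_w_diff (\<alpha> i j (k + l) *\<^sub>C f) q r"
      by (rule diff) (use that in \<open>auto simp: f 1 faces(1)[symmetric] comp_outer_def expand_scale\<close>)
    then show ?thesis
      by (simp add: f comp_inner_def expand_scale W_def add.assoc)
  qed
  have 3: "Z face_z coef_diff p q r = \<alpha> j k l *\<^sub>C (m i (j + (k + l)) u (m (j + k) l (m j k v x $$ q) y $$ r) $$ p)"
    if "p + q + r = D" for p q r
  proof -
    obtain f where f: "f \<in> zw_series_in (S (j + (k + l)))" "expand_zw f = comp_outer (m j (k + l)) (m k l) v x y"
      "expand_w_diff f = (\<lambda>q r. \<alpha> j k l *\<^sub>C comp_inner (m (j + k) l) (m j k) v x y q r)"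
      using assoc[OF uvxy(2,3,4)] by (auto simp: add.assoc)
    obtain f' where f': "\<And>q r. expand_zw f' q r = m i (j + (k + l)) u (expand_zw f q r) $$ p"
      "\<And>q r. expand_w_diff f' q r = m i (j + (k + l)) u (expand_w_diff f q r) $$ p"
      by (rule zw_series_map[OF linear_right[OF uvxy(1)] subspace f(1), of p]) blast
    have mem': "m (j + k) l (m j k v x $$ q) y $$ r \<in> S (j + (k + l))" for q r
      using mem[OF mem[OF uvxy(2,3)] uvxy(4)] by (simp add: add.assoc)
    have "Z face_z coef_diff p q r = expand_w_diff f' q r"
      by (rule diff) (use that in \<open>auto simp: f f' U faces(2)[symmetric] comp_outer_def\<close>)
    then show ?thesis
      using linear_right[OF uvxy(1), of "j + (k + l)" p] mem'
      by (simp add: f f' comp_inner_def linear_on_def)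
  qed
  have 4: "Z face_w_t coef_diff q p r =
      (\<alpha> j k l * \<alpha> i (j + k) l) *\<^sub>C (m (i + (j + k)) l (m i (j + k) u (m j k v x $$ q) $$ p) y $$ r)"
    if "p + q + r = D" for p q r
  proof -
    obtain f where f: "expand_zw f = comp_outer (m i (j + (k + l))) (m (j + k) l) u (m j k v x $$ q) y"
      "expand_w_diff f = (\<lambda>p r. \<alpha> i (j + k) l *\<^sub>C comp_inner (m (i + (j + k)) l) (m i (j + k)) u (m j k v x $$ q) y p r)"
      using assoc[OF uvxy(1) mem[OF uvxy(2,3)] uvxy(4)] by (auto simp: add.assoc)
    have "Z face_w_t coef_diff q p r = expand_w_diff (\<alpha> j k l *\<^sub>C f) p r"
      by (rule diff) (use that in \<open>auto simp: f 3 faces(3)[symmetric] comp_outer_def expand_scale\<close>)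
    then show ?thesis
      by (simp add: f comp_inner_def expand_scale)
  qed
  have 5: "Z face_t' coef_diff r p q = (\<alpha> j k l * \<alpha> i (j + k) l * \<alpha> i j k) *\<^sub>C W p q r"
    if "p + q + r = D" for p q r
  proof -
    obtain f where f: "f \<in> zw_series_in (S (i + (j + k)))" "expand_zw f = comp_outer (m i (j + k)) (m j k) u v x"
      "expand_w_diff f = (\<lambda>p q. \<alpha> i j k *\<^sub>C comp_inner (m (i + j) k) (m i j) u v x p q)"
      using assoc[OF uvxy(1,2,3)] by (auto simp: add.assoc)
    obtain f' where f': "\<And>p q. expand_zw f' p q = m (i + (j + k)) l (expand_zw f p q) y $$ r"
      "\<And>p q. expand_w_diff f' p q = m (i + (j + k)) l (expand_w_diff f p q) y $$ r"
      by (rule zw_series_map[OF linear_left[OF uvxy(4)] subspace f(1), of r]) blast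
    have mem': "m (i + j) k (m i j u v $$ p) x $$ q \<in> S (i + (j + k))" for p q
      using mem[OF mem[OF uvxy(1,2)] uvxy(3)] by (simp add: add.assoc)
    have "Z face_t' coef_diff r p q = expand_w_diff ((\<alpha> j k l * \<alpha> i (j + k) l) *\<^sub>C f') p q"
      by (rule diff) (use that in \<open>auto simp: f f' 4 faces(4)[symmetric] comp_outer_def expand_scale\<close>)
    then show ?thesis
      using linear_left[OF uvxy(4), of "i + (j + k)" r] mem'
      by (simp add: f f' comp_inner_def linear_on_def expand_scale W_def)
  qed

  have "W p q r = 0" if "p + q + r = D" for p q r
    using 2[OF that] 5[OF that] neq by (simp add: faces(5))
  then have 6: "Z face_z_w coef_diff p q r = 0" if "p + q + r = D" for p q r
    using that by (simp add: 2)
  have 7: "Z face_z_w coef_zw p q r = expand_zw 0 q r" if "p + q + r = D" for p q r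
    by (rule zw) (use that in \<open>auto simp: 6 expand_zero\<close>)
  have "Z face_t coef_zw r0 p0 q0 = expand_zw 0 p0 q0"
    by (rule zw) (auto simp: 7 faces(1) expand_zero D_def)
  with U[of p0 q0 r0] nz show False
    by (simp add: D_def expand_zero)
qed

end

section \<open>Changes of variables in two-variable series\<close>

lemma gbin_absorb: "of_int (n + 1) * gbin (n + 1 + int s) (int s) = of_nat (Suc s) * gbin (n + int (Suc s)) (int (Suc s))"
proof -
  define a :: complex where "a = of_int (n + 1 + int s)"
  have "of_int (n + 1) * (a gchoose s) = of_nat (Suc s) * (a gchoose Suc s)"
    using gbinomial_mult_1[of a s] by (simp add: a_def ring_distribs)
  then show ?thesis
    by (simp add: gbin_def a_def add_ac nat_add_distrib)
qed

text \<open>Exchanging z and w changes the sign of z - w, and \<open>z^(q + s)\<close> has to be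
  expanded as \<open>(w + (z - w))^(q + s)\<close>, which gives the binomials. \<open>N\<close>
  bounds the order of the pole along z = w, so the terms with \<open>s > p + N\<close>
  vanish.\<close>

lemma zw_series_swap:
  obtains F N where
    "\<And>p q. expand_zw F p q = expand_wz f q p"
    "\<And>p q J. int J \<ge> p + int N \<Longrightarrow> expand_w_diff F p q =
      (\<Sum>s\<le>J. (gbin (q + int s) (int s) * (-1) powi (p - int s)) *\<^sub>C expand_w_diff f (p - int s) (q + int s))"
proof -
  obtain N g where f: "f = zw_frac N g"
    by (rule zw_frac_cases)
  define F where "F = zw_frac N (\<lambda>a b. (-1) powi int N *\<^sub>C g b a)"
  have ext: "ext2 (\<lambda>a b. (-1) powi int N *\<^sub>C g b a) p q = (-1) powi int N *\<^sub>C ext2 g q p" for p q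
    by (simp add: ext2_def)
  have swap: "(\<Sum>a\<le>nat (s + 3 * int N). C (int a - int N) (s + 2 * int N - int a) *\<^sub>C
        ext2 (\<lambda>a b. (-1) powi int N *\<^sub>C g b a) (int a) (s + 3 * int N - int a)) =
      (\<Sum>a\<le>nat (s + 3 * int N). (C (s + 2 * int N - int a) (int a - int N) * (-1) powi int N) *\<^sub>C
        ext2 g (int a) (s + 3 * int N - int a))" for C :: "int \<Rightarrow> int \<Rightarrow> complex" and s
  proof (cases "s + 3 * int N < 0")
    case False
    then show ?thesis
      by (intro sum.reindex_bij_witness[where i = "\<lambda>a. nat (s + 3 * int N) - a" and j = "\<lambda>a. nat (s + 3 * int N) - a"])
        (auto simp: of_nat_diff ext algebra_simps simp del: power_int_of_nat)
  qed (simp add: ext)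
  show thesis
  proof (rule that)
    fix p q
    show "expand_zw F p q = expand_wz f q p"
      unfolding F_def f expand_zw_frac expand_wz_frac swap[of "\<lambda>a b. coef_zw a b (- int N) p q"]
      by (auto simp: coef_zw_def coef_wz_def powi_minus_one_add powi_minus_one_diff algebra_simps
          intro!: sum.cong simp del: power_int_of_nat)
  next
    fix p q J
    assume J: "int J \<ge> p + int N"
    have coef: "coef_diff (p + q + 2 * int N - int a) (int a - int N) (- int N) p q * (-1) powi int N =
        (\<Sum>s\<le>J. (gbin (q + int s) (int s) * (-1) powi (p - int s)) *
          coef_diff (int a - int N) (p + q + 2 * int N - int a) (- int N) (p - int s) (q + int s))" for a
    proof -
      have "(\<Sum>s\<le>J. (gbin (q + int s) (int s) * (-1) powi (p - int s)) *
          coef_diff (int a - int N) (p + q + 2 * int N - int a) (- int N) (p - int s) (q + int s)) =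
        (-1) powi int N * (\<Sum>s\<le>J. gbin (p + q + int N - (p + int N) + int s) (int s) *
          ((-1) powi (p + int N - int s) * gbin (int a - int N) (p + int N - int s)))"
        by (auto simp: coef_diff_def powi_minus_one_add powi_minus_one_diff algebra_simps sum_distrib_left
          intro!: sum.cong simp del: power_int_of_nat power_int_minus)
      also have "\<dots> = (-1) powi int N * gbin (p + q + int N - (int a - int N)) (p + int N)"
        by (simp only: gbin_reflect[OF J])
      also have "\<dots> = coef_diff (p + q + 2 * int N - int a) (int a - int N) (- int N) p q * (-1) powi int N"
        by (simp add: coef_diff_def algebra_simps)
      finally show ?thesis ..
    qed
    have "expand_w_diff F p q = (\<Sum>a\<le>nat (p + q + 3 * int N). \<Sum>s\<le>J. (gbin (q + int s) (int s) * (-1) powi (p - int s)) *\<^sub>C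
          coef_diff (int a - int N) (p + q + 2 * int N - int a) (- int N) (p - int s) (q + int s) *\<^sub>C
          ext2 g (int a) (p + q + 3 * int N - int a))"
      unfolding F_def expand_w_diff_frac swap[of "\<lambda>a b. coef_diff a b (- int N) p q"]
      by (simp only: coef cvec.scale_sum_left cvec.scale_scale)
    also have "\<dots> = (\<Sum>s\<le>J. (gbin (q + int s) (int s) * (-1) powi (p - int s)) *\<^sub>C
        expand_w_diff f (p - int s) (q + int s))"
      by (subst sum.swap) (simp add: f expand_w_diff_frac cvec.scale_sum_right add_ac)
    finally show "expand_w_diff F p q = (\<Sum>s\<le>J. (gbin (q + int s) (int s) * (-1) powi (p - int s)) *\<^sub>C
        expand_w_diff f (p - int s) (q + int s))" .
  qed
qed

text \<open>The substitution of \<open>(z - w, -w)\<close> for \<open>(z, w)\<close>, in total degree \<open>D\<close>.\<close>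

lemma zw_series_shift:
  obtains F N where
    "\<And>p q J. p + q = D \<Longrightarrow> int J \<ge> q + int N \<Longrightarrow> expand_zw F p q =
      (\<Sum>s\<le>J. ((-1) powi q * gbin (p + int s) (int s)) *\<^sub>C expand_zw f (p + int s) (q - int s))"
    "\<And>p q. p + q = D \<Longrightarrow> expand_w_diff F p q = (-1) powi q *\<^sub>C expand_wz f p q"
proof -
  obtain N g where f: "f = zw_frac N g"
    by (rule zw_frac_cases)
  define n where "n = nat (D + 3 * int N)"
  define a where "a s = int s - int N" for s
  define b where "b s = D + 2 * int N - int s" for s
  define x where "x s = ext2 g (int s) (D + 3 * int N - int s)" for s
  \<comment> \<open>The substitution sends \<open>z^a w^b (z - w)^(-N)\<close> to
    \<open>(-1)^b z^(-N) w^b (z - w)^a\<close>. In a single degree this is a finite sum of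
    monomials.\<close>
  define F where "F = (\<Sum>s\<le>n. (-1) powi b s *\<^sub>C zw_mon (- int N) (b s) (a s) (x s))"
  have ab: "a s + b s = D + int N" for s
    by (simp add: a_def b_def)
  show thesis
  proof (rule that)
    fix p q J
    assume D: "p + q = D" and J: "int J \<ge> q + int N"
    have "((-1) powi b s * coef_zw (- int N) (b s) (a s) p q) *\<^sub>C x s =
      (\<Sum>t\<le>J. (-1) powi q * gbin (p + int t) (int t) * coef_zw (a s) (b s) (- int N) (p + int t) (q - int t)) *\<^sub>C x s"
      for s
    proof (cases "x s = 0")
      case False
      then have "b s \<ge> - int N"
        by (auto simp: b_def x_def ext2_def split: if_splits)
      then have JQ: "int J \<ge> q - b s"
        using J by simp
      have "(\<Sum>t\<le>J. (-1) powi q * gbin (p + int t) (int t) * coef_zw (a s) (b s) (- int N) (p + int t) (q - int t)) =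
        (-1) powi q * (\<Sum>t\<le>J. gbin (a s - int N - (q - b s) + int t) (int t) *
          ((-1) powi (q - b s - int t) * gbin (- int N) (q - b s - int t)))"
        unfolding sum_distrib_left
        by (rule sum.cong) (use ab[of s] D in \<open>auto simp: coef_zw_def algebra_simps\<close>)
      also have "\<dots> = (-1) powi q * gbin (a s) (q - b s)"
        using gbin_reflect[OF JQ, of "a s - int N" "- int N"] by simp
      also have "\<dots> = (-1) powi b s * coef_zw (- int N) (b s) (a s) p q"
        using ab[of s] D by (auto simp: coef_zw_def powi_minus_one_diff algebra_simps)
      finally show ?thesis
        by simp
    qed simp
    then have "expand_zw F p q = (\<Sum>s\<le>n. (\<Sum>t\<le>J. (-1) powi q * gbin (p + int t) (int t) *
        coef_zw (a s) (b s) (- int N) (p + int t) (q - int t)) *\<^sub>C x s)"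
      by (simp only: F_def expand_sum expand_scale expand_zw_mon cvec.scale_scale)
    also have "\<dots> = (\<Sum>t\<le>J. \<Sum>s\<le>n. ((-1) powi q * gbin (p + int t) (int t)) *\<^sub>C
        coef_zw (a s) (b s) (- int N) (p + int t) (q - int t) *\<^sub>C x s)"
      by (subst sum.swap) (simp add: cvec.scale_sum_left)
    also have "\<dots> = (\<Sum>t\<le>J. ((-1) powi q * gbin (p + int t) (int t)) *\<^sub>C expand_zw f (p + int t) (q - int t))"
      using D by (simp add: f expand_zw_frac a_def b_def x_def n_def cvec.scale_sum_right algebra_simps)
    finally show "expand_zw F p q =
      (\<Sum>s\<le>J. ((-1) powi q * gbin (p + int s) (int s)) *\<^sub>C expand_zw f (p + int s) (q - int s))" .
  next
    fix p q
    assume D: "p + q = D"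
    have "(-1) powi b s * coef_diff (- int N) (b s) (a s) p q = (-1) powi q * coef_wz (a s) (b s) (- int N) p q" for s
    proof -
      have q: "q = a s + b s - int N - p"
        using ab[of s] D by simp
      show ?thesis
        unfolding q by (simp add: coef_diff_def coef_wz_def powi_minus_one_add powi_minus_one_diff algebra_simps
          del: power_int_of_nat)
    qed
    then show "expand_w_diff F p q = (-1) powi q *\<^sub>C expand_wz f p q"
      using D by (simp add: F_def f expand_sum expand_scale expand_zw_mon expand_wz_frac a_def b_def x_def n_def
          cvec.scale_sum_right algebra_simps)
  qed
qed

section \<open>Skew-symmetry and the exchange of two factors\<close>

context graded_product
begin

lemma L_pow_mem: "y \<in> S i \<Longrightarrow> (L i ^^ s) y \<in> S i"
  using L_linear[of i] by (induction s) (auto simp: linear_on_def)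

lemma L_pow_scale: "y \<in> S i \<Longrightarrow> (L i ^^ s) (c *\<^sub>C y) = c *\<^sub>C (L i ^^ s) y"
  using L_linear[of i] L_pow_mem by (induction s) (auto simp: linear_on_def)

lemma L_pow_0: "(L i ^^ s) 0 = 0"
  using linear_on_0[OF L_linear subspace] by (induction s) auto

lemma vanish_below: obtains J where "\<And>k. k < n - int J \<Longrightarrow> m i j u v $$ k = 0"
proof -
  have "m i j u v $$ k = 0" if "k < n - int (nat (n - fls_subdegree (m i j u v)))" for k
    using that by (intro fls_eq0_below_subdegree) linarith
  then show thesis
    by (rule that)
qed

lemma skew_eq:
  assumes "u \<in> S i" "v \<in> S j" and J: "\<And>k. k < n - int J \<Longrightarrow> m i j u v $$ k = 0"
  shows "\<Omega> i j *\<^sub>C (m j i v u $$ n) =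
    (\<Sum>s\<le>J. ((-1) powi (n - int s) / fact s) *\<^sub>C (L (i + j) ^^ s) (m i j u v $$ (n - int s)))"
proof -
  have "\<Omega> i j *\<^sub>C (m j i v u $$ n) = skew (L (i + j)) (m i j) v u $$ n"
    by (simp add: skew)
  also have "\<dots> = (\<Sum>s | (-1) powi (n - int s) *\<^sub>C (m i j u v $$ (n - int s)) \<noteq> 0.
      (1 / fact s) *\<^sub>C (L (i + j) ^^ s) ((-1) powi (n - int s) *\<^sub>C (m i j u v $$ (n - int s))))"
    by (simp add: skew_def fls_exp_op.rep_eq fls_neg_arg.rep_eq)
  also have "\<dots> = (\<Sum>s\<le>J. (1 / fact s) *\<^sub>C (L (i + j) ^^ s) ((-1) powi (n - int s) *\<^sub>C (m i j u v $$ (n - int s))))"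
  proof (rule sum.mono_neutral_left)
    show "{s. (-1) powi (n - int s) *\<^sub>C (m i j u v $$ (n - int s)) \<noteq> 0} \<subseteq> {..J}"
    proof (rule subsetI, rule ccontr)
      fix s assume "s \<in> {s. (-1) powi (n - int s) *\<^sub>C (m i j u v $$ (n - int s)) \<noteq> 0}" "s \<notin> {..J}"
      then show False
        using J[of "n - int s"] by simp
    qed
  qed (auto simp: L_pow_0)
  finally show ?thesis
    using mem[OF assms(1,2)] by (simp add: L_pow_scale)
qed

text \<open>Up to the lowest exponent the exponential contributes only its constant term, which
  leaves the sign coming from z -> -z.\<close>

lemma skew_leading:
  assumes "u \<in> S i" "v \<in> S j" and "\<And>k. k < n \<Longrightarrow> m i j u v $$ k = 0"
  shows "\<Omega> i j *\<^sub>C (m j i v u $$ n) = (-1) powi n *\<^sub>C (m i j u v $$ n)"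
  using skew_eq[OF assms(1,2), of n 0] assms(3) by simp

lemma m_nonzero: obtains u v where "u \<in> S i" "v \<in> S j" "m i j u v \<noteq> 0"
proof -
  obtain u v x p q where "u \<in> S i" "v \<in> S j" "x \<in> S 0" "m i (j + 0) u (m j 0 v x $$ q) $$ p \<noteq> 0"
    using assoc_nonzero[of i j 0] by (auto simp: comp_outer_def)
  moreover from this have "m j 0 v x $$ q \<in> S j"
    using mem[of v j x 0 q] by simp
  ultimately show thesis
    using that by fastforce
qed

text \<open>Both orders of the product start at the same exponent, where the two signs
  cancel.\<close>

lemma \<Omega>_sym: "\<Omega> i j * \<Omega> j i = 1"
proof -
  obtain u v where uv: "u \<in> S i" "v \<in> S j" "m i j u v \<noteq> 0"
    by (rule m_nonzero)
  define n where "n = fls_subdegree (m i j u v)"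
  have nz: "m i j u v $$ n \<noteq> 0"
    using uv by (simp add: n_def nth_fls_subdegree_nonzero)
  have below: "m i j u v $$ k = 0" if "k < n" for k
    using that by (simp add: n_def)
  have 1: "\<Omega> i j *\<^sub>C (m j i v u $$ k) = (-1) powi k *\<^sub>C (m i j u v $$ k)" if "k \<le> n" for k
    using that by (intro skew_leading[OF uv(1,2)] below) simp
  then have "\<Omega> i j \<noteq> 0"
    using 1[of n] nz by auto
  then have "m j i v u $$ k = 0" if "k < n" for k
    using 1[of k] below[OF that] that by auto
  then have "\<Omega> j i *\<^sub>C (m i j u v $$ n) = (-1) powi n *\<^sub>C (m j i v u $$ n)"
    by (intro skew_leading uv)
  then have "(\<Omega> i j * \<Omega> j i) *\<^sub>C (m i j u v $$ n) = (-1) powi n *\<^sub>C \<Omega> i j *\<^sub>C (m j i v u $$ n)"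
    by (simp add: cvec.scale_left_commute flip: cvec.scale_scale)
  also have "\<dots> = m i j u v $$ n"
    by (simp add: 1)
  finally show ?thesis
    using nz by (metis cvec.scale_cancel_right cvec.scale_one)
qed

lemma \<Omega>_nonzero: "\<Omega> i j \<noteq> 0"
  using \<Omega>_sym[of i j] by auto

text \<open>On the left factor \<open>L(-1)\<close> is d/dz, so its power divided by
  \<open>fact s\<close> is a divided derivative.\<close>

lemma L_pow_left:
  assumes "y \<in> S i" "x \<in> S k"
  shows "m i k ((L i ^^ s) y) x $$ q = (fact s * gbin (q + int s) (int s)) *\<^sub>C (m i k y x $$ (q + int s))"
proof (induction s arbitrary: q)
  case (Suc s)
  have "m i k ((L i ^^ Suc s) y) x $$ q = of_int (q + 1) *\<^sub>C (m i k ((L i ^^ s) y) x $$ (q + 1))"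
    using L_left[OF L_pow_mem[OF assms(1)] assms(2)] by simp
  also have "\<dots> = (of_int (q + 1) * gbin (q + 1 + int s) (int s) * fact s) *\<^sub>C (m i k y x $$ (q + 1 + int s))"
    by (simp only: Suc cvec.scale_scale) (simp add: mult_ac)
  also have "\<dots> = (fact (Suc s) * gbin (q + int (Suc s)) (int (Suc s))) *\<^sub>C (m i k y x $$ (q + int (Suc s)))"
    by (simp only: gbin_absorb) (simp add: mult_ac add_ac)
  finally show ?case .
qed simp

text \<open>The translation \<open>e^((z - w)L(-1))\<close> of the inner product acts through
  \<open>L_pow_left\<close>. The resulting sum matches the change of variables in
  \<open>zw_series_swap\<close> term by term.\<close>

lemma inner_skew:
  assumes "u \<in> S i" "v \<in> S j" "x \<in> S k" and J: "\<And>r. r < p - int J \<Longrightarrow> m i j u v $$ r = 0"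
  shows "\<Omega> i j *\<^sub>C comp_inner (m (j + i) k) (m j i) v u x p q =
    (\<Sum>s\<le>J. (gbin (q + int s) (int s) * (-1) powi (p - int s)) *\<^sub>C
      comp_inner (m (i + j) k) (m i j) u v x (p - int s) (q + int s))"
proof -
  note lin = linear_left[OF assms(3), of "i + j" q]
  have eq: "\<Omega> i j *\<^sub>C (m j i v u $$ p) =
    (\<Sum>s\<le>J. ((-1) powi (p - int s) / fact s) *\<^sub>C (L (i + j) ^^ s) (m i j u v $$ (p - int s)))"
    by (rule skew_eq[OF assms(1,2)]) (rule J)
  have "\<Omega> i j *\<^sub>C (m (i + j) k (m j i v u $$ p) x $$ q) = m (i + j) k (\<Omega> i j *\<^sub>C (m j i v u $$ p)) x $$ q"
    using lin mem[OF assms(2,1)] by (simp add: linear_on_def add.commute)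
  also have "\<dots> = (\<Sum>s\<le>J. ((-1) powi (p - int s) / fact s) *\<^sub>C
      (m (i + j) k ((L (i + j) ^^ s) (m i j u v $$ (p - int s))) x $$ q))"
    unfolding eq
    by (rule linear_on_sum[OF lin subspace]) (intro L_pow_mem mem assms)
  also have "\<dots> = (\<Sum>s\<le>J. (gbin (q + int s) (int s) * (-1) powi (p - int s)) *\<^sub>C
      comp_inner (m (i + j) k) (m i j) u v x (p - int s) (q + int s))"
    by (simp add: L_pow_left[OF mem[OF assms(1,2)] assms(3)] comp_inner_def mult_ac)
  finally show ?thesis
    by (simp add: comp_inner_def add.commute)
qed

text \<open>After exchanging z and w in the series of \<open>u(vx)\<close>, its expansion at
  \<open>z - w\<close> is by \<open>inner_skew\<close> a multiple of that of \<open>v(ux)\<close>;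
  by injectivity the series themselves are proportional. This supplies the expansion in
  \<open>M((w))((z))\<close> and decides locality, which asks for the factor 1.\<close>

lemma expand_wz_assoc:
  assumes "u \<in> S i" "v \<in> S j" "x \<in> S k"
    and f: "expand_zw f = comp_outer (m i (j + k)) (m j k) u v x"
  shows "expand_wz f p q = (\<Omega> i j * \<alpha> i j k / \<alpha> j i k) *\<^sub>C comp_outer (m j (i + k)) (m i k) v u x q p"
proof -
  have f': "expand_w_diff f = (\<lambda>p q. \<alpha> i j k *\<^sub>C comp_inner (m (i + j) k) (m i j) u v x p q)"
    using assoc[OF assms(1,2,3)] f expand_inject by metis
  obtain h where h: "expand_zw h = comp_outer (m j (i + k)) (m i k) v u x"
    "expand_w_diff h = (\<lambda>p q. \<alpha> j i k *\<^sub>C comp_inner (m (j + i) k) (m j i) v u x p q)"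
    using assoc[OF assms(2,1,3)] by blast
  obtain F N where F: "\<And>p q. expand_zw F p q = expand_wz f q p"
    "\<And>p q J. int J \<ge> p + int N \<Longrightarrow> expand_w_diff F p q =
      (\<Sum>s\<le>J. (gbin (q + int s) (int s) * (-1) powi (p - int s)) *\<^sub>C expand_w_diff f (p - int s) (q + int s))"
    by (rule zw_series_swap[of f]) blast
  define c where "c = \<Omega> i j * \<alpha> i j k / \<alpha> j i k"
  have "expand_w_diff F p q = expand_w_diff (c *\<^sub>C h) p q" for p q
  proof -
    obtain J0 where J0: "\<And>r. r < p - int J0 \<Longrightarrow> m i j u v $$ r = 0"
      by (rule vanish_below[of p i j u v]) blast
    define J where "J = J0 + nat \<bar>p\<bar> + N"
    have J: "m i j u v $$ r = 0" if "r < p - int J" for r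
      using that by (intro J0) (simp add: J_def)
    have "expand_w_diff F p q = \<alpha> i j k *\<^sub>C
      (\<Sum>s\<le>J. (gbin (q + int s) (int s) * (-1) powi (p - int s)) *\<^sub>C
        comp_inner (m (i + j) k) (m i j) u v x (p - int s) (q + int s))"
      by (subst F(2)[where J = J]) (simp_all add: J_def f' cvec.scale_sum_right mult_ac)
    also have "\<dots> = (\<alpha> i j k * \<Omega> i j) *\<^sub>C comp_inner (m (j + i) k) (m j i) v u x p q"
      by (subst inner_skew[OF assms(1-3), of p J, symmetric]) (simp_all add: J)
    also have "\<dots> = expand_w_diff (c *\<^sub>C h) p q"
      using \<alpha>_nonzero[of j i k] by (simp add: h expand_scale c_def)
    finally show ?thesis .
  qed
  then have "F = c *\<^sub>C h"
    by (intro expand_inject) (simp add: fun_eq_iff)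
  then show ?thesis
    using F(1)[of q p] by (simp add: expand_scale h c_def)
qed

text \<open>On the right factor \<open>L(-1)\<close> is minus a derivative plus \<open>L(-1)\<close>
  of the whole product. The hypothesis kills the latter at every stage, so in lowest degree a
  translation remains.\<close>

lemma L_pow_right:
  assumes "u \<in> S i" "y \<in> S j" and "\<And>p'. p' < p + int s \<Longrightarrow> m i j u y $$ p' = 0"
  shows "m i j u ((L j ^^ s) y) $$ p = ((-1) ^ s * fact s * gbin (p + int s) (int s)) *\<^sub>C (m i j u y $$ (p + int s))"
  using assms(3)
proof (induction s arbitrary: p)
  case (Suc s)
  have "m i j u ((L j ^^ s) y) $$ p = 0"
    using Suc.IH[of p] Suc.prems by simp
  moreover have "L (i + j) 0 = 0"
    by (rule linear_on_0[OF L_linear subspace])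
  ultimately have "m i j u ((L j ^^ Suc s) y) $$ p = - (of_int (p + 1) *\<^sub>C (m i j u ((L j ^^ s) y) $$ (p + 1)))"
    using L_right[OF assms(1) L_pow_mem[OF assms(2)]] by simp
  also have "m i j u ((L j ^^ s) y) $$ (p + 1) =
      ((-1) ^ s * fact s * gbin (p + 1 + int s) (int s)) *\<^sub>C (m i j u y $$ (p + 1 + int s))"
    by (rule Suc.IH) (simp add: Suc.prems)
  also have "- (of_int (p + 1) *\<^sub>C \<dots>) = ((-1) ^ Suc s * fact s * (of_int (p + 1) * gbin (p + 1 + int s) (int s))) *\<^sub>C
      (m i j u y $$ (p + 1 + int s))"
    by (simp add: mult_ac flip: cvec.scale_minus_left)
  also have "\<dots> = ((-1) ^ Suc s * fact (Suc s) * gbin (p + int (Suc s)) (int (Suc s))) *\<^sub>C (m i j u y $$ (p + int (Suc s)))"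
    by (simp only: gbin_absorb) (simp add: mult_ac add_ac)
  finally show ?case .
qed simp

end

text \<open>The denominator bounds the total degree below by \<open>- 3 * int N\<close>, so a least
  one exists.\<close>

lemma expand_zw_lowest_degree:
  assumes "expand_zw f p0 q0 \<noteq> 0"
  obtains p1 q1 where "expand_zw f p1 q1 \<noteq> 0" "\<And>p q. p + q < p1 + q1 \<Longrightarrow> expand_zw f p q = 0"
proof -
  obtain N g where f: "f = zw_frac N g"
    by (rule zw_frac_cases)
  have bound: "p + q \<ge> - 3 * int N" if "expand_zw f p q \<noteq> 0" for p q
  proof (rule ccontr)
    assume "\<not> p + q \<ge> - 3 * int N"
    then have "expand_zw f p q = 0"
      unfolding f expand_zw_frac by (intro sum.neutral) auto
    with that show False by simp
  qed
  define P where "P n \<longleftrightarrow> (\<exists>p q. expand_zw f p q \<noteq> 0 \<and> nat (p + q + 3 * int N) = n)" for n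
  have "P (nat (p0 + q0 + 3 * int N))"
    using assms by (auto simp: P_def)
  then have "P (LEAST n. P n)"
    by (rule LeastI)
  then obtain p1 q1 where p1: "expand_zw f p1 q1 \<noteq> 0" "nat (p1 + q1 + 3 * int N) = (LEAST n. P n)"
    by (auto simp: P_def)
  show thesis
  proof (rule that[OF p1(1)])
    fix p q assume less: "p + q < p1 + q1"
    show "expand_zw f p q = 0"
    proof (rule ccontr)
      assume nz: "expand_zw f p q \<noteq> 0"
      then have "P (nat (p + q + 3 * int N))"
        by (auto simp: P_def)
      then have "nat (p1 + q1 + 3 * int N) \<le> nat (p + q + 3 * int N)"
        unfolding p1(2) by (rule Least_le)
      with bound[OF nz] bound[OF p1(1)] less show False
        by simp
    qed
  qed
qed

section \<open>The hexagon and the diagonal of \<Omega>\<close>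

context graded_product
begin

text \<open>\<open>L_pow_right\<close> applies because nothing lives below degree \<open>D\<close>.
  The sum obtained is that of \<open>zw_series_shift\<close>: up to that degree, exchanging the last
  two factors substitutes \<open>(z - w, -w)\<close> for \<open>(z, w)\<close>.\<close>

lemma outer_skew_leading:
  assumes uvx: "u \<in> S i" "v \<in> S j" "x \<in> S k"
    and below: "\<And>p q. p + q < D \<Longrightarrow> comp_outer (m i (j + k)) (m j k) u v x p q = 0"
    and "p + q \<le> D" and J: "\<And>r. r < q - int J \<Longrightarrow> m j k v x $$ r = 0"
  shows "\<Omega> j k *\<^sub>C comp_outer (m i (k + j)) (m k j) u x v p q =
    (\<Sum>s\<le>J. ((-1) powi q * gbin (p + int s) (int s)) *\<^sub>C
      comp_outer (m i (j + k)) (m j k) u v x (p + int s) (q - int s))"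
proof -
  note lin = linear_right[OF uvx(1), of "j + k" p]
  note vx = mem[OF uvx(2,3)]
  have eq: "\<Omega> j k *\<^sub>C (m k j x v $$ q) =
    (\<Sum>s\<le>J. ((-1) powi (q - int s) / fact s) *\<^sub>C (L (j + k) ^^ s) (m j k v x $$ (q - int s)))"
    by (rule skew_eq[OF uvx(2,3)]) (rule J)
  have L: "m i (j + k) u ((L (j + k) ^^ s) (m j k v x $$ (q - int s))) $$ p =
      ((-1) ^ s * fact s * gbin (p + int s) (int s)) *\<^sub>C (m i (j + k) u (m j k v x $$ (q - int s)) $$ (p + int s))" for s
    using below \<open>p + q \<le> D\<close> unfolding comp_outer_def by (intro L_pow_right uvx vx) auto
  have "\<Omega> j k *\<^sub>C (m i (j + k) u (m k j x v $$ q) $$ p) = m i (j + k) u (\<Omega> j k *\<^sub>C (m k j x v $$ q)) $$ p"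
    using lin mem[OF uvx(3,2)] by (simp add: linear_on_def add.commute)
  also have "\<dots> = (\<Sum>s\<le>J. ((-1) powi (q - int s) / fact s) *\<^sub>C
      (m i (j + k) u ((L (j + k) ^^ s) (m j k v x $$ (q - int s))) $$ p))"
    unfolding eq by (rule linear_on_sum[OF lin subspace]) (intro L_pow_mem vx)
  also have "\<dots> = (\<Sum>s\<le>J. ((-1) powi q * gbin (p + int s) (int s)) *\<^sub>C
      comp_outer (m i (j + k)) (m j k) u v x (p + int s) (q - int s))"
    unfolding L by (intro sum.cong) (auto simp: comp_outer_def powi_minus_one_diff)
  finally show ?thesis
    by (simp add: comp_outer_def add.commute)
qed

text \<open>In the lowest total degree \<open>D\<close> of \<open>u(vx)\<close> the shifted series
  \<open>F\<close> is a multiple of that of \<open>u(xv)\<close>, so its expansion at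
  \<open>z - w\<close> is a multiple of \<open>(ux)v\<close>. By \<open>expand_wz_assoc\<close> the
  same expansion is a multiple of \<open>v(ux)\<close>, and \<open>skew_leading\<close> compares the
  two products. If the scalars disagreed, everything would vanish in degree
  \<open>D\<close>.\<close>

lemma hexagon: "\<Omega> i j * \<Omega> j (i + k) * \<alpha> i j k = \<Omega> j k * \<alpha> i k j * \<alpha> j i k"
proof (rule ccontr)
  assume neq: "\<Omega> i j * \<Omega> j (i + k) * \<alpha> i j k \<noteq> \<Omega> j k * \<alpha> i k j * \<alpha> j i k"
  obtain u v x p0 q0 where uvx: "u \<in> S i" "v \<in> S j" "x \<in> S k"
    and nz0: "comp_outer (m i (j + k)) (m j k) u v x p0 q0 \<noteq> 0"
    using assoc_nonzero[of i j k] by blast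
  obtain f where f: "expand_zw f = comp_outer (m i (j + k)) (m j k) u v x"
    using assoc[OF uvx] by blast
  obtain p1 q1 where nz: "expand_zw f p1 q1 \<noteq> 0"
    and low: "\<And>p q. p + q < p1 + q1 \<Longrightarrow> expand_zw f p q = 0"
    by (rule expand_zw_lowest_degree[of f p0 q0]) (use nz0 f in auto)
  define D where "D = p1 + q1"
  have below: "comp_outer (m i (j + k)) (m j k) u v x p q = 0" if "p + q < D" for p q
    using low that by (simp add: f D_def)
  have wz: "expand_wz f p q = (\<Omega> i j * \<alpha> i j k / \<alpha> j i k) *\<^sub>C (m j (i + k) v (m i k u x $$ p) $$ q)" for p q
    by (simp add: expand_wz_assoc[OF uvx f] comp_outer_def)
  \<comment> \<open>Nothing lies below \<open>D\<close> in the other expansion either, so the skew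
    relation between \<open>v\<close> and \<open>ux\<close> reduces to a sign.\<close>
  have below': "m j (i + k) v (m i k u x $$ p) $$ q = 0" if "p + q < D" for p q
  proof -
    have "expand_wz f p q = expand_wz 0 p q"
      by (rule expand_transfer(2)[where D = "p + q"]) (use that below f in \<open>auto simp: expand_zero\<close>)
    then show ?thesis
      using \<alpha>_nonzero[of i j k] \<alpha>_nonzero[of j i k] \<Omega>_nonzero[of i j] by (simp add: wz expand_zero)
  qed
  obtain h where h: "expand_zw h = comp_outer (m i (k + j)) (m k j) u x v"
    "expand_w_diff h = (\<lambda>p q. \<alpha> i k j *\<^sub>C comp_inner (m (i + k) j) (m i k) u x v p q)"
    using assoc[OF uvx(1,3,2)] by blast
  obtain F N where F:
    "\<And>p q J. p + q = D \<Longrightarrow> int J \<ge> q + int N \<Longrightarrow> expand_zw F p q =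
      (\<Sum>s\<le>J. ((-1) powi q * gbin (p + int s) (int s)) *\<^sub>C expand_zw f (p + int s) (q - int s))"
    "\<And>p q. p + q = D \<Longrightarrow> expand_w_diff F p q = (-1) powi q *\<^sub>C expand_wz f p q"
    by (rule zw_series_shift[of D f]) blast
  have zw: "expand_zw F p q = expand_zw (\<Omega> j k *\<^sub>C h) p q" if "p + q = D" for p q
  proof -
    obtain J0 where J0: "\<And>r. r < q - int J0 \<Longrightarrow> m j k v x $$ r = 0"
      by (rule vanish_below[of q j k v x]) blast
    define J where "J = J0 + nat \<bar>q\<bar> + N"
    have J: "m j k v x $$ r = 0" if "r < q - int J" for r
      using that by (intro J0) (simp add: J_def)
    have "expand_zw F p q = (\<Sum>s\<le>J. ((-1) powi q * gbin (p + int s) (int s)) *\<^sub>C expand_zw f (p + int s) (q - int s))"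
      by (rule F(1)) (simp_all add: that J_def)
    also have "\<dots> = \<Omega> j k *\<^sub>C comp_outer (m i (k + j)) (m k j) u x v p q"
      unfolding f by (rule outer_skew_leading[OF uvx below, symmetric]) (use that J in auto)
    finally show ?thesis
      by (simp add: expand_scale h)
  qed
  have diff: "expand_w_diff F p q = (\<Omega> j k * \<alpha> i k j) *\<^sub>C (m (i + k) j (m i k u x $$ p) v $$ q)" if "p + q = D" for p q
  proof -
    have "expand_w_diff F p q = expand_w_diff (\<Omega> j k *\<^sub>C h) p q"
      by (rule expand_transfer(3)[where D = D]) (use that zw in auto)
    then show ?thesis
      by (simp add: expand_scale h comp_inner_def)
  qed
  have zero: "m (i + k) j (m i k u x $$ p) v $$ q = 0" if "p + q = D" for p q
  proof -
    have "\<Omega> j (i + k) *\<^sub>C (m (i + k) j (m i k u x $$ p) v $$ q) =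
        (-1) powi q *\<^sub>C (m j (i + k) v (m i k u x $$ p) $$ q)"
      by (rule skew_leading[OF uvx(2) mem[OF uvx(1,3)]]) (use that below' in simp)
    from arg_cong[OF this, of "scaleC (\<Omega> i j * \<alpha> i j k / \<alpha> j i k)"]
    have "(\<Omega> i j * \<alpha> i j k / \<alpha> j i k * \<Omega> j (i + k)) *\<^sub>C (m (i + k) j (m i k u x $$ p) v $$ q) =
        (-1) powi q *\<^sub>C expand_wz f p q"
      by (simp add: wz mult.commute)
    also have "\<dots> = (\<Omega> j k * \<alpha> i k j) *\<^sub>C (m (i + k) j (m i k u x $$ p) v $$ q)"
      using F(2)[OF that] diff[OF that] by simp
    finally show ?thesis
      using neq \<alpha>_nonzero[of j i k] by (auto simp: field_simps)
  qed
  have "expand_w_diff F p q = 0" if "p + q = D" for p q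
    using zero[OF that] diff[OF that] by simp
  then have "expand_wz f p q = 0" if "p + q = D" for p q
    using F(2)[OF that] that by simp
  then have "expand_zw f p1 q1 = expand_zw 0 p1 q1"
    by (intro expand_transfer(1)[where D = D]) (auto simp: expand_zero D_def)
  then show False
    using nz by (simp add: expand_zero)
qed

text \<open>The diagonal of an abelian cocycle is a quadratic form with polar form
  \<open>\<Omega> x y * \<Omega> y x\<close>, which is 1 here. Expanding both arguments by the
  hexagon leaves associators that the pentagon at \<open>(x, y, x, y)\<close> cancels.\<close>

lemma \<Omega>_diagonal_add: "\<Omega> (x + y) (x + y) = \<Omega> x x * \<Omega> y y"
proof -
  have hex: "\<Omega> i (j + k) = \<Omega> i k * \<Omega> i j * \<alpha> j k i * \<alpha> i j k / \<alpha> j i k" for i j k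
  proof -
    have "\<Omega> j i * \<Omega> i (j + k) * \<alpha> j i k * \<Omega> i j = \<Omega> i k * \<alpha> j k i * \<alpha> i j k * \<Omega> i j"
      by (simp add: hexagon)
    then have "\<Omega> i (j + k) * \<alpha> j i k * (\<Omega> j i * \<Omega> i j) = \<Omega> i k * \<Omega> i j * \<alpha> j k i * \<alpha> i j k"
      by (simp add: mult_ac)
    then show ?thesis
      using \<alpha>_nonzero[of j i k] by (simp add: \<Omega>_sym field_simps)
  qed
  have inv: "\<Omega> a b = 1 / \<Omega> b a" for a b
    using \<Omega>_sym[of a b] \<Omega>_nonzero[of b a] by (simp add: field_simps)
  have "\<Omega> (x + y) x = 1 / (\<Omega> x y * \<Omega> x x * \<alpha> x y x)"
    using \<alpha>_nonzero[of x x y] by (subst inv) (simp add: hex)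
  moreover have "\<Omega> (x + y) y = 1 / (\<Omega> y y * \<Omega> y x * \<alpha> y x y)"
    using \<alpha>_nonzero[of x y y] by (subst inv) (simp add: hex)
  ultimately have "\<Omega> (x + y) (x + y) = \<alpha> x y (x + y) * \<alpha> (x + y) x y /
     (\<Omega> y y * \<Omega> y x * \<alpha> y x y * \<Omega> x y * \<Omega> x x * \<alpha> x y x * \<alpha> x (x + y) y)"
    by (subst hex) (simp add: mult_ac)
  also have "\<alpha> x y (x + y) * \<alpha> (x + y) x y = \<alpha> y x y * \<alpha> x (x + y) y * \<alpha> x y x"
    using pentagon[of x y x y] by (simp add: add.commute)
  also have "\<alpha> y x y * \<alpha> x (x + y) y * \<alpha> x y x /
     (\<Omega> y y * \<Omega> y x * \<alpha> y x y * \<Omega> x y * \<Omega> x x * \<alpha> x y x * \<alpha> x (x + y) y) =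
     1 / (\<Omega> y y * \<Omega> x x * (\<Omega> y x * \<Omega> x y))"
    using \<alpha>_nonzero by (simp add: field_simps)
  also have "\<dots> = (1 / \<Omega> x x) * (1 / \<Omega> y y)"
    by (simp add: \<Omega>_sym)
  also have "\<dots> = \<Omega> x x * \<Omega> y y"
    by (simp only: inv[symmetric])
  finally show ?thesis .
qed

lemma \<Omega>_diagonal_coset: "\<Omega> (a + a + k) (a + a + k) = \<Omega> k k"
  using \<Omega>_sym[of a a] by (simp add: \<Omega>_diagonal_add mult.assoc)

lemma m_add_left: "u \<in> S i \<Longrightarrow> u' \<in> S i \<Longrightarrow> v \<in> S j \<Longrightarrow> m i j (u + u') v = m i j u v + m i j u' v"
  and m_add_right: "u \<in> S i \<Longrightarrow> v \<in> S j \<Longrightarrow> v' \<in> S j \<Longrightarrow> m i j u (v + v') = m i j u v + m i j u v'"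
  using bilinear[of i j] by (auto simp: bilinear_map_def linear_on_def)

text \<open>By skew-symmetry of the leading coefficient, the parity of the lowest exponent of a
  nonzero \<open>m i i u u\<close> has sign \<open>\<Omega> i i\<close>. If all of these vanish,
  polarisation makes the product alternating; the additional sign explains why that case of evenness
  asks for odd exponents.\<close>

lemma even_operator_iff: "even_operator (S i) (m i i) \<longleftrightarrow> \<Omega> i i = 1"
proof -
  have lead: "\<Omega> i i *\<^sub>C (m i i v u $$ n) = (-1) powi n *\<^sub>C (m i i u v $$ n)"
    if "u \<in> S i" "v \<in> S i" "n = fls_subdegree (m i i u v)" for u v n
    using that by (intro skew_leading) auto
  have sign: "\<Omega> i i = (-1) powi fls_subdegree (m i i u u)" if "u \<in> S i" "m i i u u \<noteq> 0" for u
    using lead[OF that(1) that(1) refl] nth_fls_subdegree_nonzero[OF that(2)]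
    by (metis cvec.scale_cancel_right)
  show ?thesis
  proof (cases "\<forall>u\<in>S i. m i i u u = 0")
    case True
    have alt: "m i i v u = - m i i u v" if "u \<in> S i" "v \<in> S i" for u v
    proof -
      have "m i i (u + v) (u + v) = 0"
        using True that cvec.subspace_add[OF subspace] by blast
      then have "m i i v u + m i i u v = 0"
        using that True cvec.subspace_add[OF subspace] by (simp add: m_add_left m_add_right add.commute)
      then show ?thesis
        by (simp add: eq_neg_iff_add_eq_0)
    qed
    have sign': "\<Omega> i i = - ((-1) powi fls_subdegree (m i i u v))" if "u \<in> S i" "v \<in> S i" "m i i u v \<noteq> 0" for u v
    proof -
      have "(- \<Omega> i i) *\<^sub>C (m i i u v $$ fls_subdegree (m i i u v)) =
          (-1) powi fls_subdegree (m i i u v) *\<^sub>C (m i i u v $$ fls_subdegree (m i i u v))"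
        using lead[OF that(1,2) refl] by (simp add: alt[OF that(1,2)])
      then have "- \<Omega> i i = (-1) powi fls_subdegree (m i i u v)"
        using nth_fls_subdegree_nonzero[OF that(3)] cvec.scale_cancel_right by blast
      then show ?thesis
        by (metis minus_minus)
    qed
    obtain u v where uv: "u \<in> S i" "v \<in> S i" "m i i u v \<noteq> 0"
      by (rule m_nonzero)
    have odd: "odd (fls_subdegree (m i i u v)) \<longleftrightarrow> \<Omega> i i = 1"
      if "u \<in> S i" "v \<in> S i" "m i i u v \<noteq> 0" for u v
      unfolding sign'[OF that] by (simp add: power_int_minus_left)
    have "even_operator (S i) (m i i) \<longleftrightarrow>
        (\<forall>u\<in>S i. \<forall>v\<in>S i. m i i u v \<noteq> 0 \<longrightarrow> odd (fls_subdegree (m i i u v)))"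
      using True by (auto simp: even_operator_def)
    also have "\<dots> \<longleftrightarrow> \<Omega> i i = 1"
      using odd uv by blast
    finally show ?thesis .
  next
    case False
    then obtain u where u: "u \<in> S i" "m i i u u \<noteq> 0"
      by blast
    have even: "even (fls_subdegree (m i i u u)) \<longleftrightarrow> \<Omega> i i = 1" if "u \<in> S i" "m i i u u \<noteq> 0" for u
      unfolding sign[OF that] by (simp add: power_int_minus_left)
    have "even_operator (S i) (m i i) \<longleftrightarrow> (\<exists>u\<in>S i. m i i u u \<noteq> 0 \<and> even (fls_subdegree (m i i u u)))"
      using u unfolding even_operator_def by blast
    also have "\<dots> \<longleftrightarrow> \<Omega> i i = 1"
      using even u by blast
    finally show ?thesis .
  qed
qed

end

section \<open>Extension of characters\<close>

lemma complex_nth_root: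
  assumes "n > 0"
  shows "\<exists>y. y ^ n = (d :: complex)"
proof -
  obtain r a where "r \<ge> 0" "d = rcis r a"
    by (metis norm_ge_zero rcis_cmod_Arg)
  then have "rcis (root n r) (a / n) ^ n = d"
    using assms by (simp add: DeMoivre2)
  then show ?thesis ..
qed

text \<open>
  Homomorphisms into the divisible group of nonzero complex numbers extend. \<open>E\<close> is the graph of a
  homomorphism on a submonoid that contains a multiple of every element.
\<close>

locale character_graph = comm_monoid G for G (structure) +
  fixes E :: "('b \<times> complex) set"
  assumes graph: "(x, d) \<in> E \<Longrightarrow> x \<in> carrier G \<and> d \<noteq> 0"
    and graph_one: "(\<one>, 1) \<in> E"
    and graph_mult: "(x, d) \<in> E \<Longrightarrow> (y, e) \<in> E \<Longrightarrow> (x \<otimes> y, d * e) \<in> E"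
    and graph_unique: "(x, d) \<in> E \<Longrightarrow> (x, e) \<in> E \<Longrightarrow> d = e"
    and cofinal: "x \<in> carrier G \<Longrightarrow> \<exists>y\<in>carrier G. \<exists>d. (x \<otimes> y, d) \<in> E"
begin

lemma graph_pow: "(x, d) \<in> E \<Longrightarrow> (x [^] (n::nat), d ^ n) \<in> E"
proof (induction n)
  case (Suc n)
  then show ?case
    using graph_mult[of "x [^] n" "d ^ n" x d] by (simp add: mult.commute)
qed (simp add: graph_one)

text \<open>A monoid need not have inverses, so closure under division is enforced separately:
  \<open>x\<close> gets the quotient of the values at \<open>x \<otimes> h\<close> and at
  \<open>h\<close>.\<close>

lemma saturate:
  "character_graph G {(x, d). x \<in> carrier G \<and> d \<noteq> 0 \<and> (\<exists>h e. (h, e) \<in> E \<and> (x \<otimes> h, d * e) \<in> E)}"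
  (is "character_graph G ?E")
proof
  show one: "(\<one>, 1) \<in> ?E"
  proof -
    have "\<exists>h e. (h, e) \<in> E \<and> (\<one> \<otimes> h, 1 * e) \<in> E"
      by (rule exI[of _ \<one>], rule exI[of _ 1]) (simp add: graph_one)
    then show ?thesis
      by simp
  qed
  show "(x \<otimes> y, d * e) \<in> ?E" if xy: "(x, d) \<in> ?E" "(y, e) \<in> ?E" for x d y e
  proof -
    obtain h1 e1 h2 e2 where *: "(h1, e1) \<in> E" "(x \<otimes> h1, d * e1) \<in> E" "(h2, e2) \<in> E" "(y \<otimes> h2, e * e2) \<in> E"
      "x \<in> carrier G" "y \<in> carrier G" "d \<noteq> 0" "e \<noteq> 0"
      using xy by auto
    have carr: "h1 \<in> carrier G" "h2 \<in> carrier G"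
      using * graph by auto
    have eqs: "(x \<otimes> h1) \<otimes> (y \<otimes> h2) = (x \<otimes> y) \<otimes> (h1 \<otimes> h2)" "(d * e1) * (e * e2) = (d * e) * (e1 * e2)"
      using * carr by (simp_all add: m_ac)
    from graph_mult[OF *(2,4)] have "((x \<otimes> y) \<otimes> (h1 \<otimes> h2), (d * e) * (e1 * e2)) \<in> E"
      unfolding eqs .
    with graph_mult[OF *(1,3)] have "\<exists>h e'. (h, e') \<in> E \<and> ((x \<otimes> y) \<otimes> h, (d * e) * e') \<in> E"
      by (intro exI conjI)
    with * show ?thesis
      by simp
  qed
  show "d = e" if xd: "(x, d) \<in> ?E" "(x, e) \<in> ?E" for x d e
  proof -
    obtain h1 e1 h2 e2 where *: "(h1, e1) \<in> E" "(x \<otimes> h1, d * e1) \<in> E" "(h2, e2) \<in> E" "(x \<otimes> h2, e * e2) \<in> E"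
      "x \<in> carrier G"
      using xd by auto
    moreover have "h1 \<in> carrier G" "h2 \<in> carrier G" "e1 \<noteq> 0" "e2 \<noteq> 0"
      using * graph by auto
    moreover have "(x \<otimes> h1) \<otimes> h2 = (x \<otimes> h2) \<otimes> h1"
      using calculation by (simp add: m_ac)
    ultimately have "(d * e1) * e2 = (e * e2) * e1"
      using graph_mult[OF *(2,3)] graph_mult[OF *(4,1)] by (intro graph_unique[of "(x \<otimes> h1) \<otimes> h2"]) simp_all
    then show ?thesis
      using \<open>e1 \<noteq> 0\<close> \<open>e2 \<noteq> 0\<close> by simp
  qed
  show "\<exists>y\<in>carrier G. \<exists>d. (x \<otimes> y, d) \<in> ?E" if x: "x \<in> carrier G" for x
  proof -
    obtain y d where "y \<in> carrier G" "(x \<otimes> y, d) \<in> E"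
      using cofinal[OF x] by blast
    then have "(x \<otimes> y, d) \<in> ?E"
      using graph_one graph[of "x \<otimes> y" d] x by (auto intro!: exI[of _ \<one>] exI[of _ "1::complex"])
    with \<open>y \<in> carrier G\<close> show ?thesis
      by blast
  qed
qed auto

text \<open>In a saturated graph the exponents of the powers of \<open>a\<close> in the domain are
  the multiples of the least positive one, by division with remainder. So a root of a single value
  is a consistent value at \<open>a\<close>; if no positive power lies in the domain, 1 will
  do.\<close>

lemma adjoin:
  assumes sat: "\<And>x d h e. x \<in> carrier G \<Longrightarrow> d \<noteq> 0 \<Longrightarrow> (h, e) \<in> E \<Longrightarrow> (x \<otimes> h, d * e) \<in> E \<Longrightarrow> (x, d) \<in> E"
    and a: "a \<in> carrier G"
  obtains y where "y \<noteq> 0" "character_graph G {(h \<otimes> a [^] (n::nat), e * y ^ n) | h e n. (h, e) \<in> E}"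
proof -
  have "\<exists>y. y \<noteq> 0 \<and> (\<forall>k d. (a [^] (k::nat), d) \<in> E \<longrightarrow> y ^ k = d)"
  proof (cases "\<exists>k>0. \<exists>d. (a [^] (k::nat), d) \<in> E")
    case True
    define n where "n = (LEAST k. k > 0 \<and> (\<exists>d. (a [^] (k::nat), d) \<in> E))"
    have n: "n > 0 \<and> (\<exists>d. (a [^] n, d) \<in> E)"
      using LeastI_ex[OF True] unfolding n_def .
    then obtain d0 where d0: "(a [^] n, d0) \<in> E"
      by blast
    obtain y where y: "y ^ n = d0"
      using complex_nth_root n by blast
    have nz: "d0 \<noteq> 0" "y \<noteq> 0"
      using graph[OF d0] y n by auto
    have "y ^ k = d" if k: "(a [^] k, d) \<in> E" for k d
    proof -
      define q r where "q = k div n" and "r = k mod n"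
      have kqr: "k = r + n * q"
        by (simp add: q_def r_def)
      have "(a [^] r, d / d0 ^ q) \<in> E"
      proof (rule sat)
        show "((a [^] n) [^] q, d0 ^ q) \<in> E"
          by (rule graph_pow[OF d0])
        show "(a [^] r \<otimes> (a [^] n) [^] q, d / d0 ^ q * d0 ^ q) \<in> E"
          using k nz a by (simp add: nat_pow_pow nat_pow_mult kqr)
      qed (use a nz graph[OF k] in auto)
      moreover have "r < n"
        using n by (simp add: r_def)
      ultimately have "r = 0"
        using not_less_Least[of r "\<lambda>k. k > 0 \<and> (\<exists>d. (a [^] (k::nat), d) \<in> E)", folded n_def] gr_zeroI by blast
      with \<open>(a [^] r, d / d0 ^ q) \<in> E\<close> have "d / d0 ^ q = 1"
        by (intro graph_unique[OF _ graph_one]) simp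
      then show ?thesis
        using nz \<open>r = 0\<close> by (simp add: kqr power_mult y)
    qed
    with nz show ?thesis
      by (intro exI[of _ y] conjI allI impI)
  next
    case False
    have "1 ^ k = d" if k: "(a [^] (k::nat), d) \<in> E" for k d
    proof -
      have "\<not> k > 0"
      proof
        assume "k > 0"
        with k have "\<exists>k>0. \<exists>d. (a [^] (k::nat), d) \<in> E"
          by (intro exI conjI)
        with False show False ..
      qed
      then have "(\<one>, d) \<in> E"
        using k by simp
      then show ?thesis
        using graph_unique[OF graph_one] by (simp only: power_one)
    qed
    then show ?thesis
      by (metis zero_neq_one)
  qed
  then obtain y where y: "y \<noteq> 0" "\<And>k d. (a [^] (k::nat), d) \<in> E \<Longrightarrow> y ^ k = d"
    by blast
  let ?E = "{(h \<otimes> a [^] (n::nat), e * y ^ n) | h e n. (h, e) \<in> E}"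
  have unique: "e * y ^ n = e' * y ^ n'"
    if h: "(h, e) \<in> E" "(h', e') \<in> E" "h \<otimes> a [^] n = h' \<otimes> a [^] n'" "n \<le> n'" for h e h' e' and n n' :: nat
  proof -
    \<comment> \<open>The factor \<open>b\<close> stands in for an inverse of \<open>a\<close>,
      since \<open>a \<otimes> b\<close> lies in the domain: its powers carry both sides of the
      equation into a form where saturation applies.\<close>
    obtain b \<epsilon> where b: "b \<in> carrier G" "(a \<otimes> b, \<epsilon>) \<in> E"
      using cofinal[OF a] by blast
    define k where "k = n' - n"
    have carr: "h \<in> carrier G" "h' \<in> carrier G" "e \<noteq> 0" "e' \<noteq> 0" "\<epsilon> \<noteq> 0"
      using h b graph by auto
    have ab: "((a \<otimes> b) [^] n, \<epsilon> ^ n) \<in> E"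
      by (rule graph_pow[OF b(2)])
    have "a [^] k \<otimes> (h' \<otimes> (a \<otimes> b) [^] n) = (h' \<otimes> (a [^] k \<otimes> a [^] n)) \<otimes> b [^] n"
      using a b carr by (simp add: nat_pow_distrib m_ac)
    also have "\<dots> = (h \<otimes> a [^] n) \<otimes> b [^] n"
      using a \<open>n \<le> n'\<close> by (simp add: nat_pow_mult k_def h(3))
    also have "\<dots> = h \<otimes> (a \<otimes> b) [^] n"
      using a b carr by (simp add: nat_pow_distrib m_ac)
    finally have eq: "a [^] k \<otimes> (h' \<otimes> (a \<otimes> b) [^] n) = h \<otimes> (a \<otimes> b) [^] n" .
    have "(a [^] k, e / e') \<in> E"
    proof (rule sat)
      show "(h' \<otimes> (a \<otimes> b) [^] n, e' * \<epsilon> ^ n) \<in> E"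
        by (rule graph_mult[OF h(2) ab])
      show "(a [^] k \<otimes> (h' \<otimes> (a \<otimes> b) [^] n), e / e' * (e' * \<epsilon> ^ n)) \<in> E"
        using graph_mult[OF h(1) ab] carr by (simp add: eq)
    qed (use a carr in auto)
    then have "y ^ k = e / e'"
      by (rule y(2))
    moreover have "y ^ n' = y ^ k * y ^ n"
      using \<open>n \<le> n'\<close> by (simp add: k_def flip: power_add)
    ultimately show ?thesis
      using carr by simp
  qed
  have "character_graph G ?E"
  proof
    show "(\<one>, 1) \<in> ?E"
      using graph_one by (force intro: exI[of _ "0::nat"])
    show "x \<in> carrier G \<and> d \<noteq> 0" if "(x, d) \<in> ?E" for x d
      using that graph a y(1) by auto
    show "(x \<otimes> z, d * e) \<in> ?E" if xz: "(x, d) \<in> ?E" "(z, e) \<in> ?E" for x d z e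
    proof -
      obtain h1 e1 n1 where 1: "(h1, e1) \<in> E" "x = h1 \<otimes> a [^] (n1::nat)" "d = e1 * y ^ n1"
        using xz(1) by blast
      obtain h2 e2 n2 where 2: "(h2, e2) \<in> E" "z = h2 \<otimes> a [^] (n2::nat)" "e = e2 * y ^ n2"
        using xz(2) by blast
      note * = 1(1) 2(1) 1(2,3) 2(2,3)
      have "h1 \<in> carrier G" "h2 \<in> carrier G"
        using * graph by auto
      then have "x \<otimes> z = (h1 \<otimes> h2) \<otimes> a [^] (n1 + n2)"
        using a by (simp add: * m_ac flip: nat_pow_mult)
      moreover have "d * e = (e1 * e2) * y ^ (n1 + n2)"
        by (simp add: * power_add)
      ultimately show ?thesis
        using graph_mult[OF *(1,2)] by blast
    qed
    show "d = e" if xd: "(x, d) \<in> ?E" "(x, e) \<in> ?E" for x d e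
    proof -
      obtain h1 e1 n1 where 1: "(h1, e1) \<in> E" "x = h1 \<otimes> a [^] (n1::nat)" "d = e1 * y ^ n1"
        using xd(1) by blast
      obtain h2 e2 n2 where 2: "(h2, e2) \<in> E" "x = h2 \<otimes> a [^] (n2::nat)" "e = e2 * y ^ n2"
        using xd(2) by blast
      show ?thesis
        using unique[OF 1(1) 2(1)] unique[OF 2(1) 1(1)] 1 2 by (metis nat_le_linear)
    qed
    show "\<exists>z\<in>carrier G. \<exists>d. (x \<otimes> z, d) \<in> ?E" if x: "x \<in> carrier G" for x
    proof -
      obtain z d where z: "z \<in> carrier G" "(x \<otimes> z, d) \<in> E"
        using cofinal[OF x] by blast
      then have "(x \<otimes> z \<otimes> a [^] (0::nat), d * y ^ 0) \<in> ?E"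
        by blast
      then have "(x \<otimes> z, d) \<in> ?E"
        using x z by simp
      with z show ?thesis
        by blast
    qed
  qed
  with y(1) show thesis
    by (rule that)
qed

text \<open>A graph that is maximal by Zorn's lemma equals its saturation, and it is total because
  adjoining an element cannot enlarge it.\<close>

theorem character_extension:
  obtains \<chi> :: "'b \<Rightarrow> complex" where
    "\<And>x. x \<in> carrier G \<Longrightarrow> \<chi> x \<noteq> 0"
    "\<And>x y. x \<in> carrier G \<Longrightarrow> y \<in> carrier G \<Longrightarrow> \<chi> (x \<otimes> y) = \<chi> x * \<chi> y"
    "\<And>x d. (x, d) \<in> E \<Longrightarrow> \<chi> x = d"
proof -
  define \<A> where "\<A> = {F. E \<subseteq> F \<and> character_graph G F}"
  have "\<exists>F\<in>\<A>. \<forall>X\<in>\<A>. F \<subseteq> X \<longrightarrow> X = F"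
  proof (rule subset_Zorn_nonempty)
    show "\<A> \<noteq> {}"
      using character_graph_axioms by (auto simp: \<A>_def)
  next
    fix C assume C: "C \<noteq> {}" "subset.chain \<A> C"
    then have CA: "F \<in> C \<Longrightarrow> F \<in> \<A>" and ch: "F \<in> C \<Longrightarrow> F' \<in> C \<Longrightarrow> F \<subseteq> F' \<or> F' \<subseteq> F" for F F'
      by (auto simp: subset.chain_def)
    have common: "\<exists>F\<in>C. p \<in> F \<and> q \<in> F" if "p \<in> \<Union>C" "q \<in> \<Union>C" for p q
      using that ch by blast
    have cg: "character_graph G F" if "F \<in> C" for F
      using CA[OF that] by (simp add: \<A>_def)
    have sub: "E \<subseteq> \<Union>C"
      using C(1) CA by (auto simp: \<A>_def)
    have "character_graph G (\<Union>C)"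
    proof
      show "(\<one>, 1) \<in> \<Union>C"
        using graph_one sub by blast
      show "x \<in> carrier G \<and> d \<noteq> 0" if "(x, d) \<in> \<Union>C" for x d
        using that character_graph.graph[OF cg] by blast
      show "(x \<otimes> y, d * e) \<in> \<Union>C" if "(x, d) \<in> \<Union>C" "(y, e) \<in> \<Union>C" for x d y e
        using common[OF that] character_graph.graph_mult[OF cg] by blast
      show "d = e" if "(x, d) \<in> \<Union>C" "(x, e) \<in> \<Union>C" for x d e
        using common[OF that] character_graph.graph_unique[OF cg] by blast
      show "\<exists>y\<in>carrier G. \<exists>d. (x \<otimes> y, d) \<in> \<Union>C" if "x \<in> carrier G" for x
        using cofinal[OF that] sub by blast
    qed
    then show "\<Union>C \<in> \<A>"
      using sub by (simp add: \<A>_def)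
  qed
  then obtain F where F_max: "F \<in> \<A>" "\<forall>X\<in>\<A>. F \<subseteq> X \<longrightarrow> X = F"
    by blast
  then have F: "E \<subseteq> F" "character_graph G F"
    by (simp_all add: \<A>_def)
  have max: "X = F" if "F \<subseteq> X" "character_graph G X" for X
    using F_max(2)[rule_format, of X] that F(1) by (simp add: \<A>_def)
  interpret F: character_graph G F by fact
  have sat: "(x, d) \<in> F" if "x \<in> carrier G" "d \<noteq> 0" "(h, e) \<in> F" "(x \<otimes> h, d * e) \<in> F" for x d h e
  proof -
    have "F \<subseteq> {(x, d). x \<in> carrier G \<and> d \<noteq> 0 \<and> (\<exists>h e. (h, e) \<in> F \<and> (x \<otimes> h, d * e) \<in> F)}" (is "_ \<subseteq> ?X")
    proof
      fix p assume "p \<in> F"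
      moreover obtain x d where "p = (x, d)"
        by (cases p)
      moreover have "x \<otimes> \<one> = x" "d * 1 = d"
        using calculation F.graph by simp_all
      then have "\<exists>h e. (h, e) \<in> F \<and> (x \<otimes> h, d * e) \<in> F"
        using calculation F.graph_one by metis
      ultimately show "p \<in> ?X"
        using F.graph by auto
    qed
    from max[OF this F.saturate] that show ?thesis
      by blast
  qed
  have dom: "\<exists>d. (a, d) \<in> F" if a: "a \<in> carrier G" for a
  proof -
    obtain y where y: "y \<noteq> 0" "character_graph G {(h \<otimes> a [^] (n::nat), e * y ^ n) | h e n. (h, e) \<in> F}"
      (is "character_graph G ?X")
      by (rule F.adjoin[OF sat a])
    have "F \<subseteq> ?X"
    proof
      fix p assume "p \<in> F"
      moreover obtain h e where "p = (h, e)"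
        by (cases p)
      moreover have "h \<otimes> a [^] (0::nat) = h"
        using calculation F.graph by simp
      moreover have "e * y ^ 0 = e"
        by simp
      ultimately show "p \<in> ?X"
        by (metis (mono_tags, lifting) mem_Collect_eq)
    qed
    from max[OF this y(2)] have "(\<one> \<otimes> a [^] (1::nat), 1 * y ^ 1) \<in> F"
      using F.graph_one by blast
    then show ?thesis
      using a by auto
  qed
  define \<chi> where "\<chi> x = (THE d. (x, d) \<in> F)" for x
  have \<chi>: "\<chi> x = d" if "(x, d) \<in> F" for x d
    unfolding \<chi>_def using that by (rule the_equality) (rule F.graph_unique[OF _ that])
  show thesis
  proof (rule that)
    show "\<chi> x \<noteq> 0" if "x \<in> carrier G" for x
      using dom[OF that] \<chi> F.graph by blast
    show "\<chi> (x \<otimes> y) = \<chi> x * \<chi> y" if "x \<in> carrier G" "y \<in> carrier G" for x y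
      using dom[OF that(1)] dom[OF that(2)] \<chi> F.graph_mult by blast
    show "\<chi> x = d" if "(x, d) \<in> E" for x d
      using that F(1) \<chi> by blast
  qed
qed

end

section \<open>Symmetric cocycles\<close>

text \<open>The least element for a well-order of the type. Stability under passage to submultisets
  makes all brackets that contain this element split it off.\<close>

lemma least_element_choice:
  obtains lo :: "'b multiset \<Rightarrow> 'b" where
    "\<And>M. M \<noteq> {#} \<Longrightarrow> lo M \<in># M"
    "\<And>M N. N \<subseteq># M \<Longrightarrow> lo M \<in># N \<Longrightarrow> lo N = lo M"
proof -
  obtain r :: "'b rel" where r: "well_order r"
    using well_ordering by (metis (full_types))
  have wf: "wf (r - Id)" and antisym: "antisym r" and total: "\<And>x y. x \<noteq> y \<Longrightarrow> (x, y) \<in> r \<or> (y, x) \<in> r"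
    using r by (auto simp: well_order_on_def linear_order_on_def partial_order_on_def total_on_def)
  define least where "least M x \<longleftrightarrow> x \<in># M \<and> (\<forall>y\<in>#M. y \<noteq> x \<longrightarrow> (x, y) \<in> r)" for M x
  have ex: "\<exists>x. least M x" if M: "M \<noteq> {#}" for M
  proof -
    obtain a where "a \<in># M"
      using M by (rule multiset_nonemptyE)
    then obtain x where x: "x \<in># M" "\<And>y. (y, x) \<in> r - Id \<Longrightarrow> y \<notin># M"
      by (rule wfE_min[OF wf]) blast
    have "(x, y) \<in> r" if "y \<in># M" "y \<noteq> x" for y
      using x(2)[of y] total[of x y] that by blast
    with x(1) show ?thesis
      by (auto simp: least_def)
  qed
  have unique: "x = y" if "least M x" "least M y" for M x y
  proof (rule ccontr)
    assume "x \<noteq> y"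
    then have "(x, y) \<in> r" "(y, x) \<in> r"
      using that by (auto simp: least_def)
    with antisym \<open>x \<noteq> y\<close> show False
      by (blast dest: antisymD)
  qed
  define lo where "lo M = (SOME x. least M x)" for M
  have lo: "least M (lo M)" if "M \<noteq> {#}" for M
    unfolding lo_def by (rule someI_ex) (rule ex[OF that])
  show thesis
  proof (rule that[of lo])
    show "lo M \<in># M" if "M \<noteq> {#}" for M
      using lo[OF that] by (simp add: least_def)
    show "lo N = lo M" if N: "N \<subseteq># M" "lo M \<in># N" for M N
    proof (rule unique)
      show "least N (lo N)"
        using N by (intro lo) auto
      have "M \<noteq> {#}"
        using N by auto
      from lo[OF this] show "least N (lo M)"
        using N by (auto simp: least_def dest: mset_subset_eqD)
    qed
  qed
qed

text \<open>What is left of an abelian cocycle once all \<open>\<Omega> i j\<close> are 1; the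
  normalisation at 0 reflects the unit.\<close>

locale symmetric_cocycle =
  fixes \<alpha> :: "'a::ab_group_add \<Rightarrow> 'a \<Rightarrow> 'a \<Rightarrow> complex"
  assumes \<alpha>_nonzero: "\<alpha> i j k \<noteq> 0"
    and pentagon: "\<alpha> i j (k + l) * \<alpha> (i + j) k l = \<alpha> j k l * \<alpha> i (j + k) l * \<alpha> i j k"
    and hexagon: "\<alpha> i j k = \<alpha> i k j * \<alpha> j i k"
    and \<alpha>_zero: "\<alpha> 0 j k = 1"
begin

lemma \<alpha>_reverse: "\<alpha> i j k * \<alpha> k j i = 1"
proof -
  have "\<alpha> i k j = \<alpha> i j k * (\<alpha> k j i * \<alpha> i k j)"
    using hexagon[of i k j] hexagon[of k i j] by simp
  then show ?thesis
    using \<alpha>_nonzero[of i k j] by simp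
qed

lemma \<alpha>_self: "\<alpha> i j i = 1"
  using hexagon[of j i i] \<alpha>_nonzero[of j i i] by simp

lemma \<alpha>_zero_right: "\<alpha> i j 0 = 1"
  using \<alpha>_reverse[of i j 0] by (simp add: \<alpha>_zero)

text \<open>Needed where the same letter \<open>i\<close> is split off both factors: the two orders
  of doing so collect the two sides of this equation.\<close>

lemma exchange: "\<alpha> i k j * \<alpha> i j (i + k) = \<alpha> i j k * \<alpha> i k (i + j)"
proof -
  have "\<alpha> i j (i + k) * \<alpha> (i + j) i k = \<alpha> j i k * \<alpha> i (i + j) k"
    using pentagon[of i j i k] by (simp add: \<alpha>_self add.commute)
  also have "\<alpha> i (i + j) k = \<alpha> i k (i + j) * \<alpha> (i + j) i k"
  proof -
    have "\<alpha> i k (i + j) * \<alpha> (i + j) i k = \<alpha> i (i + j) k * (\<alpha> k i (i + j) * \<alpha> (i + j) i k)"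
      using hexagon[of i k "i + j"] by simp
    then show ?thesis
      by (simp add: \<alpha>_reverse)
  qed
  finally have "\<alpha> i j (i + k) = \<alpha> j i k * \<alpha> i k (i + j)"
    using \<alpha>_nonzero[of "i + j" i k] by simp
  then have "\<alpha> i k j * \<alpha> i j (i + k) = (\<alpha> i k j * \<alpha> j i k) * \<alpha> i k (i + j)"
    by simp
  then show ?thesis
    using hexagon[of i j k] by simp
qed

end

text \<open>
  The cocycle becomes trivial on the free commutative monoid over the group: \<open>bracket S T\<close> is the
  scalar that relates the product of the sorted products of \<open>S\<close> and \<open>T\<close> to the sorted product of
  \<open>S + T\<close>. The recursion splits off the least element \<open>lo (S + T)\<close>.
\<close>

locale sorted_cocycle = symmetric_cocycle \<alpha>
  for \<alpha> :: "'a::ab_group_add \<Rightarrow> 'a \<Rightarrow> 'a \<Rightarrow> complex" +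
  fixes lo :: "'a multiset \<Rightarrow> 'a"
  assumes lo_in: "M \<noteq> {#} \<Longrightarrow> lo M \<in># M"
    and lo_mono: "N \<subseteq># M \<Longrightarrow> lo M \<in># N \<Longrightarrow> lo N = lo M"
begin

function bracket :: "'a multiset \<Rightarrow> 'a multiset \<Rightarrow> complex" where
  "bracket S T = (let x = lo (S + T) in
     if x \<in># S then bracket (S - {#x#}) T * \<alpha> x (\<Sum>\<^sub># (S - {#x#})) (\<Sum>\<^sub># T)
     else if x \<in># T then bracket (T - {#x#}) S * \<alpha> x (\<Sum>\<^sub># (T - {#x#})) (\<Sum>\<^sub># S)
     else 1)"
  by auto
termination
  by (relation "measure (\<lambda>(S, T). size S + size T)") (auto simp: size_Diff_singleton_if dest: size_Diff1_less)

declare bracket.simps [simp del]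

lemma bracket_left:
  assumes "lo (add_mset x S + T) = x"
  shows "bracket (add_mset x S) T = bracket S T * \<alpha> x (\<Sum>\<^sub># S) (\<Sum>\<^sub># T)"
  by (subst bracket.simps) (use assms in \<open>simp add: Let_def\<close>)

lemma bracket_right:
  assumes "lo (S + add_mset x T) = x" "x \<notin># S"
  shows "bracket S (add_mset x T) = bracket T S * \<alpha> x (\<Sum>\<^sub># T) (\<Sum>\<^sub># S)"
  by (subst bracket.simps) (use assms in \<open>simp add: Let_def\<close>)

text \<open>The recursion prefers the first argument, so symmetry is visible unless the least
  element occurs in both. Then both sides reduce to \<open>bracket S' T'\<close>, and
  \<open>exchange\<close> compares the scalars.\<close>

lemma bracket_commute: "bracket S T = bracket T S"
proof (induction "size S + size T" arbitrary: S T rule: less_induct)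
  case less
  show ?case
  proof (cases "S + T = {#}")
    case False
    define x where "x = lo (S + T)"
    have "x \<in># S + T"
      using lo_in[OF False] by (simp add: x_def)
    then consider S' T' where "S = add_mset x S'" "T = add_mset x T'"
      | S' where "S = add_mset x S'" "x \<notin># T" | T' where "T = add_mset x T'" "x \<notin># S"
      by (metis multi_member_split union_iff)
    then show ?thesis
    proof cases
      case 1
      have lo: "lo N = x" if "x \<in># N" "N \<subseteq># S + T" for N
        using lo_mono[of N "S + T"] that by (simp add: x_def)
      have S: "bracket S T = bracket S' T * \<alpha> x (\<Sum>\<^sub># S') (\<Sum>\<^sub># T)"
        unfolding 1(1) by (rule bracket_left) (rule lo, auto simp: 1)
      have T: "bracket T S = bracket T' S * \<alpha> x (\<Sum>\<^sub># T') (\<Sum>\<^sub># S)"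
        unfolding 1(2) by (rule bracket_left) (rule lo, auto simp: 1)
      have "bracket S' T = bracket T S'"
        by (rule less) (simp add: 1)
      also have "\<dots> = bracket T' S' * \<alpha> x (\<Sum>\<^sub># T') (\<Sum>\<^sub># S')"
        unfolding 1(2) by (rule bracket_left) (rule lo, auto simp: 1)
      finally have S': "bracket S' T = bracket T' S' * \<alpha> x (\<Sum>\<^sub># T') (\<Sum>\<^sub># S')" .
      have "bracket T' S = bracket S T'"
        by (rule less) (simp add: 1)
      also have "\<dots> = bracket S' T' * \<alpha> x (\<Sum>\<^sub># S') (\<Sum>\<^sub># T')"
        unfolding 1(1) by (rule bracket_left) (rule lo, auto simp: 1)
      also have "bracket S' T' = bracket T' S'"
        by (rule less) (simp add: 1)
      finally have T': "bracket T' S = bracket T' S' * \<alpha> x (\<Sum>\<^sub># S') (\<Sum>\<^sub># T')" .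
      show ?thesis
        unfolding S T S' T' using exchange[of x "\<Sum>\<^sub># T'" "\<Sum>\<^sub># S'"] by (simp add: 1)
    next
      case 2
      have "bracket S T = bracket S' T * \<alpha> x (\<Sum>\<^sub># S') (\<Sum>\<^sub># T)"
        unfolding 2(1) by (rule bracket_left) (simp only: x_def[symmetric] 2(1)[symmetric])
      moreover have "bracket T S = bracket S' T * \<alpha> x (\<Sum>\<^sub># S') (\<Sum>\<^sub># T)"
        unfolding 2(1) by (rule bracket_right) (simp_all only: add.commute[of T] x_def[symmetric] 2(1)[symmetric] 2(2) not_False_eq_True)
      ultimately show ?thesis
        by simp
    next
      case 3
      have "bracket T S = bracket T' S * \<alpha> x (\<Sum>\<^sub># T') (\<Sum>\<^sub># S)"
        unfolding 3(1) by (rule bracket_left) (simp only: add.commute[of _ S] x_def[symmetric] 3(1)[symmetric])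
      moreover have "bracket S T = bracket T' S * \<alpha> x (\<Sum>\<^sub># T') (\<Sum>\<^sub># S)"
        unfolding 3(1) by (rule bracket_right) (simp_all only: x_def[symmetric] 3(1)[symmetric] 3(2) not_False_eq_True)
      ultimately show ?thesis
        by simp
    qed
  qed simp
qed

lemma bracket_nonzero: "bracket S T \<noteq> 0"
  by (induction S T rule: bracket.induct) (subst bracket.simps, auto simp: Let_def \<alpha>_nonzero)

lemma bracket_empty: "bracket {#} T = 1"
proof (induction "size T" arbitrary: T rule: less_induct)
  case less
  show ?case
  proof (cases "T = {#}")
    case False
    define x where "x = lo T"
    then obtain T' where T: "T = add_mset x T'"
      using lo_in[OF False] by (metis multi_member_split)
    have "bracket {#} T = bracket T' {#} * \<alpha> x (\<Sum>\<^sub># T') (\<Sum>\<^sub># {#})"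
      unfolding T by (rule bracket_right) (simp_all add: T[symmetric] x_def[symmetric] del: add_mset_add_single)
    then show ?thesis
      using less[of T'] by (simp add: \<alpha>_zero_right T bracket_commute[of T'])
  qed (subst bracket.simps, simp)
qed

text \<open>If the least element lies in the first argument, the brackets containing it split it off
  there and the claim follows from the pentagon. Other positions are moved to the first by
  commutativity, and the associators that this costs are balanced by the hexagon and
  \<open>\<alpha>_reverse\<close>.\<close>

lemma bracket_assoc:
  "\<alpha> (\<Sum>\<^sub># S) (\<Sum>\<^sub># T) (\<Sum>\<^sub># U) * bracket T U * bracket S (T + U) = bracket S T * bracket (S + T) U"
proof (induction "size S + size T + size U" arbitrary: S T U rule: less_induct)
  case less
  define x where "x = lo (S + T + U)"
  have first: "\<alpha> (\<Sum>\<^sub># A) (\<Sum>\<^sub># B) (\<Sum>\<^sub># C) * bracket B C * bracket A (B + C) = bracket A B * bracket (A + B) C"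
    if x_in: "x \<in># A" and sum: "A + B + C = S + T + U" for A B C
  proof -
    obtain A' where A: "A = add_mset x A'"
      using multi_member_split[OF x_in] by blast
    have lo: "lo N = x" if "x \<in># N" "N \<subseteq># A + B + C" for N
      using lo_mono[of N "S + T + U"] that sum by (simp add: x_def)
    have 1: "bracket A (B + C) = bracket A' (B + C) * \<alpha> x (\<Sum>\<^sub># A') (\<Sum>\<^sub># (B + C))"
      unfolding A by (rule bracket_left) (rule lo, auto simp: A)
    have 2: "bracket A B = bracket A' B * \<alpha> x (\<Sum>\<^sub># A') (\<Sum>\<^sub># B)"
      unfolding A by (rule bracket_left) (rule lo, auto simp: A)
    have 3: "bracket (A + B) C = bracket (A' + B) C * \<alpha> x (\<Sum>\<^sub># (A' + B)) (\<Sum>\<^sub># C)"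
      unfolding A union_mset_add_mset_left by (rule bracket_left) (rule lo, auto simp: A)
    have "size A + size B + size C = size S + size T + size U"
      using arg_cong[OF sum, of size] by simp
    then have IH: "\<alpha> (\<Sum>\<^sub># A') (\<Sum>\<^sub># B) (\<Sum>\<^sub># C) * bracket B C * bracket A' (B + C) =
        bracket A' B * bracket (A' + B) C"
      by (intro less) (simp add: A)
    define a b c where "a = \<Sum>\<^sub># A'" and "b = \<Sum>\<^sub># B" and "c = \<Sum>\<^sub># C"
    have "\<alpha> (x + a) b c * bracket B C * (bracket A' (B + C) * \<alpha> x a (b + c)) =
        (\<alpha> x a (b + c) * \<alpha> (x + a) b c) * (bracket B C * bracket A' (B + C))"
      by simp
    also have "\<dots> = (\<alpha> a b c * bracket B C * bracket A' (B + C)) * \<alpha> x (a + b) c * \<alpha> x a b"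
      by (subst pentagon) simp
    also have "\<dots> = bracket A' B * bracket (A' + B) C * \<alpha> x (a + b) c * \<alpha> x a b"
      using IH by (simp add: a_def b_def c_def)
    finally show ?thesis
      unfolding 1 2 3 by (simp add: A a_def b_def c_def mult_ac)
  qed
  define s t u where "s = \<Sum>\<^sub># S" and "t = \<Sum>\<^sub># T" and "u = \<Sum>\<^sub># U"
  show ?case
  proof (cases "S + T + U = {#}")
    case True
    then show ?thesis
      by (simp add: \<alpha>_zero bracket_empty)
  next
    case False
    then have "x \<in># S + T + U"
      unfolding x_def by (rule lo_in)
    then consider "x \<in># S" | "x \<in># T" | "x \<in># U"
      by auto
    then show ?thesis
    proof cases
      case 1
      then show ?thesis
        by (rule first) simp
    next
      case 2
      have "\<alpha> t u s * bracket U S * bracket T (U + S) = bracket T U * bracket (T + U) S"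
        unfolding s_def t_def u_def by (rule first[OF 2]) (simp add: add_ac)
      then have TUS: "bracket T U * bracket S (T + U) = \<alpha> t u s * (bracket S U * bracket T (S + U))"
        by (simp add: bracket_commute add.commute mult_ac)
      have "\<alpha> t s u * bracket S U * bracket T (S + U) = bracket T S * bracket (T + S) U"
        unfolding s_def t_def u_def by (rule first[OF 2]) (simp add: add_ac)
      then have TSU: "bracket S T * bracket (S + T) U = \<alpha> t s u * (bracket S U * bracket T (S + U))"
        by (simp add: bracket_commute[of S T] add.commute mult_ac)
      have "\<alpha> s t u * \<alpha> t u s = \<alpha> t s u * (\<alpha> s u t * \<alpha> t u s)"
        using hexagon[of s t u] by simp
      then have "\<alpha> s t u * \<alpha> t u s = \<alpha> t s u"
        by (simp add: \<alpha>_reverse)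
      then show ?thesis
        using TUS TSU by (simp add: s_def t_def u_def mult.assoc flip: mult.assoc[of "\<alpha> _ _ _" "\<alpha> _ _ _"])
    next
      case 3
      have "\<alpha> u t s * bracket T S * bracket U (T + S) = bracket U T * bracket (U + T) S"
        unfolding s_def t_def u_def by (rule first[OF 3]) (simp add: add_ac)
      then have "\<alpha> u t s * (bracket S T * bracket (S + T) U) = bracket T U * bracket S (T + U)"
        by (simp add: bracket_commute add.commute mult_ac)
      then have "\<alpha> s t u * (bracket T U * bracket S (T + U)) = (\<alpha> s t u * \<alpha> u t s) * (bracket S T * bracket (S + T) U)"
        by simp
      then show ?thesis
        by (simp add: \<alpha>_reverse s_def t_def u_def mult.assoc)
    qed
  qed
qed

end

section \<open>Descent of the trivialisation from multisets to the group\<close>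

context sorted_cocycle
begin

lemma bracket_empty_right: "bracket S {#} = 1"
  using bracket_commute[of S "{#}"] by (simp add: bracket_empty)

text \<open>
  The extension by the nonzero scalars of the congruence on multisets given by equal sums. Since the
  cocycle \<open>\<alpha>\<close> depends on sums only, it cancels in the quotient of two brackets.
\<close>

definition pair_monoid :: "('a multiset \<times> 'a multiset \<times> complex) monoid" where
  "pair_monoid = \<lparr>carrier = {(S, S', x). \<Sum>\<^sub># S = \<Sum>\<^sub># S' \<and> x \<noteq> 0},
     monoid.mult = (\<lambda>(S, S', x) (T, T', y). (S + T, S' + T', x * y * bracket S T / bracket S' T')),
     one = ({#}, {#}, 1)\<rparr>"

text \<open>The diagonal is cofinal because \<open>(S, S', x)\<close> times
  \<open>(S', S, 1)\<close> lies in it, the two brackets being equal by commutativity.\<close>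

lemma pair_character_graph:
  "character_graph pair_monoid {((S, S, x), x) | S x. x \<noteq> 0}"
proof
  fix p q r
  assume "p \<in> carrier pair_monoid" "q \<in> carrier pair_monoid" "r \<in> carrier pair_monoid"
  then obtain S S' x T T' y U U' z where p: "p = (S, S', x)" "q = (T, T', y)" "r = (U, U', z)"
    and sums: "\<Sum>\<^sub># S = \<Sum>\<^sub># S'" "\<Sum>\<^sub># T = \<Sum>\<^sub># T'" "\<Sum>\<^sub># U = \<Sum>\<^sub># U'"
    by (auto simp: pair_monoid_def)
  have "bracket S T * bracket (S + T) U / (bracket S' T' * bracket (S' + T') U') =
      bracket T U * bracket S (T + U) / (bracket T' U' * bracket S' (T' + U'))"
    unfolding bracket_assoc[symmetric] sums
    using \<alpha>_nonzero[of "\<Sum>\<^sub># S'" "\<Sum>\<^sub># T'" "\<Sum>\<^sub># U'"] by simp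
  then show "p \<otimes>\<^bsub>pair_monoid\<^esub> q \<otimes>\<^bsub>pair_monoid\<^esub> r =
      p \<otimes>\<^bsub>pair_monoid\<^esub> (q \<otimes>\<^bsub>pair_monoid\<^esub> r)"
    using bracket_nonzero by (simp add: p pair_monoid_def add.assoc field_simps)
next
  fix p
  assume "p \<in> carrier pair_monoid"
  then obtain S S' x where p: "p = (S, S', x)" "\<Sum>\<^sub># S = \<Sum>\<^sub># S'" "x \<noteq> 0"
    by (auto simp: pair_monoid_def)
  have "(S', S, 1) \<in> carrier pair_monoid"
    using p by (simp add: pair_monoid_def)
  moreover have "(p \<otimes>\<^bsub>pair_monoid\<^esub> (S', S, 1), x) \<in> {((S, S, x), x) | S x. x \<noteq> 0}"
    using p bracket_nonzero bracket_commute[of S S'] by (simp add: pair_monoid_def add.commute)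
  ultimately show "\<exists>y\<in>carrier pair_monoid. \<exists>d. (p \<otimes>\<^bsub>pair_monoid\<^esub> y, d) \<in> {((S, S, x), x) | S x. x \<noteq> 0}"
    by blast
next
  fix p q
  assume "p \<in> carrier pair_monoid" "q \<in> carrier pair_monoid"
  obtain S S' x T T' y where p: "p = (S, S', x)" "q = (T, T', y)"
    by (metis surj_pair)
  show "p \<otimes>\<^bsub>pair_monoid\<^esub> q = q \<otimes>\<^bsub>pair_monoid\<^esub> p"
    by (simp add: pair_monoid_def p add.commute mult.commute bracket_commute[of S T] bracket_commute[of S' T'])
qed (auto simp: pair_monoid_def bracket_nonzero bracket_empty bracket_empty_right)

text \<open>The extended character yields scalars \<open>c S S'\<close> comparing the products of
  multisets with equal sums, compatibly with addition. Transporting each product to that of a fixed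
  representative of its sum turns the bracket into a function of sums.\<close>

lemma sorted_trivial:
  obtains g where "\<And>i j. g i j \<noteq> 0" "\<And>i j. g i j = g j i" "\<And>j. g 0 j = 1"
    "\<And>i j k. \<alpha> i j k * g j k * g i (j + k) = g i j * g (i + j) k"
proof -
  obtain \<chi> where \<chi>:
    "\<And>x. x \<in> carrier pair_monoid \<Longrightarrow> \<chi> x \<noteq> 0"
    "\<And>x y. x \<in> carrier pair_monoid \<Longrightarrow> y \<in> carrier pair_monoid \<Longrightarrow>
      \<chi> (x \<otimes>\<^bsub>pair_monoid\<^esub> y) = \<chi> x * \<chi> y"
    "\<And>x d. (x, d) \<in> {((S, S, x), x) | S x. x \<noteq> 0} \<Longrightarrow> \<chi> x = d"
    by (rule character_graph.character_extension[OF pair_character_graph]) blast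
  define c where "c S S' = \<chi> (S, S', 1)" for S S'
  have c_nz: "c S S' \<noteq> 0" if "\<Sum>\<^sub># S = \<Sum>\<^sub># S'" for S S'
    using \<chi>(1)[of "(S, S', 1)"] that by (simp add: pair_monoid_def c_def)
  have c_refl: "c S S = 1" for S
    using \<chi>(3)[of "(S, S, 1)" 1] by (simp add: c_def)
  have \<chi>_scale: "\<chi> (S, S', x) = x * c S S'" if "\<Sum>\<^sub># S = \<Sum>\<^sub># S'" "x \<noteq> 0" for S S' x
    using \<chi>(2)[of "({#}, {#}, x)" "(S, S', 1)"] \<chi>(3)[of "({#}, {#}, x)" x] that
    by (simp add: pair_monoid_def c_def bracket_empty)
  have c_add: "bracket S T / bracket S' T' * c (S + T) (S' + T') = c S S' * c T T'"
    if "\<Sum>\<^sub># S = \<Sum>\<^sub># S'" "\<Sum>\<^sub># T = \<Sum>\<^sub># T'" for S S' T T'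
    using \<chi>(2)[of "(S, S', 1)" "(T, T', 1)"] that bracket_nonzero
    by (simp add: pair_monoid_def c_def[symmetric] \<chi>_scale)
  \<comment> \<open>Evaluate \<open>c\<close> on \<open>S + S'\<close> and \<open>S' + S''\<close>
    in two ways.\<close>
  have c_trans: "c S S' * c S' S'' = c S S''" if "\<Sum>\<^sub># S = \<Sum>\<^sub># S'" "\<Sum>\<^sub># S' = \<Sum>\<^sub># S''" for S S' S''
    using c_add[of S S' S' S''] c_add[of S S'' S' S'] that
    by (simp add: c_refl bracket_commute[of S' S''] add.commute)
  \<comment> \<open>Zero is represented by the empty multiset rather than by \<open>{#0#}\<close>,
    which gives \<open>g 0 j = 1\<close>.\<close>
  define \<sigma> :: "'a \<Rightarrow> 'a multiset" where "\<sigma> i = (if i = 0 then {#} else {#i#})" for i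
  have \<sigma>: "\<Sum>\<^sub># (\<sigma> i) = i" for i
    by (simp add: \<sigma>_def)
  define \<theta> where "\<theta> S = c S (\<sigma> (\<Sum>\<^sub># S))" for S
  have \<theta>_nz: "\<theta> S \<noteq> 0" for S
    by (simp add: \<theta>_def c_nz \<sigma>)
  define g where "g i j = bracket (\<sigma> i) (\<sigma> j) * c (\<sigma> i + \<sigma> j) (\<sigma> (i + j))" for i j
  \<comment> \<open>The bracket differs from \<open>g\<close> by the coboundary of
    \<open>\<theta>\<close>, so \<open>bracket_assoc\<close> passes to \<open>g\<close>.\<close>
  have g: "g (\<Sum>\<^sub># S) (\<Sum>\<^sub># T) = bracket S T * \<theta> (S + T) / (\<theta> S * \<theta> T)" for S T
  proof -
    let ?i = "\<Sum>\<^sub># S" and ?j = "\<Sum>\<^sub># T"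
    have "\<theta> (S + T) = c (S + T) (\<sigma> ?i + \<sigma> ?j) * c (\<sigma> ?i + \<sigma> ?j) (\<sigma> (?i + ?j))"
      unfolding \<theta>_def by (subst c_trans) (simp_all add: \<sigma>)
    moreover have "bracket S T * c (S + T) (\<sigma> ?i + \<sigma> ?j) = \<theta> S * \<theta> T * bracket (\<sigma> ?i) (\<sigma> ?j)"
      using c_add[of S "\<sigma> ?i" T "\<sigma> ?j"] bracket_nonzero[of "\<sigma> ?i" "\<sigma> ?j"]
      by (simp add: \<theta>_def \<sigma> field_simps)
    ultimately have "bracket S T * \<theta> (S + T) = \<theta> S * \<theta> T * g ?i ?j"
      by (simp add: g_def)
    then show ?thesis
      using \<theta>_nz by (simp add: field_simps)
  qed
  show thesis
  proof (rule that[of g])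
    fix i j k
    show "g i j \<noteq> 0"
      by (simp add: g_def c_nz bracket_nonzero \<sigma>)
    show "g i j = g j i"
      by (simp add: g_def bracket_commute add.commute)
    show "g 0 j = 1"
      using g[of "{#}" "\<sigma> j"] \<theta>_nz[of "\<sigma> j"] by (simp add: \<sigma> bracket_empty \<theta>_def[of "{#}"] c_refl \<sigma>_def[of 0])
    have A: "g j k * g i (j + k) = bracket (\<sigma> j) (\<sigma> k) * bracket (\<sigma> i) (\<sigma> j + \<sigma> k) * \<theta> (\<sigma> i + (\<sigma> j + \<sigma> k)) /
        (\<theta> (\<sigma> i) * \<theta> (\<sigma> j) * \<theta> (\<sigma> k))"
      using \<theta>_nz g[of "\<sigma> j" "\<sigma> k", unfolded \<sigma>] g[of "\<sigma> i" "\<sigma> j + \<sigma> k", unfolded \<sigma> sum_mset.union]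
      by (simp only:) (simp add: field_simps)
    have B: "g i j * g (i + j) k = bracket (\<sigma> i) (\<sigma> j) * bracket (\<sigma> i + \<sigma> j) (\<sigma> k) * \<theta> (\<sigma> i + \<sigma> j + \<sigma> k) /
        (\<theta> (\<sigma> i) * \<theta> (\<sigma> j) * \<theta> (\<sigma> k))"
      using \<theta>_nz g[of "\<sigma> i" "\<sigma> j", unfolded \<sigma>] g[of "\<sigma> i + \<sigma> j" "\<sigma> k", unfolded \<sigma> sum_mset.union]
      by (simp only:) (simp add: field_simps)
    have C: "\<alpha> i j k * (bracket (\<sigma> j) (\<sigma> k) * bracket (\<sigma> i) (\<sigma> j + \<sigma> k)) =
        bracket (\<sigma> i) (\<sigma> j) * bracket (\<sigma> i + \<sigma> j) (\<sigma> k)"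
      using bracket_assoc[of "\<sigma> i" "\<sigma> j" "\<sigma> k"] by (simp add: \<sigma> mult.assoc)
    have "\<alpha> i j k * g j k * g i (j + k) = \<alpha> i j k * (g j k * g i (j + k))"
      by simp
    also have "\<dots> = (\<alpha> i j k * (bracket (\<sigma> j) (\<sigma> k) * bracket (\<sigma> i) (\<sigma> j + \<sigma> k))) *
        \<theta> (\<sigma> i + (\<sigma> j + \<sigma> k)) / (\<theta> (\<sigma> i) * \<theta> (\<sigma> j) * \<theta> (\<sigma> k))"
      unfolding A by simp
    also have "\<dots> = g i j * g (i + j) k"
      unfolding B C by (simp add: add.assoc)
    finally show "\<alpha> i j k * g j k * g i (j + k) = g i j * g (i + j) k" .
  qed
qed

end

theorem (in symmetric_cocycle) trivial:
  obtains g where "\<And>i j. g i j \<noteq> 0" "\<And>i j. g i j = g j i" "\<And>j. g 0 j = 1"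
    "\<And>i j k. \<alpha> i j k * g j k * g i (j + k) = g i j * g (i + j) k"
proof -
  obtain lo :: "'a multiset \<Rightarrow> 'a" where lo: "\<And>M. M \<noteq> {#} \<Longrightarrow> lo M \<in># M"
    "\<And>M N. N \<subseteq># M \<Longrightarrow> lo M \<in># N \<Longrightarrow> lo N = lo M"
    by (rule least_element_choice) blast
  interpret sorted_cocycle \<alpha> lo
    by unfold_locales (fact lo)+
  show thesis
    by (rule sorted_trivial) (rule that)
qed

section \<open>One-dimensional data\<close>

lemma one_dimensional_multiple:
  assumes "one_dimensional X" "a \<in> X" "a \<noteq> 0" "b \<in> X"
  obtains c where "b = c *\<^sub>C a"
proof -
  obtain B where B: "B \<subseteq> X" "cvec.independent B" "X \<subseteq> cvec.span B" "card B = cvec.dim X"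
    by (rule cvec.basis_exists)
  then obtain e where "B = {e}"
    using assms(1) by (auto simp: one_dimensional_def card_1_singleton_iff)
  then have "X \<subseteq> range (\<lambda>r. r *\<^sub>C e)"
    using B(3) by (simp add: cvec.span_singleton)
  then obtain r s where "a = r *\<^sub>C e" "b = s *\<^sub>C e"
    using assms(2,4) by blast
  then have "b = (s / r) *\<^sub>C a"
    using assms(3) by auto
  then show thesis
    by (rule that)
qed

lemma one_dimensional_nonzero:
  assumes "one_dimensional X"
  obtains a where "a \<in> X" "a \<noteq> 0"
proof -
  obtain B where B: "B \<subseteq> X" "cvec.independent B" "card B = cvec.dim X"
    using cvec.basis_exists[of X] by metis
  then obtain e where "B = {e}"
    using assms by (auto simp: one_dimensional_def card_1_singleton_iff)
  then show thesis
    using B that cvec.dependent_zero[of B] by auto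
qed

lemma one_dimensional_span:
  assumes "one_dimensional (cvec.span {a})"
  shows "a \<noteq> 0"
proof
  assume "a = 0"
  obtain b where "b \<in> cvec.span {a}" "b \<noteq> 0"
    by (rule one_dimensional_nonzero[OF assms])
  with \<open>a = 0\<close> show False
    by (auto simp: cvec.span_singleton)
qed

text \<open>The isomorphism is given on bases only; in dimension one their members are multiples of
  \<open>a\<close> and \<open>b\<close>, and a member of the image basis is nonzero.\<close>

lemma induces_iso2_nonzero:
  assumes \<phi>: "induces_iso2 X Y Z \<phi>" and X: "one_dimensional X" "a \<in> X" "a \<noteq> 0"
    and Y: "one_dimensional Y" "b \<in> Y" "b \<noteq> 0"
  shows "\<phi> a b \<in> Z" "\<phi> a b \<noteq> 0"
proof -
  have bil: "bilinear_map X Y Z \<phi>"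
    using \<phi> by (simp add: induces_iso2_def)
  then show "\<phi> a b \<in> Z"
    using X Y by (simp add: bilinear_map_def linear_on_def)
  obtain B C where B: "is_basis B X" and C: "is_basis C Y"
    and Z: "is_basis ((\<lambda>(b, c). \<phi> b c) ` (B \<times> C)) Z"
    using \<phi> by (auto simp: induces_iso2_def)
  have "B \<noteq> {}" "C \<noteq> {}"
    using B C X Y by (auto simp: is_basis_def)
  then obtain e f where ef: "e \<in> B" "f \<in> C"
    by blast
  then have "e \<in> X" "f \<in> Y"
    using B C by (auto simp: is_basis_def intro: cvec.span_base)
  then obtain r s where rs: "e = r *\<^sub>C a" "f = s *\<^sub>C b"
    by (metis one_dimensional_multiple X Y)
  have "\<phi> e f \<in> (\<lambda>(b, c). \<phi> b c) ` (B \<times> C)"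
    using ef by (auto intro!: rev_image_eqI[of "(e, f)"])
  then have "\<phi> e f \<noteq> 0"
    using Z cvec.dependent_zero unfolding is_basis_def by metis
  moreover have "\<phi> e f = r *\<^sub>C s *\<^sub>C \<phi> a b"
    using bil X Y \<open>f \<in> Y\<close> unfolding rs by (simp add: bilinear_map_def linear_on_def)
  ultimately show "\<phi> a b \<noteq> 0"
    by auto
qed

lemma induces_iso3_nonzero:
  assumes \<phi>: "induces_iso3 X Y W Z \<phi>" and X: "one_dimensional X" "a \<in> X" "a \<noteq> 0"
    and Y: "one_dimensional Y" "b \<in> Y" "b \<noteq> 0" and W: "one_dimensional W" "c \<in> W" "c \<noteq> 0"
  shows "\<phi> a b c \<in> Z" "\<phi> a b c \<noteq> 0"
proof -
  have tri: "trilinear_map X Y W Z \<phi>"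
    using \<phi> by (simp add: induces_iso3_def)
  then show "\<phi> a b c \<in> Z"
    using X Y W by (simp add: trilinear_map_def bilinear_map_def linear_on_def)
  obtain B C D where B: "is_basis B X" and C: "is_basis C Y" and D: "is_basis D W"
    and Z: "is_basis ((\<lambda>(b, c, d). \<phi> b c d) ` (B \<times> C \<times> D)) Z"
    using \<phi> by (auto simp: induces_iso3_def)
  have "B \<noteq> {}" "C \<noteq> {}" "D \<noteq> {}"
    using B C D X Y W by (auto simp: is_basis_def)
  then obtain e f g where efg: "e \<in> B" "f \<in> C" "g \<in> D"
    by blast
  then have mem: "e \<in> X" "f \<in> Y" "g \<in> W"
    using B C D by (auto simp: is_basis_def intro: cvec.span_base)
  then obtain r s t where rst: "e = r *\<^sub>C a" "f = s *\<^sub>C b" "g = t *\<^sub>C c"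
    by (metis one_dimensional_multiple X Y W)
  have "\<phi> e f g \<in> (\<lambda>(b, c, d). \<phi> b c d) ` (B \<times> C \<times> D)"
    using efg by (auto intro!: rev_image_eqI[of "(e, f, g)"])
  then have "\<phi> e f g \<noteq> 0"
    using Z cvec.dependent_zero unfolding is_basis_def by metis
  moreover have "\<phi> e f g = r *\<^sub>C s *\<^sub>C t *\<^sub>C \<phi> a b c"
    using tri X Y W mem unfolding rst by (simp add: trilinear_map_def bilinear_map_def linear_on_def)
  ultimately show "\<phi> a b c \<noteq> 0"
    by auto
qed

lemma T_module_va_module: "T_module T V M \<Longrightarrow> va_module V M"
  by (cases "(T, V, M)" rule: T_module.cases; cases "kind_of T")
    (auto simp: integral_weight_module_def conformal_module_def)

lemma T_vertex_algebra_underlying: "T_vertex_algebra T V \<Longrightarrow> underlying_va V"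
  by (cases "(T, V)" rule: T_vertex_algebra.cases; cases "kind_of T")
    (auto simp: weighted_va_def conformal_va_def)

lemma intertwining_operatorD:
  assumes "intertwining_operator T V M1 M2 M3 I"
  shows "bilinear_map (Mspace M1) (Mspace M2) (laurent (Mspace M3)) I"
    and "u \<in> Mspace M1 \<Longrightarrow> v \<in> Mspace M2 \<Longrightarrow>
      I (M_L M1 (-1) u) v $$ n = of_int (n + 1) *\<^sub>C (I u v $$ (n + 1))"
    and "u \<in> Mspace M1 \<Longrightarrow> v \<in> Mspace M2 \<Longrightarrow>
      I u (M_L M2 (-1) v) $$ n = M_L M3 (-1) (I u v $$ n) - of_int (n + 1) *\<^sub>C (I u v $$ (n + 1))"
    and "a \<in> Vspace V \<Longrightarrow> u \<in> Mspace M1 \<Longrightarrow> v \<in> Mspace M2 \<Longrightarrow> \<exists>f\<in>zw_series_in (Mspace M3).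
        expand_zw f = comp_outer (Mact M3) I a u v \<and>
        expand_w_diff f = comp_inner I (Mact M1) a u v"
proof -
  show "bilinear_map (Mspace M1) (Mspace M2) (laurent (Mspace M3)) I"
    using assms by (simp add: intertwining_operator_def)
  have L: "of_int (n + 1) *\<^sub>C (I u v $$ (n + 1)) = I (M_L M1 (-1) u) v $$ n"
    "I (M_L M1 (-1) u) v $$ n = M_L M3 (-1) (I u v $$ n) - I u (M_L M2 (-1) v) $$ n"
    if "u \<in> Mspace M1" "v \<in> Mspace M2"
    using assms that unfolding intertwining_operator_def by blast+
  show "I (M_L M1 (-1) u) v $$ n = of_int (n + 1) *\<^sub>C (I u v $$ (n + 1))"
    if "u \<in> Mspace M1" "v \<in> Mspace M2"
    using L(1)[OF that] by simp
  show "I u (M_L M2 (-1) v) $$ n = M_L M3 (-1) (I u v $$ n) - of_int (n + 1) *\<^sub>C (I u v $$ (n + 1))"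
    if "u \<in> Mspace M1" "v \<in> Mspace M2"
    unfolding L(1)[OF that] L(2)[OF that] by simp
  show "\<exists>f\<in>zw_series_in (Mspace M3). expand_zw f = comp_outer (Mact M3) I a u v \<and>
        expand_w_diff f = comp_inner I (Mact M1) a u v"
    if "a \<in> Vspace V" "u \<in> Mspace M1" "v \<in> Mspace M2"
    using assms that unfolding intertwining_operator_def by blast
qed

text \<open>Both composites are nonzero elements of the same line \<open>J\<close>, and
  \<open>a\<close> is their ratio.\<close>

lemma associativity_datum_assoc:
  assumes datum: "associativity_datum T V M \<I>"
    and m: "\<And>i j. m i j \<in> \<I> i j" "\<And>i j. m i j \<noteq> 0"
  shows "\<exists>a. associator (\<lambda>i. Mspace (M i)) m i j k a"
proof -
  let ?S = "\<lambda>i. Mspace (M i)"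
  have one: "one_dimensional (\<I> i j)" for i j
    using datum by (simp add: associativity_datum_def)
  obtain J \<phi> \<psi> where J: "one_dimensional J"
    and tri: "\<forall>F\<in>J. trilinear_map (?S i) (?S j) (?S k)
           (zw_series_in (?S (i + j + k))) F"
    and \<phi>: "induces_iso2 (\<I> i (j + k)) (\<I> j k) J \<phi>"
      "\<forall>m\<in>\<I> i (j + k). \<forall>m'\<in>\<I> j k. \<forall>u\<in>?S i. \<forall>v\<in>?S j. \<forall>x\<in>?S k.
              expand_zw (\<phi> m m' u v x) = comp_outer m m' u v x"
    and \<psi>: "induces_iso2 (\<I> (i + j) k) (\<I> i j) J \<psi>"
      "\<forall>m\<in>\<I> (i + j) k. \<forall>m'\<in>\<I> i j. \<forall>u\<in>?S i. \<forall>v\<in>?S j. \<forall>x\<in>?S k.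
              expand_w_diff (\<psi> m m' u v x) = comp_inner m m' u v x"
    by (rule datum[unfolded associativity_datum_def, THEN conjunct2, THEN conjunct1,
          THEN spec[of _ i], THEN spec[of _ j], THEN spec[of _ k], THEN exE], elim exE conjE) (rule that)
  define F G where "F = \<phi> (m i (j + k)) (m j k)" and "G = \<psi> (m (i + j) k) (m i j)"
  have F: "F \<in> J" "F \<noteq> 0"
    unfolding F_def by (rule induces_iso2_nonzero[OF \<phi>(1) one m one m])+
  have G: "G \<in> J" "G \<noteq> 0"
    unfolding G_def by (rule induces_iso2_nonzero[OF \<psi>(1) one m one m])+
  obtain a where a: "F = a *\<^sub>C G"
    by (rule one_dimensional_multiple[OF J G F(1)])
  then have "a \<noteq> 0"
    using F(2) by auto
  have zw: "expand_zw (F u v x) = comp_outer (m i (j + k)) (m j k) u v x"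
    if "u \<in> ?S i" "v \<in> ?S j" "x \<in> ?S k" for u v x
    using \<phi>(2) m that by (simp add: F_def)
  have diff: "expand_w_diff (F u v x) p q = a *\<^sub>C comp_inner (m (i + j) k) (m i j) u v x p q"
    if "u \<in> ?S i" "v \<in> ?S j" "x \<in> ?S k" for u v x p q
    using \<psi>(2) m that by (simp add: a expand_scale G_def)
  have mem: "F u v x \<in> zw_series_in (?S (i + j + k))"
    if "u \<in> ?S i" "v \<in> ?S j" "x \<in> ?S k" for u v x
    using tri[rule_format, OF F(1)] that by (simp add: trilinear_map_def bilinear_map_def linear_on_def)
  obtain u v x where nz: "F u v x \<noteq> 0"
    using F(2) by (auto simp: fun_eq_iff)
  then have uvx: "u \<in> ?S i" "v \<in> ?S j" "x \<in> ?S k"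
    using tri[rule_format, OF F(1)] unfolding trilinear_map_def bilinear_map_def by blast+
  have "expand_zw (F u v x) \<noteq> expand_zw 0"
    using nz expand_inject by blast
  then have nz': "\<exists>p q. comp_outer (m i (j + k)) (m j k) u v x p q \<noteq> 0"
    by (auto simp: fun_eq_iff zw[OF uvx] expand_zero)
  show ?thesis
    unfolding associator_def
  proof (intro exI[of _ a] conjI ballI)
    show "a \<noteq> 0"
      by fact
    show "\<exists>u\<in>?S i. \<exists>v\<in>?S j. \<exists>x\<in>?S k. \<exists>p q.
      comp_outer (m i (j + k)) (m j k) u v x p q \<noteq> 0"
      by (intro bexI[of _ u] bexI[of _ v] bexI[of _ x] nz' uvx)
    fix u v x
    assume "u \<in> ?S i" "v \<in> ?S j" "x \<in> ?S k"
    then show "\<exists>f\<in>zw_series_in (?S (i + j + k)).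
      expand_zw f = comp_outer (m i (j + k)) (m j k) u v x \<and>
      expand_w_diff f = (\<lambda>p q. a *\<^sub>C comp_inner (m (i + j) k) (m i j) u v x p q)"
      by (intro bexI[of _ "F u v x"] conjI zw mem ext diff)
  qed
qed

lemma associativity_datum_quad:
  assumes datum: "associativity_datum T V M \<I>"
    and m: "\<And>i j. m i j \<in> \<I> i j" "\<And>i j. m i j \<noteq> 0"
  shows "four_point (\<lambda>i. Mspace (M i)) m i j k l"
proof -
  let ?S = "\<lambda>i. Mspace (M i)"
  have one: "one_dimensional (\<I> i j)" for i j
    using datum by (simp add: associativity_datum_def)
  obtain J \<phi> where J: "one_dimensional J"
    and quad: "\<forall>F\<in>J. quadrilinear_map (?S i) (?S j) (?S k) (?S l)
           (zwt_series_in (?S (i + j + k + l))) F"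
    and \<phi>: "induces_iso3 (\<I> i (j + k + l)) (\<I> j (k + l)) (\<I> k l) J \<phi>"
      "\<forall>m\<in>\<I> i (j + k + l). \<forall>m'\<in>\<I> j (k + l). \<forall>m''\<in>\<I> k l.
            \<forall>u\<in>?S i. \<forall>v\<in>?S j. \<forall>x\<in>?S k. \<forall>y\<in>?S l.
              expand_zwt (\<phi> m m' m'' u v x y) = (\<lambda>p q r. m u (m' v (m'' x y $$ r) $$ q) $$ p)"
    by (rule datum[unfolded associativity_datum_def, THEN conjunct2, THEN conjunct2, THEN conjunct1,
          THEN spec[of _ i], THEN spec[of _ j], THEN spec[of _ k], THEN spec[of _ l], THEN exE],
        elim exE conjE) (rule that)
  define F where "F = \<phi> (m i (j + k + l)) (m j (k + l)) (m k l)"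
  have F: "F \<in> J" "F \<noteq> 0"
    unfolding F_def by (rule induces_iso3_nonzero[OF \<phi>(1) one m one m one m])+
  have zwt: "expand_zwt (F u v x y) = (\<lambda>p q r. m i (j + (k + l)) u (m j (k + l) v (m k l x y $$ r) $$ q) $$ p)"
    if "u \<in> ?S i" "v \<in> ?S j" "x \<in> ?S k" "y \<in> ?S l" for u v x y
    using \<phi>(2) m that by (simp add: F_def add.assoc)
  obtain u v x y where nz: "F u v x y \<noteq> 0"
    using F(2) by (auto simp: fun_eq_iff)
  then have uvxy: "u \<in> ?S i" "v \<in> ?S j" "x \<in> ?S k" "y \<in> ?S l"
    using quad[rule_format, OF F(1)] unfolding quadrilinear_map_def trilinear_map_def bilinear_map_def by blast+
  have "\<exists>p q r. expand_zwt (F u v x y) p q r \<noteq> 0"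
    using nz expand_zwt_eq_0 by blast
  then have nz': "\<exists>p q r. m i (j + (k + l)) u (m j (k + l) v (m k l x y $$ r) $$ q) $$ p \<noteq> 0"
    by (simp add: zwt[OF uvxy])
  show ?thesis
    unfolding four_point_def
  proof (intro conjI ballI)
    fix u v x y
    assume "u \<in> ?S i" "v \<in> ?S j" "x \<in> ?S k" "y \<in> ?S l"
    then show "\<exists>f. expand_zwt f = (\<lambda>p q r. m i (j + (k + l)) u (m j (k + l) v (m k l x y $$ r) $$ q) $$ p)"
      by (intro exI) (rule zwt)
  next
    show "\<exists>u\<in>?S i. \<exists>v\<in>?S j. \<exists>x\<in>?S k. \<exists>y\<in>?S l. \<exists>p q r.
      m i (j + (k + l)) u (m j (k + l) v (m k l x y $$ r) $$ q) $$ p \<noteq> 0"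
      by (intro bexI[of _ u] bexI[of _ v] bexI[of _ x] bexI[of _ y] nz' uvxy)
  qed
qed

lemma commutativity_datum_graded_product:
  assumes datum: "commutativity_datum T V M \<I>" and modules: "\<forall>i. T_module T V (M i)"
    and m: "\<And>i j. m i j \<in> \<I> i j" "\<And>i j. m i j \<noteq> 0"
  obtains \<alpha> \<Omega> where "graded_product (\<lambda>i. Mspace (M i)) (\<lambda>i. M_L (M i) (-1)) m \<alpha> \<Omega>"
proof -
  let ?S = "\<lambda>i. Mspace (M i)"
  have assoc: "associativity_datum T V M \<I>"
    using datum by (simp add: commutativity_datum_def)
  have one: "one_dimensional (\<I> i j)" and op: "intertwining_operator T V (M i) (M j) (M (i + j)) (m i j)" for i j
    using assoc m(1) by (auto simp: associativity_datum_def)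
  have va: "va_module V (M i)" for i
    using modules T_module_va_module by blast
  have "\<exists>c. skew (M_L (M (i + j)) (-1)) (m i j) = c *\<^sub>C m j i" for i j
    using datum m one one_dimensional_multiple[OF one m] unfolding commutativity_datum_def by metis
  then obtain \<Omega> where \<Omega>: "\<And>i j. skew (M_L (M (i + j)) (-1)) (m i j) = \<Omega> i j *\<^sub>C m j i"
    by metis
  obtain \<alpha> where \<alpha>: "\<And>i j k. associator ?S m i j k (\<alpha> i j k)"
    using associativity_datum_assoc[OF assoc m] by metis
  have "graded_product ?S (\<lambda>i. M_L (M i) (-1)) m \<alpha> \<Omega>"
  proof
    fix i j k l
    show "cvec.subspace (?S i)" "linear_on (?S i) (?S i) (M_L (M i) (-1))"
      using va[of i] by (auto simp: va_module_def)
    show "bilinear_map (?S i) (?S j) (laurent (?S (i + j))) (m i j)"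
      by (rule intertwining_operatorD(1)[OF op])
    show "associator ?S m i j k (\<alpha> i j k)"
      by (rule \<alpha>)
    show "four_point ?S m i j k l"
      by (rule associativity_datum_quad[OF assoc m])
    show "skew (M_L (M (i + j)) (-1)) (m i j) = \<Omega> i j *\<^sub>C m j i"
      by (rule \<Omega>)
    fix u v n assume uv: "u \<in> ?S i" "v \<in> ?S j"
    show "m i j (M_L (M i) (-1) u) v $$ n = of_int (n + 1) *\<^sub>C (m i j u v $$ (n + 1))"
      by (rule intertwining_operatorD(2)[OF op uv])
    show "m i j u (M_L (M j) (-1) v) $$ n = M_L (M (i + j)) (-1) (m i j u v $$ n) -
        of_int (n + 1) *\<^sub>C (m i j u v $$ (n + 1))"
      by (rule intertwining_operatorD(3)[OF op uv])
  qed
  then show thesis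
    by (rule that)
qed

section \<open>Direct sums\<close>

definition summand :: "'a \<Rightarrow> 'm::zero \<Rightarrow> 'a \<Rightarrow> 'm" where
  "summand i u = (\<lambda>j. if j = i then u else 0)"

lemma sum_fun_apply: "(\<Sum>a\<in>A. f a) x = (\<Sum>a\<in>A. f a x)"
  by (induction A rule: infinite_finite_induct) simp_all

locale graded_bilinear =
  fixes M :: "'a::ab_group_add \<Rightarrow> ('g, 'v, 'v::complex_vector) mod_data"
    and m :: "'a \<Rightarrow> 'a \<Rightarrow> 'v \<Rightarrow> 'v \<Rightarrow> 'v fls"
  assumes subspace: "cvec.subspace (Mspace (M i))"
    and L_linear: "linear_on (Mspace (M i)) (Mspace (M i)) (M_L (M i) (-1))"
    and bilinear: "bilinear_map (Mspace (M i)) (Mspace (M j)) (laurent (Mspace (M (i + j)))) (m i j)"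
begin

abbreviation S :: "'a \<Rightarrow> 'v set" where
  "S i \<equiv> Mspace (M i)"
abbreviation D :: "('a \<Rightarrow> 'v) set" where
  "D \<equiv> direct_sum_space M"
abbreviation ds_mult :: "('a \<Rightarrow> 'v) \<Rightarrow> ('a \<Rightarrow> 'v) \<Rightarrow> ('a \<Rightarrow> 'v) fls" where
  "ds_mult \<equiv> direct_sum_mult M m"

lemma D_mem: "x \<in> D \<Longrightarrow> x i \<in> S i"
  and D_finite: "x \<in> D \<Longrightarrow> finite {i. x i \<noteq> 0}"
  by (simp_all add: direct_sum_space_def)

lemma subspace_D: "cvec.subspace D"
proof (rule cvec.subspaceI)
  show "0 \<in> D"
    using cvec.subspace_0[OF subspace] by (simp add: direct_sum_space_def)
  show "x + y \<in> D" if "x \<in> D" "y \<in> D" for x y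
  proof -
    have "finite {i. x i + y i \<noteq> 0}"
      by (rule finite_subset[of _ "{i. x i \<noteq> 0} \<union> {i. y i \<noteq> 0}"]) (use that D_finite in auto)
    then show ?thesis
      using that cvec.subspace_add[OF subspace] by (simp add: direct_sum_space_def)
  qed
  show "c *\<^sub>C x \<in> D" if "x \<in> D" for c x
  proof -
    have "finite {i. c *\<^sub>C x i \<noteq> 0}"
      by (rule finite_subset[of _ "{i. x i \<noteq> 0}"]) (use that D_finite in auto)
    then show ?thesis
      using that cvec.subspace_scale[OF subspace] by (simp add: direct_sum_space_def)
  qed
qed

lemma summand_mem: "u \<in> S i \<Longrightarrow> summand i u \<in> D"
  using cvec.subspace_0[OF subspace]
  by (auto simp: direct_sum_space_def summand_def intro: finite_subset[of _ "{i}"])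

lemma linear_on_summand: "linear_on (S i) D (summand i)"
  by (auto simp: linear_on_def summand_mem) (auto simp: summand_def fun_eq_iff)

lemma linear_on_component: "linear_on D (S i) (\<lambda>x. x i)"
  by (simp add: linear_on_def D_mem)

lemma m_mem: "u \<in> S i \<Longrightarrow> v \<in> S j \<Longrightarrow> m i j u v $$ n \<in> S (i + j)"
  using bilinear[of i j] by (auto simp: bilinear_map_def linear_on_def laurent_def)

lemma linear_right: "u \<in> S i \<Longrightarrow> linear_on (S j) (S (i + j)) (\<lambda>v. m i j u v $$ n)"
  using bilinear[of i j] by (simp add: bilinear_map_def linear_on_def laurent_def)

lemma linear_left: "v \<in> S j \<Longrightarrow> linear_on (S i) (S (i + j)) (\<lambda>u. m i j u v $$ n)"
  using bilinear[of i j] by (simp add: bilinear_map_def linear_on_def laurent_def)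

lemma m_zero: "m i j 0 v = 0" "m i j u 0 = 0"
  using linear_on_0[OF linear_left subspace, of v j i] linear_on_0[OF linear_right subspace, of u i j] bilinear[of i j]
  by (auto simp: bilinear_map_def fls_eq_iff) metis+

text \<open>Any finite superset of the support may serve as index set, so that several vectors can
  be summed over a common one.\<close>

lemma ds_mult_nth:
  assumes "x \<in> D" "y \<in> D" and A: "finite A" "{i. x i \<noteq> 0} \<subseteq> A"
  shows "(ds_mult x y $$ n) k = (\<Sum>i\<in>A. m i (k - i) (x i) (y (k - i)) $$ n)"
proof -
  let ?F = "\<lambda>k. \<Sum>i | x i \<noteq> 0. m i (k - i) (x i) (y (k - i))"
  have "{k. ?F k \<noteq> 0} \<subseteq> (\<lambda>(i, j). i + j) ` ({i. x i \<noteq> 0} \<times> {j. y j \<noteq> 0})"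
  proof
    fix k assume "k \<in> {k. ?F k \<noteq> 0}"
    then obtain i where "x i \<noteq> 0" "m i (k - i) (x i) (y (k - i)) \<noteq> 0"
      by (auto elim: sum.not_neutral_contains_not_neutral)
    then have "x i \<noteq> 0" "y (k - i) \<noteq> 0"
      by (auto simp: m_zero)
    then show "k \<in> (\<lambda>(i, j). i + j) ` ({i. x i \<noteq> 0} \<times> {j. y j \<noteq> 0})"
      by (auto intro!: rev_image_eqI[of "(i, k - i)"])
  qed
  then have "finite {k. ?F k \<noteq> 0}"
    by (rule finite_subset) (use assms D_finite in auto)
  then have "ds_mult x y $$ n = (\<lambda>k. ?F k $$ n)"
    using assms by (simp add: direct_sum_mult_def fls_assemble_nth)
  moreover have "?F k $$ n = (\<Sum>i\<in>A. m i (k - i) (x i) (y (k - i)) $$ n)"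
    unfolding fls_nth_sum
    by (rule sum.mono_neutral_left) (use A in \<open>auto simp: m_zero\<close>)
  ultimately show ?thesis
    by simp
qed

lemma ds_mult_nth_mem:
  assumes xy: "x \<in> D" "y \<in> D"
  shows "ds_mult x y $$ n \<in> D"
proof -
  note nth = ds_mult_nth[OF xy D_finite[OF xy(1)] order_refl]
  have "(ds_mult x y $$ n) k \<in> S k" for k
    unfolding nth
    using m_mem[OF D_mem[OF xy(1)] D_mem[OF xy(2)], of _ "k - i" n for i]
    by (intro cvec.subspace_sum[OF subspace]) (metis add.commute diff_add_cancel)
  moreover have "finite {k. (ds_mult x y $$ n) k \<noteq> 0}"
  proof (rule finite_subset)
    show "{k. (ds_mult x y $$ n) k \<noteq> 0} \<subseteq> (\<lambda>(i, j). i + j) ` ({i. x i \<noteq> 0} \<times> {j. y j \<noteq> 0})"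
    proof
      fix k assume "k \<in> {k. (ds_mult x y $$ n) k \<noteq> 0}"
      then obtain i where "x i \<noteq> 0" "m i (k - i) (x i) (y (k - i)) $$ n \<noteq> 0"
        unfolding nth by (auto elim: sum.not_neutral_contains_not_neutral)
      then have "x i \<noteq> 0" "y (k - i) \<noteq> 0"
        by (auto simp: m_zero)
      then show "k \<in> (\<lambda>(i, j). i + j) ` ({i. x i \<noteq> 0} \<times> {j. y j \<noteq> 0})"
        by (auto intro!: rev_image_eqI[of "(i, k - i)"])
    qed
  qed (use xy D_finite in auto)
  ultimately show ?thesis
    by (simp add: direct_sum_space_def)
qed

lemma ds_mult_summand: "u \<in> S i \<Longrightarrow> v \<in> S j \<Longrightarrow>
    ds_mult (summand i u) (summand j v) $$ n = summand (i + j) (m i j u v $$ n)"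
proof
  fix k
  assume uv: "u \<in> S i" "v \<in> S j"
  have "(ds_mult (summand i u) (summand j v) $$ n) k =
      (\<Sum>l\<in>{i}. m l (k - l) (summand i u l) (summand j v (k - l)) $$ n)"
    by (rule ds_mult_nth[OF summand_mem[OF uv(1)] summand_mem[OF uv(2)]]) (auto simp: summand_def)
  then show "(ds_mult (summand i u) (summand j v) $$ n) k = summand (i + j) (m i j u v $$ n) k"
    by (auto simp: summand_def m_zero algebra_simps)
qed

lemma comp_outer_nth:
  assumes uvx: "u \<in> D" "v \<in> D" "x \<in> D"
    and A: "finite A" "{i. u i \<noteq> 0} \<subseteq> A" and B: "finite B" "{j. v j \<noteq> 0} \<subseteq> B"
  shows "comp_outer ds_mult ds_mult u v x p q l =
    (\<Sum>i\<in>A. \<Sum>j\<in>B. m i (l - i) (u i) (m j (l - i - j) (v j) (x (l - i - j)) $$ q) $$ p)"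
proof -
  have "comp_outer ds_mult ds_mult u v x p q l = (\<Sum>i\<in>A. m i (l - i) (u i) ((ds_mult v x $$ q) (l - i)) $$ p)"
    unfolding comp_outer_def by (rule ds_mult_nth[OF uvx(1) ds_mult_nth_mem[OF uvx(2,3)] A])
  \<comment> \<open>The factors 1 bring the inner sum into the shape that
    \<open>linear_on_sum\<close> expects.\<close>
  also have "\<dots> = (\<Sum>i\<in>A. m i (l - i) (u i) (\<Sum>j\<in>B. 1 *\<^sub>C (m j (l - i - j) (v j) (x (l - i - j)) $$ q)) $$ p)"
    by (simp add: ds_mult_nth[OF uvx(2,3) B])
  also have "\<dots> = (\<Sum>i\<in>A. \<Sum>j\<in>B. 1 *\<^sub>C (m i (l - i) (u i) (m j (l - i - j) (v j) (x (l - i - j)) $$ q) $$ p))"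
  proof (rule sum.cong[OF refl])
    fix i assume "i \<in> A"
    have "m j (l - i - j) (v j) (x (l - i - j)) $$ q \<in> S (l - i)" for j
      using m_mem[OF D_mem[OF uvx(2), of j] D_mem[OF uvx(3), of "l - i - j"], of q] by simp
    then show "m i (l - i) (u i) (\<Sum>j\<in>B. 1 *\<^sub>C (m j (l - i - j) (v j) (x (l - i - j)) $$ q)) $$ p =
        (\<Sum>j\<in>B. 1 *\<^sub>C (m i (l - i) (u i) (m j (l - i - j) (v j) (x (l - i - j)) $$ q) $$ p))"
      by (intro linear_on_sum[OF linear_right[OF D_mem[OF uvx(1)]] subspace])
  qed
  finally show ?thesis
    by simp
qed

lemma comp_outer_summand:
  assumes "u \<in> S i" "v \<in> S j" "x \<in> S k"
  shows "comp_outer ds_mult ds_mult (summand i u) (summand j v) (summand k x) p q =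
    summand (i + (j + k)) (comp_outer (m i (j + k)) (m j k) u v x p q)"
  using assms by (simp add: comp_outer_def ds_mult_summand m_mem)

text \<open>Locality is assumed for homogeneous vectors. In general its series is the sum, over the
  finite supports, of the homogeneous ones placed in their summands.\<close>

theorem direct_sum_vertex_algebra:
  assumes vac: "Vvac V \<in> S 0"
    and unit_left: "\<And>j x. x \<in> S j \<Longrightarrow> m 0 j (Vvac V) x = fls_const x"
    and unit_right: "\<And>i u. u \<in> S i \<Longrightarrow>
      (\<forall>n<0. m i 0 u (Vvac V) $$ n = 0) \<and> m i 0 u (Vvac V) $$ 0 = u"
    and L_right: "\<And>i j u v n. u \<in> S i \<Longrightarrow> v \<in> S j \<Longrightarrow>
      m i j u (M_L (M j) (-1) v) $$ n =
        M_L (M (i + j)) (-1) (m i j u v $$ n) - of_int (n + 1) *\<^sub>C (m i j u v $$ (n + 1))"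
    and commute: "\<And>i j k u v x. u \<in> S i \<Longrightarrow> v \<in> S j \<Longrightarrow> x \<in> S k \<Longrightarrow>
      \<exists>f\<in>zw_series_in (S (i + (j + k))).
        expand_zw f = comp_outer (m i (j + k)) (m j k) u v x \<and>
        expand_wz f = (\<lambda>p q. comp_outer (m j (i + k)) (m i k) v u x q p)"
  shows "vertex_algebra D (direct_sum_vac V) (M_L (direct_sum M) (-1)) ds_mult"
proof -
  let ?L = "M_L (direct_sum M) (-1)"
  have vac_eq: "(direct_sum_vac V :: 'a \<Rightarrow> 'v) = summand 0 (Vvac V)"
    by (simp add: direct_sum_vac_def summand_def)
  then have vac_mem: "direct_sum_vac V \<in> D"
    by (simp add: summand_mem vac)
  have L_eq: "?L x = (\<lambda>i. M_L (M i) (-1) (x i))" for x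
    by (simp add: direct_sum_def)
  have L0: "M_L (M i) (-1) 0 = 0" for i
    by (rule linear_on_0[OF L_linear subspace])
  have L_mem: "?L x \<in> D" if "x \<in> D" for x
  proof -
    have "finite {i. M_L (M i) (-1) (x i) \<noteq> 0}"
      by (rule finite_subset[OF _ D_finite[OF that]]) (auto simp: L0)
    then show ?thesis
      using D_mem[OF that] L_linear by (simp add: L_eq direct_sum_space_def linear_on_def)
  qed
  have lin: "linear_on D D (?L)"
    unfolding linear_on_def
  proof (intro conjI ballI allI)
    show "?L x \<in> D" if "x \<in> D" for x
      by (rule L_mem[OF that])
    show "?L (x + y) = ?L x + ?L y"
      if "x \<in> D" "y \<in> D" for x y
      using that L_linear by (auto simp: L_eq fun_eq_iff linear_on_def D_mem)
    show "?L (c *\<^sub>C x) = c *\<^sub>C ?L x" if "x \<in> D" for c x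
      using that L_linear by (auto simp: L_eq fun_eq_iff linear_on_def D_mem)
  qed
  have bil: "bilinear_map D D (laurent D) ds_mult"
    unfolding bilinear_map_def linear_on_def
  proof (intro conjI ballI allI impI)
    fix x y x' y' c
    show "x \<notin> D \<or> y \<notin> D \<Longrightarrow> ds_mult x y = 0"
      by (auto simp: direct_sum_mult_def)
    assume xy: "x \<in> D" "y \<in> D"
    show "ds_mult x y \<in> laurent D"
      using ds_mult_nth_mem[OF xy] by (simp add: laurent_def)
    note S = D_finite[OF xy(1)]
    show "ds_mult x (c *\<^sub>C y) = c *\<^sub>C ds_mult x y"
      using xy cvec.subspace_scale[OF subspace_D xy(2)] linear_right[OF D_mem[OF xy(1)]]
      by (simp add: fls_eq_iff fun_eq_iff ds_mult_nth[OF _ _ S] linear_on_def D_mem cvec.scale_sum_right)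
    show "ds_mult (c *\<^sub>C x) y = c *\<^sub>C ds_mult x y"
    proof -
      have "{i. (c *\<^sub>C x) i \<noteq> 0} \<subseteq> {i. x i \<noteq> 0}"
        by auto
      note nth = ds_mult_nth[OF cvec.subspace_scale[OF subspace_D xy(1)] xy(2) S this]
      show ?thesis
        using xy linear_left[OF D_mem[OF xy(2)]]
        by (simp add: fls_eq_iff fun_eq_iff ds_mult_nth[OF _ _ S] nth linear_on_def D_mem cvec.scale_sum_right)
    qed
    show "ds_mult x (y + y') = ds_mult x y + ds_mult x y'" if y': "y' \<in> D"
      using xy y' cvec.subspace_add[OF subspace_D xy(2) y'] linear_right[OF D_mem[OF xy(1)]]
      by (simp add: fls_eq_iff fun_eq_iff ds_mult_nth[OF _ _ S] linear_on_def D_mem sum.distrib)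
    show "ds_mult (x + x') y = ds_mult x y + ds_mult x' y" if x': "x' \<in> D"
    proof -
      let ?A = "{i. x i \<noteq> 0} \<union> {i. x' i \<noteq> 0}"
      have fin: "finite ?A"
        using S D_finite[OF x'] by simp
      have sub: "{i. (x + x') i \<noteq> 0} \<subseteq> ?A" "{i. x i \<noteq> 0} \<subseteq> ?A" "{i. x' i \<noteq> 0} \<subseteq> ?A"
        by auto
      note nth = ds_mult_nth[OF cvec.subspace_add[OF subspace_D xy(1) x'] xy(2) fin sub(1)]
        ds_mult_nth[OF xy fin sub(2)] ds_mult_nth[OF x' xy(2) fin sub(3)]
      show ?thesis
        using xy x' linear_left[OF D_mem[OF xy(2)]]
        by (simp only: fls_eq_iff fun_eq_iff fls_plus_nth plus_fun_apply nth)
          (simp add: linear_on_def D_mem sum.distrib)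
    qed
  qed (simp add: laurent_def ds_mult_nth_mem)
  have vac_left: "ds_mult (direct_sum_vac V) y = fls_const y" if y: "y \<in> D" for y
  proof -
    have "(ds_mult (direct_sum_vac V) y $$ n) k = (fls_const y $$ n) k" for n k
    proof -
      have "(ds_mult (direct_sum_vac V) y $$ n) k =
          (\<Sum>i\<in>{0}. m i (k - i) (direct_sum_vac V i) (y (k - i)) $$ n)"
        by (rule ds_mult_nth[OF vac_mem y]) (auto simp: direct_sum_vac_def)
      then show ?thesis
        using unit_left[OF D_mem[OF y, of k]] by (simp add: direct_sum_vac_def)
    qed
    then show ?thesis
      by (simp add: fls_eq_iff fun_eq_iff)
  qed
  have vac_right: "(ds_mult y (direct_sum_vac V) $$ n) k = m k 0 (y k) (Vvac V) $$ n" if y: "y \<in> D" for y n k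
  proof -
    \<comment> \<open>Inserting \<open>k\<close> keeps this index present even when
      \<open>y k = 0\<close>.\<close>
    have "(ds_mult y (direct_sum_vac V) $$ n) k =
        (\<Sum>i\<in>insert k {i. y i \<noteq> 0}. m i (k - i) (y i) (direct_sum_vac V (k - i)) $$ n)"
      by (rule ds_mult_nth[OF y vac_mem]) (use D_finite[OF y] in auto)
    also have "\<dots> = (\<Sum>i\<in>{k}. m i (k - i) (y i) (direct_sum_vac V (k - i)) $$ n)"
      by (rule sum.mono_neutral_right) (use D_finite[OF y] in \<open>auto simp: direct_sum_vac_def m_zero\<close>)
    finally show ?thesis
      by (simp add: direct_sum_vac_def)
  qed
  have deriv: "?L (ds_mult u v $$ n) - ds_mult u (?L v) $$ n =
      of_int (n + 1) *\<^sub>C (ds_mult u v $$ (n + 1))" if uv: "u \<in> D" "v \<in> D" for u v n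
  proof
    fix k
    note nth = ds_mult_nth[OF uv D_finite[OF uv(1)] order_refl]
      ds_mult_nth[OF uv(1) L_mem[OF uv(2)] D_finite[OF uv(1)] order_refl]
    have mem: "m i (k - i) (u i) (v (k - i)) $$ n \<in> S k" for i n
      using m_mem[OF D_mem[OF uv(1), of i] D_mem[OF uv(2), of "k - i"], of n] by simp
    have "M_L (M k) (-1) (\<Sum>i | u i \<noteq> 0. 1 *\<^sub>C (m i (k - i) (u i) (v (k - i)) $$ n)) =
        (\<Sum>i | u i \<noteq> 0. 1 *\<^sub>C M_L (M k) (-1) (m i (k - i) (u i) (v (k - i)) $$ n))"
      by (rule linear_on_sum[OF L_linear subspace mem])
    moreover have "m i (k - i) (u i) (M_L (M (k - i)) (-1) (v (k - i))) $$ n =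
        M_L (M k) (-1) (m i (k - i) (u i) (v (k - i)) $$ n) -
        of_int (n + 1) *\<^sub>C (m i (k - i) (u i) (v (k - i)) $$ (n + 1))" for i
      using L_right[OF D_mem[OF uv(1), of i] D_mem[OF uv(2), of "k - i"], of n] by simp
    ultimately show "(?L (ds_mult u v $$ n) - ds_mult u (?L v) $$ n) k =
      (of_int (n + 1) *\<^sub>C (ds_mult u v $$ (n + 1))) k"
      by (simp add: L_eq nth[unfolded L_eq] sum_subtractf cvec.scale_sum_right del: of_int_add)
  qed
  have locality: "\<exists>f\<in>zw_series_in D. expand_zw f = comp_outer ds_mult ds_mult u v x \<and>
        expand_wz f = (\<lambda>p q. comp_outer ds_mult ds_mult v u x q p)"
    if uvx: "u \<in> D" "v \<in> D" "x \<in> D" for u v x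
  proof -
    define A B C where "A = {i. u i \<noteq> 0}" and "B = {j. v j \<noteq> 0}" and "C = {k. x k \<noteq> 0}"
    have fin: "finite A" "finite B" "finite C"
      using uvx D_finite by (simp_all add: A_def B_def C_def)
    have "\<exists>f\<in>zw_series_in D.
        (\<forall>p q. expand_zw f p q = summand (i + (j + k)) (comp_outer (m i (j + k)) (m j k) (u i) (v j) (x k) p q)) \<and>
        (\<forall>p q. expand_wz f p q = summand (i + (j + k)) (comp_outer (m j (i + k)) (m i k) (v j) (u i) (x k) q p))"
      for i j k
    proof -
      obtain f where f: "f \<in> zw_series_in (S (i + (j + k)))"
        "expand_zw f = comp_outer (m i (j + k)) (m j k) (u i) (v j) (x k)"
        "expand_wz f = (\<lambda>p q. comp_outer (m j (i + k)) (m i k) (v j) (u i) (x k) q p)"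
        using commute[OF D_mem[OF uvx(1), of i] D_mem[OF uvx(2), of j] D_mem[OF uvx(3), of k]] by blast
      obtain f' where "f' \<in> zw_series_in D"
        "\<And>p q. expand_zw f' p q = summand (i + (j + k)) (expand_zw f p q)"
        "\<And>p q. expand_wz f' p q = summand (i + (j + k)) (expand_wz f p q)"
        by (rule zw_series_map[OF linear_on_summand subspace f(1)]) blast
      then show ?thesis
        by (auto simp: f)
    qed
    then obtain F where F: "\<And>i j k. F i j k \<in> zw_series_in D"
      "\<And>i j k p q. expand_zw (F i j k) p q = summand (i + (j + k)) (comp_outer (m i (j + k)) (m j k) (u i) (v j) (x k) p q)"
      "\<And>i j k p q. expand_wz (F i j k) p q = summand (i + (j + k)) (comp_outer (m j (i + k)) (m i k) (v j) (u i) (x k) q p)"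
      by metis
    have sum_C: "(\<Sum>k\<in>C. summand (i + (j + k)) (G k) l) = G (l - i - j)"
      if "\<And>k. x k = 0 \<Longrightarrow> G k = 0" for i j l and G :: "'a \<Rightarrow> 'v"
    proof -
      have "(\<Sum>k\<in>C. summand (i + (j + k)) (G k) l) = (\<Sum>k\<in>C. if k = l - i - j then G k else 0)"
        by (rule sum.cong) (auto simp: summand_def algebra_simps)
      also have "\<dots> = G (l - i - j)"
        using fin that by (auto simp: C_def)
      finally show ?thesis .
    qed
    have zw: "(\<Sum>k\<in>C. summand (i + (j + k)) (comp_outer (m i (j + k)) (m j k) (u i) (v j) (x k) p q) l) =
        m i (l - i) (u i) (m j (l - i - j) (v j) (x (l - i - j)) $$ q) $$ p" for i j l p q
      by (subst sum_C) (simp_all add: comp_outer_def m_zero)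
    have wz: "(\<Sum>k\<in>C. summand (i + (j + k)) (comp_outer (m j (i + k)) (m i k) (v j) (u i) (x k) q p) l) =
        m j (l - j) (v j) (m i (l - j - i) (u i) (x (l - j - i)) $$ p) $$ q" for i j l p q
    proof -
      have e: "l - i - j = l - j - i"
        by (simp add: algebra_simps)
      show ?thesis
        by (subst sum_C) (simp_all add: comp_outer_def m_zero e)
    qed
    define f where "f = (\<Sum>i\<in>A. \<Sum>j\<in>B. \<Sum>k\<in>C. F i j k)"
    have "f \<in> zw_series_in D"
      unfolding f_def by (intro cvec.subspace_sum[OF subspace_zw_series_in[OF subspace_D]] F)
    moreover have "expand_zw f p q l = comp_outer ds_mult ds_mult u v x p q l" for p q l
      by (subst comp_outer_nth[OF uvx fin(1) _ fin(2)])
        (simp_all add: f_def expand_sum F sum_fun_apply zw, simp_all add: A_def B_def)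
    moreover have "expand_wz f p q l = comp_outer ds_mult ds_mult v u x q p l" for p q l
      by (subst comp_outer_nth[OF uvx(2,1,3) fin(2) _ fin(1)])
        (simp_all add: f_def expand_sum F sum_fun_apply wz sum.swap[of _ A B], simp_all add: A_def B_def)
    ultimately show ?thesis
      by (auto simp: fun_eq_iff)
  qed
  show ?thesis
    unfolding vertex_algebra_def
    using subspace_D vac_mem lin bil vac_left vac_right unit_right D_mem deriv locality
    by (auto simp: fun_eq_iff)
qed

end

section \<open>The main theorem\<close>

text \<open>Evenness is a property of the line spanned by an operator, so any nonzero element of a
  one-dimensional space can test it.\<close>

lemma even_operator_scale:
  fixes I :: "'a \<Rightarrow> 'a \<Rightarrow> 'b::complex_vector fls"
  assumes "c \<noteq> 0"
  shows "even_operator X (c *\<^sub>C I) \<longleftrightarrow> even_operator X I"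
proof -
  have nz: "c *\<^sub>C F = 0 \<longleftrightarrow> F = 0" for F :: "'b fls"
    using assms by simp
  have "fls_subdegree (c *\<^sub>C F) = fls_subdegree F" for F :: "'b fls"
  proof (cases "F = 0")
    case False
    then show ?thesis
      using assms by (intro fls_subdegree_eqI) simp_all
  qed simp
  then show ?thesis
    unfolding even_operator_def scaleC_fun_apply nz by simp
qed

theorem corollary2p3p8:
  fixes T :: "'g setting"
    and V :: "('g, 'v::complex_vector) va_data"
    and M :: "'a::ab_group_add \<Rightarrow> ('g, 'v, 'v) mod_data"
    and \<I> :: "'a \<Rightarrow> 'a \<Rightarrow> ('v \<Rightarrow> 'v \<Rightarrow> 'v fls) set"
  assumes "T_vertex_algebra T V"
    and "M 0 = adjoint_module V"
    and "\<forall>i. T_module T V (M i)"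
    and "T_compatible T V M"
    and "commutativity_datum T V M \<I>"
  shows "(\<exists>m. (\<forall>i j. m i j \<in> \<I> i j \<and> m i j \<noteq> 0) \<and>
           vertex_algebra (Mspace (direct_sum M)) (direct_sum_vac V) (M_L (direct_sum M) (-1))
             (direct_sum_mult M m)) \<longleftrightarrow>
         (\<forall>k. \<exists>i\<in>{a + a + k | a. True}. \<exists>m\<in>\<I> i i. m \<noteq> 0 \<and> even_operator (Mspace (M i)) m)"
proof -
  let ?S = "\<lambda>i. Mspace (M i)" and ?L = "M_L (direct_sum M) (-1)"
  have assoc: "associativity_datum T V M \<I>"
    using assms(5) by (simp add: commutativity_datum_def)
  have one: "one_dimensional (\<I> i j)" for i j
    using assoc by (simp add: associativity_datum_def)
  have op: "intertwining_operator T V (M i) (M j) (M (i + j)) n" if "n \<in> \<I> i j" for i j n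
    using assoc that by (auto simp: associativity_datum_def)
  have va: "va_module V (M i)" for i
    using assms(3) T_module_va_module by blast
  have subspace: "cvec.subspace (?S i)"
    and L_linear: "linear_on (?S i) (?S i) (M_L (M i) (-1))" for i
    using va[of i] by (auto simp: va_module_def)
  have graded_bilinear: "graded_bilinear M m" if "\<And>i j. m i j \<in> \<I> i j" for m
    by unfold_locales (rule subspace L_linear intertwining_operatorD(1)[OF op[OF that]])+
  have D: "Mspace (direct_sum M) = direct_sum_space M"
    by (simp add: direct_sum_def)
  show ?thesis
    unfolding D
  proof
    assume "\<exists>m. (\<forall>i j. m i j \<in> \<I> i j \<and> m i j \<noteq> 0) \<and>
           vertex_algebra (direct_sum_space M) (direct_sum_vac V) (?L) (direct_sum_mult M m)"
    then obtain m where m: "\<And>i j. m i j \<in> \<I> i j" "\<And>i j. m i j \<noteq> 0"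
      and vert: "vertex_algebra (direct_sum_space M) (direct_sum_vac V) (?L) (direct_sum_mult M m)"
      by blast
    obtain \<alpha> \<Omega> where "graded_product ?S (\<lambda>i. M_L (M i) (-1)) m \<alpha> \<Omega>"
      by (rule commutativity_datum_graded_product[OF assms(5,3) m])
    then interpret P: graded_product "?S" "\<lambda>i. M_L (M i) (-1)" m \<alpha> \<Omega> .
    interpret B: graded_bilinear M m
      by (rule graded_bilinear[OF m(1)])
    have "even_operator (?S i) (m i i)" for i
    proof -
      \<comment> \<open>With equal first indices the associators in \<open>expand_wz_assoc\<close>
        cancel, so only \<open>\<Omega> i i\<close> is left; locality then makes it fix a nonzero
        series.\<close>
      obtain u v x p0 q0 where uvx: "u \<in> ?S i" "v \<in> ?S i" "x \<in> ?S 0"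
        and nz: "comp_outer (m i (i + 0)) (m i 0) u v x p0 q0 \<noteq> 0"
        using P.assoc_nonzero[of i i 0] by blast
      obtain f where f: "expand_zw f = comp_outer (m i (i + 0)) (m i 0) u v x"
        using P.assoc[OF uvx] by blast
      have wz: "expand_wz f p q = \<Omega> i i *\<^sub>C comp_outer (m i (i + 0)) (m i 0) v u x q p" for p q
        using P.expand_wz_assoc[OF uvx f] P.\<alpha>_nonzero[of i i 0] by simp
      obtain h where h: "h \<in> zw_series_in B.D"
        "expand_zw h = comp_outer B.ds_mult B.ds_mult (summand i u) (summand i v) (summand 0 x)"
        "expand_wz h = (\<lambda>p q. comp_outer B.ds_mult B.ds_mult (summand i v) (summand i u) (summand 0 x) q p)"
        using vert uvx B.summand_mem unfolding vertex_algebra_def by blast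
      obtain h' where h': "\<And>p q. expand_zw h' p q = expand_zw h p q (i + (i + 0))"
        "\<And>p q. expand_wz h' p q = expand_wz h p q (i + (i + 0))"
        by (rule zw_series_map[OF B.linear_on_component[of "i + (i + 0)"] B.subspace_D h(1)]) blast
      have "expand_zw h' p q = expand_zw f p q" for p q
        unfolding h' h f by (subst B.comp_outer_summand[OF uvx]) (simp add: summand_def)
      then have "h' = f"
        by (intro expand_inject) (simp add: fun_eq_iff)
      then have "expand_wz f p q = comp_outer (m i (i + 0)) (m i 0) v u x q p" for p q
        using h'(2)[of p q] unfolding h
        by (subst (asm) B.comp_outer_summand[OF uvx(2,1,3)]) (simp add: summand_def)
      then have fixed: "\<Omega> i i *\<^sub>C expand_wz f p q = expand_wz f p q" for p q
        using wz[of p q] by simp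
      have "f \<noteq> 0"
        using nz f expand_zero by metis
      then have "expand_wz f \<noteq> expand_wz 0"
        using expand_inject by blast
      then obtain p q where "expand_wz f p q \<noteq> 0"
        by (auto simp: fun_eq_iff expand_zero)
      then have "\<Omega> i i = 1"
        using fixed[of p q] by (metis cvec.scale_cancel_right cvec.scale_one)
      then show ?thesis
        by (simp add: P.even_operator_iff)
    qed
    then have "\<exists>m\<in>\<I> k k. m \<noteq> 0 \<and> even_operator (?S k) m" for k
      using m by blast
    moreover have "k \<in> {a + a + k | a. True}" for k :: 'a
      by (auto intro: exI[of _ 0])
    ultimately show "\<forall>k. \<exists>i\<in>{a + a + k | a. True}. \<exists>m\<in>\<I> i i. m \<noteq> 0 \<and> even_operator (?S i) m"
      by blast
  next
    assume even: "\<forall>k. \<exists>i\<in>{a + a + k | a. True}. \<exists>m\<in>\<I> i i. m \<noteq> 0 \<and> even_operator (?S i) m"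
    have span: "\<I> 0 i = cvec.span {Mact (M i)}" for i
      using assoc by (simp add: associativity_datum_def)
    have act: "Mact (M i) \<in> \<I> 0 i" "Mact (M i) \<noteq> 0" for i
      using one[of 0 i] one_dimensional_span unfolding span by (auto intro: cvec.span_base)
    \<comment> \<open>At \<open>i = 0\<close> the operator is the module action itself, which yields
      both the unit axiom and \<open>\<alpha> 0 j k = 1\<close>.\<close>
    define g where "g i j = (if i = 0 then Mact (M j) else SOME n. n \<in> \<I> i j \<and> n \<noteq> 0)" for i j
    have g: "g i j \<in> \<I> i j \<and> g i j \<noteq> 0" for i j
    proof (cases "i = 0")
      case False
      have "\<exists>n. n \<in> \<I> i j \<and> n \<noteq> 0"
        using one_dimensional_nonzero[OF one[of i j]] by blast
      from someI_ex[OF this] False show ?thesis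
        by (simp add: g_def)
    qed (simp add: g_def act)
    obtain \<beta> \<Psi> where "graded_product ?S (\<lambda>i. M_L (M i) (-1)) g \<beta> \<Psi>"
      by (rule commutativity_datum_graded_product[OF assms(5,3)]) (use g in blast)+
    then interpret G: graded_product "?S" "\<lambda>i. M_L (M i) (-1)" g \<beta> \<Psi> .
    \<comment> \<open>Evenness depends only on the line, and \<open>\<Psi> k k\<close> only on the
      coset of \<open>k\<close>, so one even operator per coset settles every
      \<open>k\<close>.\<close>
    have \<Psi>: "\<Psi> k k = 1" for k
    proof -
      obtain a n where n: "n \<in> \<I> (a + a + k) (a + a + k)" "n \<noteq> 0" "even_operator (?S (a + a + k)) n"
        using even by blast
      obtain c where c: "n = c *\<^sub>C g (a + a + k) (a + a + k)"
        by (rule one_dimensional_multiple[OF one _ _ n(1)]) (use g in blast)+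
      with n(2) have "c \<noteq> 0"
        by auto
      then have "even_operator (?S (a + a + k)) (g (a + a + k) (a + a + k))"
        using n(3) even_operator_scale unfolding c by blast
      then show ?thesis
        by (simp add: G.even_operator_iff G.\<Omega>_diagonal_coset)
    qed
    obtain r :: "'a rel" where r: "well_order r"
      using well_ordering by (metis (full_types))
    \<comment> \<open>A total order with 0 put first, so that the pairs \<open>(0, j)\<close> keep
      the module action.\<close>
    define R where "R i j \<longleftrightarrow> i = 0 \<or> i = j \<or> (j \<noteq> 0 \<and> (i, j) \<in> r)" for i j
    have R: "R i j \<longleftrightarrow> \<not> R j i" if "i \<noteq> j" for i j
      using that r unfolding R_def well_order_on_def linear_order_on_def partial_order_on_def total_on_def antisym_def
      by blast
    have R_refl: "R i i" "R 0 i" for i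
      by (simp_all add: R_def)
    \<comment> \<open>Taking skews for the pairs in the wrong order makes
      \<open>\<Omega> i j = 1\<close> for distinct indices. On the diagonal no such choice exists;
      there \<open>\<Psi>\<close> is needed.\<close>
    define n where "n i j = (if R i j then g i j else skew (M_L (M (j + i)) (-1)) (g j i))" for i j
    have n: "n i j \<in> \<I> i j \<and> n i j \<noteq> 0" for i j
    proof (cases "R i j")
      case False
      have "skew (M_L (M (j + i)) (-1)) (g j i) \<in> \<I> i j"
        using g[of j i] assms(5) by (simp add: commutativity_datum_def)
      moreover have "skew (M_L (M (j + i)) (-1)) (g j i) \<noteq> 0"
        using g[of i j] G.\<Omega>_nonzero[of j i] by (simp add: G.skew)
      ultimately show ?thesis
        using False by (simp add: n_def)
    qed (simp add: n_def g)
    obtain \<alpha> \<Omega> where "graded_product ?S (\<lambda>i. M_L (M i) (-1)) n \<alpha> \<Omega>"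
      by (rule commutativity_datum_graded_product[OF assms(5,3)]) (use n in blast)+
    then interpret P: graded_product "?S" "\<lambda>i. M_L (M i) (-1)" n \<alpha> \<Omega> .
    have \<Omega>_R: "\<Omega> i j = 1" if "R i j" for i j
    proof -
      have "skew (M_L (M (i + j)) (-1)) (n i j) = n j i"
      proof (cases "i = j")
        case True
        then show ?thesis
          using G.skew[of i i] by (simp add: n_def R_refl \<Psi>)
      next
        case False
        then show ?thesis
          using that R[of i j] by (simp add: n_def)
      qed
      then have "\<Omega> i j *\<^sub>C n j i = 1 *\<^sub>C n j i"
        using P.skew[of i j] by simp
      then show ?thesis
        using n[of j i] cvec.scale_cancel_right by blast
    qed
    have \<Omega>: "\<Omega> i j = 1" for i j
      using \<Omega>_R[of i j] \<Omega>_R[of j i] P.\<Omega>_sym[of i j] R[of i j] R_refl by (cases "i = j") auto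
    have n_0: "n 0 j = Mact (M j)" for j
      by (simp add: n_def R_refl g_def)
    have V: "?S 0 = Vspace V"
      using assms(2) by (simp add: adjoint_module_def)
    \<comment> \<open>The compatibility of an intertwining operator with the action of V is
      associativity with scalar exactly 1.\<close>
    have \<alpha>_0: "\<alpha> 0 j k = 1" for j k
    proof -
      obtain a u v p0 q0 where auv: "a \<in> ?S 0" "u \<in> ?S j" "v \<in> ?S k"
        and nz: "comp_outer (n 0 (j + k)) (n j k) a u v p0 q0 \<noteq> 0"
        using P.assoc_nonzero[of 0 j k] by blast
      obtain f where f: "expand_zw f = comp_outer (n 0 (j + k)) (n j k) a u v"
        "expand_w_diff f = (\<lambda>p q. \<alpha> 0 j k *\<^sub>C comp_inner (n (0 + j) k) (n 0 j) a u v p q)"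
        using P.assoc[OF auv] by blast
      obtain h where h: "expand_zw h = comp_outer (Mact (M (j + k))) (n j k) a u v"
        "expand_w_diff h = comp_inner (n j k) (Mact (M j)) a u v"
        using intertwining_operatorD(4)[OF op[OF n[THEN conjunct1, of j k]] auv[unfolded V]] by blast
      have "h = f"
        by (rule expand_inject) (simp add: f h n_0)
      have "f \<noteq> 0"
        using nz f(1) expand_zero by metis
      then have "expand_w_diff f \<noteq> expand_w_diff 0"
        using expand_inject by blast
      then obtain p q where "expand_w_diff f p q \<noteq> 0"
        by (auto simp: fun_eq_iff expand_zero)
      moreover have "\<alpha> 0 j k *\<^sub>C expand_w_diff f p q = 1 *\<^sub>C expand_w_diff f p q"
        using fun_cong[OF fun_cong[OF f(2), of p], of q] by (simp add: h[unfolded \<open>h = f\<close>] n_0)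
      ultimately show ?thesis
        using cvec.scale_cancel_right by blast
    qed
    interpret \<alpha>: symmetric_cocycle \<alpha>
    proof
      fix i j k l
      show "\<alpha> i j k \<noteq> 0"
        by (rule P.\<alpha>_nonzero)
      show "\<alpha> i j (k + l) * \<alpha> (i + j) k l = \<alpha> j k l * \<alpha> i (j + k) l * \<alpha> i j k"
        by (rule P.pentagon)
      show "\<alpha> i j k = \<alpha> i k j * \<alpha> j i k"
        using P.hexagon[of i j k] by (simp add: \<Omega>)
      show "\<alpha> 0 j k = 1"
        by (rule \<alpha>_0)
    qed
    obtain c where c: "\<And>i j. c i j \<noteq> 0" "\<And>i j. c i j = c j i" "\<And>j. c 0 j = 1"
      "\<And>i j k. \<alpha> i j k * c j k * c i (j + k) = c i j * c (i + j) k"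
      by (rule \<alpha>.trivial) blast
    define m where "m i j = c i j *\<^sub>C n i j" for i j
    have m: "m i j \<in> \<I> i j \<and> m i j \<noteq> 0" for i j
      using n[of i j] c(1)[of i j] one[of i j] cvec.subspace_scale by (auto simp: m_def one_dimensional_def)
    interpret B: graded_bilinear M m
      by (rule graded_bilinear) (use m in blast)
    have outer: "comp_outer (m i (j + k)) (m j k) u v x p q =
        (c j k * c i (j + k)) *\<^sub>C comp_outer (n i (j + k)) (n j k) u v x p q"
      if "u \<in> ?S i" "v \<in> ?S j" "x \<in> ?S k" for i j k u v x p q
      using P.linear_right[OF that(1), of "j + k" p] P.mem[OF that(2,3), of q]
      by (simp add: comp_outer_def m_def linear_on_def mult.commute)
    have "vertex_algebra B.D (direct_sum_vac V) (?L) B.ds_mult"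
    proof (rule B.direct_sum_vertex_algebra)
      have "underlying_va V"
        by (rule T_vertex_algebra_underlying[OF assms(1)])
      then show vac: "Vvac V \<in> ?S 0"
        by (simp add: V underlying_va_def vertex_algebra_def)
      show left: "m 0 j (Vvac V) x = fls_const x" if "x \<in> ?S j" for j x
        using va[of j] that by (simp add: m_def c n_0 va_module_def)
      show "(\<forall>k<0. m i 0 u (Vvac V) $$ k = 0) \<and> m i 0 u (Vvac V) $$ 0 = u" if u: "u \<in> ?S i" for i u
      proof -
        have n_left: "n 0 i (Vvac V) u = fls_const u"
          using left[OF u] by (simp add: m_def c)
        \<comment> \<open>The right unit law is skew to the left one: the constant series starts at
          exponent 0, so up to there the exponential does not intervene.\<close>
        have "n i 0 u (Vvac V) $$ k = (-1) powi k *\<^sub>C (fls_const u $$ k)" if "k \<le> 0" for k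
          using P.skew_leading[OF vac u, of k] that by (simp add: n_left \<Omega>)
        then show ?thesis
          using c(2)[of i 0] by (simp add: m_def c(3))
      qed
      show "m i j u (M_L (M j) (-1) v) $$ k =
          M_L (M (i + j)) (-1) (m i j u v $$ k) - of_int (k + 1) *\<^sub>C (m i j u v $$ (k + 1))"
        if "u \<in> ?S i" "v \<in> ?S j" for i j u v k
        by (rule intertwining_operatorD(3)[OF op that]) (use m in blast)
      show "\<exists>f\<in>zw_series_in (?S (i + (j + k))).
          expand_zw f = comp_outer (m i (j + k)) (m j k) u v x \<and>
          expand_wz f = (\<lambda>p q. comp_outer (m j (i + k)) (m i k) v u x q p)"
        if uvx: "u \<in> ?S i" "v \<in> ?S j" "x \<in> ?S k" for i j k u v x
      proof -
        obtain f where f: "f \<in> zw_series_in (?S (i + (j + k)))"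
          "expand_zw f = comp_outer (n i (j + k)) (n j k) u v x"
          using P.assoc[OF uvx] by (auto simp: add.assoc)
        let ?h = "(c j k * c i (j + k)) *\<^sub>C f"
        have "?h \<in> zw_series_in (?S (i + (j + k)))"
          by (rule cvec.subspace_scale[OF subspace_zw_series_in[OF subspace] f(1)])
        moreover have "expand_zw ?h p q = comp_outer (m i (j + k)) (m j k) u v x p q" for p q
          by (simp add: expand_scale f outer[OF uvx])
        moreover have "expand_wz ?h p q = comp_outer (m j (i + k)) (m i k) v u x q p" for p q
        proof -
          \<comment> \<open>By symmetry of \<open>c\<close> two instances of the coboundary equation
            share their right-hand side; their comparison cancels the factor in
            \<open>expand_wz_assoc\<close>.\<close>
          have "\<alpha> i j k * (c j k * c i (j + k)) = \<alpha> j i k * (c i k * c j (i + k))"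
            using c(4)[of i j k] c(4)[of j i k] c(2)[of i j] by (simp add: add.commute mult.assoc)
          then have "c j k * c i (j + k) * (\<alpha> i j k / \<alpha> j i k) = c i k * c j (i + k)"
            using P.\<alpha>_nonzero[of j i k] by (simp add: field_simps)
          then show ?thesis
            by (simp add: expand_scale P.expand_wz_assoc[OF uvx f(2)] \<Omega> outer[OF uvx(2,1,3)])
        qed
        ultimately show ?thesis
          by (auto simp: fun_eq_iff)
      qed
    qed
    with m show "\<exists>m. (\<forall>i j. m i j \<in> \<I> i j \<and> m i j \<noteq> 0) \<and>
           vertex_algebra (direct_sum_space M) (direct_sum_vac V) (?L) (direct_sum_mult M m)"
      by blast
  qed
qed

end
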